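(* Consider the microgrid system augmented with the distributed integrators, $$L_t\dot I_t=-R_tI_t-V+u,\quad C_t\dot V=I_t+\mathcal{B}I-I_L,\quad L\dot I=-\mathcal{B}^TV-RI,\quad \dot\theta=-\mathcal{L}_cWI_t ,$$ where all parameter matrices and the current demand $I_L\in\mathbb{R}^n$ are constant, $V^\star\in\mathbb{R}^n$ is a given constant vector of desired reference voltages, $\mathbb{1}_n^T\theta(0)=0$, and the communication graph is undirected and connected. Let the input $u$ be generated either by the distributed SSOSM control scheme or by the distributed 3SM control scheme (both defined in the context, including the standing boundedness assumptions on the uncertain terms). Then there is a finite time $T_r$ such that $$\mathbb{1}_n^TW^{-1}V(t)=\mathbb{1}_n^TW^{-1}V^\star\qquad\text{for all } t\ge T_r .$$
   Context: Notation. $\mathbb{1}_n\in\mathbb{R}^n$ is the all-ones vector. The electrical network is a connected undirected graph with node set $\mathcal V=\{1,\dots,n\}$ and $m$ edges; $\mathcal{B}\in\mathbb{R}^{n\times m}$ is its incidence matrix for an arbitrary orientation ($\mathcal B_{ik}=+1$ if $i$ is the positive end of edge $k$, $-1$ if the negative end, $0$ otherwise). $I_t,V,\theta,u\in\mathbb{R}^n$, $I\in\mathbb{R}^m$. $L_t,R_t,C_t\in\mathbb{R}^{n\times n}$ and $L,R\in\mathbb{R}^{m\times m}$ are positive definite diagonal matrices. $W=\mathrm{diag}(w_1,\dots,w_n)$ with $w_i>0$. $\mathcal{L}_c=\mathcal{D}_c-\mathcal{A}_c\in\mathbb{R}^{n\times n}$ is the weighted Laplacian of the communication graph on the nodes $1,\dots,n$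 (edge weights $\gamma_{ij}=\gamma_{ji}>0$), with $\mathcal D_c$ the (diagonal) weighted degree matrix and $\mathcal A_c$ the weighted adjacency matrix. Parameters and $I_L$ are unknown to the controller, but with known bounds. Solutions of the discontinuous closed loops are understood in the usual sense of sliding mode control (Filippov). Sliding function: $\sigma=W^{-1}(V-V^\star)-\theta\in\mathbb{R}^n$. Put $\xi_1=\sigma$, $\xi_2=\dot\sigma$. Then $\dot\xi_1=\xi_2$, $\dot\xi_2=b+G_du$, with $G_d=(W^{-1}C_t^{-1}+\mathcal D_cW)L_t^{-1}$, $G_a=\mathcal A_cWL_t^{-1}$ and $$b=-(W^{-1}C_t^{-1}+\mathcal L_cW)L_t^{-1}R_tI_t-\big((W^{-1}C_t^{-1}+\mathcal L_cW)L_t^{-1}+W^{-1}C_t^{-1}\mathcal BL^{-1}\mathcal B^T\big)V-W^{-1}C_t^{-1}\mathcal BL^{-1}RI-G_au .$$ Standing assumption: there are known positive constants with $G_{\min_i}\le G_{d_i}\le G_{\max_i}$ for all $i\in\mathcal V$, where $G_{d_i}$ is the $i$-th diagonal entry of $G_d$. Distributed SSOSM (suboptimal second order sliding mode) scheme. Standing assumption: $|b_i|\le b_{\max_i}$ for known positive constants $b_{\max_i}$. For each $i$, $$u_i=-\mu_iU_{\max_i}\,\mathrm{sgn}\big(\xi_{1_i}-\tfrac12\xi_{1_i}^{\max}\big),\quad U_{\max_i}>\max\Big(\frac{b_{\max_i}}{\mu_i^*G_{\min_i}},\frac{4b_{\max_i}}{3G_{\min_i}-\mu_i^*G_{\max_i}}\Big),\quad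 \mu_i^*\in(0,1]\cap\Big(0,\frac{3G_{\min_i}}{G_{\max_i}}\Big),$$ where $\xi_{1_i}^{\max}$ is initialized at $\xi_{1_i}(0)$ and updated to the current value of $\xi_{1_i}$ each time $\xi_{1_i}$ attains a local extremum, and $\mu_i=\mu_i^*$ if $(\xi_{1_i}-\frac12\xi_{1_i}^{\max})(\xi_{1_i}^{\max}-\xi_{1_i})>0$, $\mu_i=1$ otherwise. Distributed 3SM (third order sliding mode) scheme. The input is $\dot u=v$, $u(t)=\int_0^tv(\tau)\,d\tau$. With $\xi_3=\ddot\sigma$ one has $\dot\xi_3=\dot b+G_dv$. Standing assumption: $|\dot b_i|\le\beta_{\max_i}$ for known positive constants $\beta_{\max_i}$. Choose $\alpha_i>0$ with $\alpha_{r_i}:=\alpha_iG_{\min_i}-\beta_{\max_i}>0$. Write $\boldsymbol\sigma_i=(\sigma_i,\dot\sigma_i,\ddot\sigma_i)$, $v_{1_i}=\mathrm{sgn}(\ddot\sigma_i)$, $v_{2_i}=\mathrm{sgn}\big(\dot\sigma_i+\frac{\ddot\sigma_i^2v_{1_i}}{2\alpha_{r_i}}\big)$, $v_{3_i}=\mathrm{sgn}(s_i(\boldsymbol\sigma_i))$, where $$s_i(\boldsymbol\sigma_i)=\sigma_i+\frac{\ddot\sigma_i^3}{3\alpha_{r_i}^2}+v_{2_i}\Big[\frac{1}{\sqrt{\alpha_{r_i}}}\Big(v_{2_i}\dot\sigma_i+\frac{\ddot\sigma_i^2}{2\alpha_{r_i}}\Big)^{3/2}+\frac{\dot\sigma_i\ddot\sigma_i}{\alpha_{r_i}}\Big].$$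 Let $\mathcal M_{0_i}=\{\sigma_i=\dot\sigma_i=\ddot\sigma_i=0\}$, $\mathcal M_{1_i}=\{\sigma_i-\frac{\ddot\sigma_i^3}{6\alpha_{r_i}^2}=0,\ \dot\sigma_i+\frac{\ddot\sigma_i|\ddot\sigma_i|}{2\alpha_{r_i}}=0\}$, $\mathcal M_{2_i}=\{s_i(\boldsymbol\sigma_i)=0\}$ (subsets of $\mathbb R^3$). The control is $v_i=-\alpha_iv_{1_i}$ on $\mathcal M_{1_i}\setminus\mathcal M_{0_i}$, $v_i=-\alpha_iv_{2_i}$ on $\mathcal M_{2_i}\setminus\mathcal M_{1_i}$, and $v_i=-\alpha_iv_{3_i}$ otherwise. In this law $\sigma_i,\dot\sigma_i,\ddot\sigma_i$ are replaced by estimates $\hat\xi_{1_i},\hat\xi_{2_i},\hat\xi_{3_i}$ from Levant's differentiator $$\dot{\hat\xi}_{1_i}=-\lambda_{0_i}|\hat\xi_{1_i}-\xi_{1_i}|^{2/3}\mathrm{sgn}(\hat\xi_{1_i}-\xi_{1_i})+\hat\xi_{2_i},\quad \dot{\hat\xi}_{2_i}=-\lambda_{1_i}|\hat\xi_{2_i}-\dot{\hat\xi}_{1_i}|^{1/2}\mathrm{sgn}(\hat\xi_{2_i}-\dot{\hat\xi}_{1_i})+\hat\xi_{3_i},\quad \dot{\hat\xi}_{3_i}=-\lambda_{2_i}\mathrm{sgn}(\hat\xi_{3_i}-\dot{\hat\xi}_{2_i}),$$ with $\lambda_{0_i}=3\Lambda_i^{1/3}$, $\lambda_{1_i}=1.5\Lambda_i^{1/2}$,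 $\lambda_{2_i}=1.1\Lambda_i$, where $\Lambda_i>0$ is chosen as prescribed for this differentiator, so that the estimates coincide with $\sigma_i,\dot\sigma_i,\ddot\sigma_i$ after a finite time. *)

theory Defs
  imports "HOL-Analysis.Analysis"
begin

section \<open>Solutions of discontinuous differential equations\<close>

text \<open>Filippov's convexification of a vector field, at a point \<open>x\<close>.\<close>

definition filippov :: "('a::euclidean_space \<Rightarrow> 'a) \<Rightarrow> 'a \<Rightarrow> 'a set" where
  "filippov f x =
    (\<Inter>\<delta>\<in>{0<..}. \<Inter>N\<in>{N. negligible N}. closure (convex hull (f ` (ball x \<delta> - N))))"

text \<open>\<open>x\<close> is locally absolutely continuous on \<open>[0, \<infinity>)\<close> with almost everywhere
  derivative \<open>x'\<close>.\<close>

definition has_ac_derivative ::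
    "(real \<Rightarrow> 'a::euclidean_space) \<Rightarrow> (real \<Rightarrow> 'a) \<Rightarrow> bool" where
  "has_ac_derivative x x' \<longleftrightarrow>
    (\<forall>T\<ge>0. x' absolutely_integrable_on {0..T} \<and> x T = x 0 + integral {0..T} x')"

definition filippov_solution ::
    "(real \<Rightarrow> 'a::euclidean_space \<Rightarrow> 'a) \<Rightarrow> (real \<Rightarrow> 'a) \<Rightarrow> (real \<Rightarrow> 'a) \<Rightarrow> bool" where
  "filippov_solution f x x' \<longleftrightarrow>
    has_ac_derivative x x' \<and> (AE t in lebesgue. t \<ge> 0 \<longrightarrow> x' t \<in> filippov (f t) (x t))"


section \<open>The microgrid\<close>

text \<open>The line \<open>k \<in> lines\<close> has positive end \<open>pos_end k\<close> and negative end \<open>neg_end k\<close>.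
  In general \<open>lines = UNIV\<close>. A proper subset is admitted only because index types are nonempty,
  whereas a one-node network has no line: an index outside \<open>lines\<close> has a zero column in the
  incidence matrix, hence a current that is decoupled from the network.\<close>

record ('n::finite, 'm::finite) microgrid =
  L\<^sub>t :: "real^'n^'n"
  R\<^sub>t :: "real^'n^'n"
  C\<^sub>t :: "real^'n^'n"
  L\<^sub>l :: "real^'m^'m"
  R\<^sub>l :: "real^'m^'m"
  weight :: "real^'n"
  lines :: "'m set"
  pos_end :: "'m \<Rightarrow> 'n"
  neg_end :: "'m \<Rightarrow> 'n"
  comm_edges :: "('n \<times> 'n) set"
  comm_weight :: "'n \<Rightarrow> 'n \<Rightarrow> real"
  I\<^sub>L :: "real^'n"
  V_ref :: "real^'n"

definition diag_mat :: "real^'n \<Rightarrow> real^'n^'n" where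
  "diag_mat d = (\<chi> i j. if i = j then d $ i else 0)"

definition pos_def_diagonal :: "real^'n^'n \<Rightarrow> bool" where
  "pos_def_diagonal A \<longleftrightarrow>
    (\<forall>i j. i \<noteq> j \<longrightarrow> A $ i $ j = 0) \<and> (\<forall>x. x \<noteq> 0 \<longrightarrow> 0 < x \<bullet> (A *v x))"

definition W_mat :: "('n::finite, 'm::finite) microgrid \<Rightarrow> real^'n^'n" where
  "W_mat g = diag_mat (weight g)"

definition incidence :: "('n::finite, 'm::finite) microgrid \<Rightarrow> real^'m^'n" where
  "incidence g = (\<chi> i k. if k \<notin> lines g then 0
                        else if i = pos_end g k then 1 else if i = neg_end g k then -1 else 0)"

definition comm_adjacency :: "('n::finite, 'm::finite) microgrid \<Rightarrow> real^'n^'n" where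
  "comm_adjacency g = (\<chi> i j. if (i, j) \<in> comm_edges g then comm_weight g i j else 0)"

definition comm_degree :: "('n::finite, 'm::finite) microgrid \<Rightarrow> real^'n^'n" where
  "comm_degree g = diag_mat (\<chi> i. \<Sum>j\<in>UNIV. comm_adjacency g $ i $ j)"

definition comm_laplacian :: "('n::finite, 'm::finite) microgrid \<Rightarrow> real^'n^'n" where
  "comm_laplacian g = comm_degree g - comm_adjacency g"

definition microgrid :: "('n::finite, 'm::finite) microgrid \<Rightarrow> bool" where
  "microgrid g \<longleftrightarrow>
    pos_def_diagonal (L\<^sub>t g) \<and> pos_def_diagonal (R\<^sub>t g) \<and> pos_def_diagonal (C\<^sub>t g) \<and>
    pos_def_diagonal (L\<^sub>l g) \<and> pos_def_diagonal (R\<^sub>l g) \<and> (\<forall>i. 0 < weight g $ i) \<and>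
    (\<forall>k\<in>lines g. pos_end g k \<noteq> neg_end g k) \<and>
    (\<forall>i j. (i, j) \<in> ((\<lambda>k. (pos_end g k, neg_end g k)) ` lines g \<union>
                      (\<lambda>k. (neg_end g k, pos_end g k)) ` lines g)\<^sup>*) \<and>
    sym (comm_edges g) \<and> irrefl (comm_edges g) \<and> (\<forall>i j. (i, j) \<in> (comm_edges g)\<^sup>*) \<and>
    (\<forall>(i, j)\<in>comm_edges g. comm_weight g i j = comm_weight g j i \<and> 0 < comm_weight g i j)"

text \<open>States are tuples \<open>(I\<^sub>t, V, I, \<theta>)\<close>.\<close>

type_synonym ('n, 'm) grid_state = "(real^'n) \<times> (real^'n) \<times> (real^'m) \<times> (real^'n)"

fun grid_field :: "('n::finite, 'm::finite) microgrid \<Rightarrow> real^'n \<Rightarrow>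
    ('n, 'm) grid_state \<Rightarrow> ('n, 'm) grid_state" where
  "grid_field g u (It, V, I, \<theta>) =
    (matrix_inv (L\<^sub>t g) *v (- (R\<^sub>t g *v It) - V + u),
     matrix_inv (C\<^sub>t g) *v (It + incidence g *v I - I\<^sub>L g),
     matrix_inv (L\<^sub>l g) *v (- (transpose (incidence g) *v V) - R\<^sub>l g *v I),
     - ((comm_laplacian g ** W_mat g) *v It))"

text \<open>The sliding function \<open>\<sigma> = \<xi>\<^sub>1\<close>.\<close>

fun sliding :: "('n::finite, 'm::finite) microgrid \<Rightarrow> ('n, 'm) grid_state \<Rightarrow> real^'n" where
  "sliding g (It, V, I, \<theta>) = matrix_inv (W_mat g) *v (V - V_ref g) - \<theta>"

definition G_d :: "('n::finite, 'm::finite) microgrid \<Rightarrow> real^'n^'n" where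
  "G_d g = (matrix_inv (W_mat g) ** matrix_inv (C\<^sub>t g) + comm_degree g ** W_mat g)
            ** matrix_inv (L\<^sub>t g)"

definition G_a :: "('n::finite, 'm::finite) microgrid \<Rightarrow> real^'n^'n" where
  "G_a g = comm_adjacency g ** W_mat g ** matrix_inv (L\<^sub>t g)"

fun b_term :: "('n::finite, 'm::finite) microgrid \<Rightarrow> real^'n \<Rightarrow>
    ('n, 'm) grid_state \<Rightarrow> real^'n" where
  "b_term g u (It, V, I, \<theta>) =
    (let WC = matrix_inv (W_mat g) ** matrix_inv (C\<^sub>t g);
         K = (WC + comm_laplacian g ** W_mat g) ** matrix_inv (L\<^sub>t g);
         P = WC ** incidence g ** matrix_inv (L\<^sub>l g)
     in - ((K ** R\<^sub>t g) *v It) - (K + P ** transpose (incidence g)) *v V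
        - (P ** R\<^sub>l g) *v I - G_a g *v u)"


section \<open>The suboptimal second order sliding mode scheme\<close>

text \<open>The argument \<open>m\<close> is the stored extremal value of \<open>y = \<xi>\<^sub>1\<^sub>i\<close>.\<close>

definition ssosm_input :: "real \<Rightarrow> real \<Rightarrow> real \<Rightarrow> real \<Rightarrow> real" where
  "ssosm_input \<mu>s Umax m y =
    - (if (y - m / 2) * (m - y) > 0 then \<mu>s else 1) * Umax * sgn (y - m / 2)"

text \<open>\<open>m t\<close> is the value of \<open>y\<close> at the last update instant up to time \<open>t\<close>; \<open>S\<close> is the set of
  update instants, including the initialization at time \<open>0\<close>. Every local extremum
  (weak, so instants of a constant phase count) is an update instant. Conversely an update
  requires only that \<open>y\<close> has zero derivative: when \<open>y\<close> is about to attain an extremum on the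
  same side of \<open>0\<close> as the stored value, the update itself reverses the acceleration, so that along
  the closed loop \<open>y\<close> merely has an inflection point there.\<close>

definition local_extremum :: "(real \<Rightarrow> real) \<Rightarrow> real \<Rightarrow> bool" where
  "local_extremum y s \<longleftrightarrow> (\<forall>\<^sub>F r in nhds s. y r \<le> y s) \<or> (\<forall>\<^sub>F r in nhds s. y s \<le> y r)"

definition stores_extremum :: "(real \<Rightarrow> real) \<Rightarrow> (real \<Rightarrow> real) \<Rightarrow> bool" where
  "stores_extremum y m \<longleftrightarrow>
    (\<exists>S. 0 \<in> S \<and> S \<subseteq> {0..} \<and>
      (\<forall>s>0. local_extremum y s \<longrightarrow> s \<in> S) \<and>
      (\<forall>s\<in>S. s > 0 \<longrightarrow> (y has_real_derivative 0) (at s)) \<and>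
      (\<forall>t\<ge>0. \<exists>s\<in>S. s \<le> t \<and> (\<forall>r\<in>S. r \<le> t \<longrightarrow> r \<le> s) \<and> m t = y s))"

text \<open>\<open>x\<close> solves the closed loop, the memory \<open>m\<close> being a given function of time in the
  convexification; \<open>u\<close> is the input which the Filippov solution \<open>x\<close> realizes.\<close>

definition ssosm_closed_loop :: "('n::finite, 'm::finite) microgrid \<Rightarrow>
    ('n \<Rightarrow> real) \<Rightarrow> ('n \<Rightarrow> real) \<Rightarrow> ('n \<Rightarrow> real) \<Rightarrow> ('n \<Rightarrow> real) \<Rightarrow> ('n \<Rightarrow> real) \<Rightarrow>
    (real \<Rightarrow> ('n, 'm) grid_state) \<Rightarrow> (real \<Rightarrow> real^'n) \<Rightarrow> bool" where
  "ssosm_closed_loop g Gmin Gmax bmax \<mu>s Umax x u \<longleftrightarrow>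
    (\<forall>i. 0 < bmax i \<and> \<mu>s i \<in> {0<..1} \<inter> {0<..<3 * Gmin i / Gmax i} \<and>
         Umax i > max (bmax i / (\<mu>s i * Gmin i)) (4 * bmax i / (3 * Gmin i - \<mu>s i * Gmax i))) \<and>
    (\<exists>x' m.
      (\<forall>i. stores_extremum (\<lambda>t. sliding g (x t) $ i) (\<lambda>t. m t $ i)) \<and>
      filippov_solution
        (\<lambda>t z. grid_field g (\<chi> i. ssosm_input (\<mu>s i) (Umax i) (m t $ i) (sliding g z $ i)) z)
        x x' \<and>
      (AE t in lebesgue. t \<ge> 0 \<longrightarrow> x' t = grid_field g (u t) (x t))) \<and>
    (\<forall>i. AE t in lebesgue. t \<ge> 0 \<longrightarrow> \<bar>b_term g (u t) (x t) $ i\<bar> \<le> bmax i)"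


section \<open>The third order sliding mode scheme\<close>

text \<open>In the following, \<open>y1, y2, y3\<close> stand for \<open>\<sigma>\<^sub>i\<close> and its first two derivatives (or their
  estimates), and \<open>a\<close> for the reduced control authority \<open>\<alpha>\<^sub>r\<^sub>i\<close>.\<close>

definition tsm_v2 :: "real \<Rightarrow> real \<Rightarrow> real \<Rightarrow> real" where
  "tsm_v2 a y2 y3 = sgn (y2 + y3\<^sup>2 * sgn y3 / (2 * a))"

definition tsm_s :: "real \<Rightarrow> real \<Rightarrow> real \<Rightarrow> real \<Rightarrow> real" where
  "tsm_s a y1 y2 y3 =
    y1 + y3 ^ 3 / (3 * a\<^sup>2)
    + tsm_v2 a y2 y3 * (1 / sqrt a * (tsm_v2 a y2 y3 * y2 + y3\<^sup>2 / (2 * a)) powr (3 / 2)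
                         + y2 * y3 / a)"

definition tsm_M0 :: "(real \<times> real \<times> real) set" where
  "tsm_M0 = {(0, 0, 0)}"

definition tsm_M1 :: "real \<Rightarrow> (real \<times> real \<times> real) set" where
  "tsm_M1 a = {(y1, y2, y3). y1 - y3 ^ 3 / (6 * a\<^sup>2) = 0 \<and> y2 + y3 * \<bar>y3\<bar> / (2 * a) = 0}"

definition tsm_M2 :: "real \<Rightarrow> (real \<times> real \<times> real) set" where
  "tsm_M2 a = {(y1, y2, y3). tsm_s a y1 y2 y3 = 0}"

definition tsm_control :: "real \<Rightarrow> real \<Rightarrow> real \<Rightarrow> real \<Rightarrow> real \<Rightarrow> real" where
  "tsm_control \<alpha> a y1 y2 y3 =
    (if (y1, y2, y3) \<in> tsm_M1 a - tsm_M0 then - \<alpha> * sgn y3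
     else if (y1, y2, y3) \<in> tsm_M2 a - tsm_M1 a then - \<alpha> * tsm_v2 a y2 y3
     else - \<alpha> * sgn (tsm_s a y1 y2 y3))"

text \<open>Right-hand sides of Levant's differentiator with input \<open>y\<close> and estimates
  \<open>e1, e2, e3\<close>.\<close>

definition levant1 :: "real \<Rightarrow> real \<Rightarrow> real \<Rightarrow> real \<Rightarrow> real \<Rightarrow> real" where
  "levant1 \<Lambda> y e1 e2 e3 =
    - (3 * \<Lambda> powr (1 / 3)) * \<bar>e1 - y\<bar> powr (2 / 3) * sgn (e1 - y) + e2"

definition levant2 :: "real \<Rightarrow> real \<Rightarrow> real \<Rightarrow> real \<Rightarrow> real \<Rightarrow> real" where
  "levant2 \<Lambda> y e1 e2 e3 =
    - (1.5 * \<Lambda> powr (1 / 2)) * \<bar>e2 - levant1 \<Lambda> y e1 e2 e3\<bar> powr (1 / 2)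
        * sgn (e2 - levant1 \<Lambda> y e1 e2 e3) + e3"

definition levant3 :: "real \<Rightarrow> real \<Rightarrow> real \<Rightarrow> real \<Rightarrow> real \<Rightarrow> real" where
  "levant3 \<Lambda> y e1 e2 e3 = - (1.1 * \<Lambda>) * sgn (e3 - levant2 \<Lambda> y e1 e2 e3)"

text \<open>The closed loop has state \<open>(x, u, (e1, e2, e3))\<close>.\<close>

fun tsm_field :: "('n::finite, 'm::finite) microgrid \<Rightarrow> ('n \<Rightarrow> real) \<Rightarrow> ('n \<Rightarrow> real) \<Rightarrow>
    ('n \<Rightarrow> real) \<Rightarrow>
    ('n, 'm) grid_state \<times> (real^'n) \<times> ((real^'n) \<times> (real^'n) \<times> (real^'n)) \<Rightarrow>
    ('n, 'm) grid_state \<times> (real^'n) \<times> ((real^'n) \<times> (real^'n) \<times> (real^'n))" where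
  "tsm_field g \<alpha> a \<Lambda> (x, u, (e1, e2, e3)) =
    (grid_field g u x,
     (\<chi> i. tsm_control (\<alpha> i) (a i) (e1 $ i) (e2 $ i) (e3 $ i)),
     ((\<chi> i. levant1 (\<Lambda> i) (sliding g x $ i) (e1 $ i) (e2 $ i) (e3 $ i)),
      (\<chi> i. levant2 (\<Lambda> i) (sliding g x $ i) (e1 $ i) (e2 $ i) (e3 $ i)),
      (\<chi> i. levant3 (\<Lambda> i) (sliding g x $ i) (e1 $ i) (e2 $ i) (e3 $ i))))"

text \<open>The last conjunct inside the inner existential quantifier is the exactness of the
  differentiator after a finite time, which the choice of \<open>\<Lambda>\<close> has to ensure.\<close>

definition tsm_closed_loop :: "('n::finite, 'm::finite) microgrid \<Rightarrow>
    ('n \<Rightarrow> real) \<Rightarrow> ('n \<Rightarrow> real) \<Rightarrow> ('n \<Rightarrow> real) \<Rightarrow> ('n \<Rightarrow> real) \<Rightarrow>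
    (real \<Rightarrow> ('n, 'm) grid_state) \<Rightarrow> (real \<Rightarrow> real^'n) \<Rightarrow> bool" where
  "tsm_closed_loop g Gmin \<beta>max \<alpha> \<Lambda> x u \<longleftrightarrow>
    (\<forall>i. 0 < \<beta>max i \<and> 0 < \<alpha> i \<and> 0 < \<alpha> i * Gmin i - \<beta>max i \<and> 0 < \<Lambda> i) \<and>
    u 0 = 0 \<and>
    (\<exists>z' e1 e2 e3.
      filippov_solution (\<lambda>t. tsm_field g \<alpha> (\<lambda>i. \<alpha> i * Gmin i - \<beta>max i) \<Lambda>)
        (\<lambda>t. (x t, u t, (e1 t, e2 t, e3 t))) z' \<and>
      (\<exists>T\<ge>0. \<forall>t>T. e1 t = sliding g (x t) \<and>
        ((\<lambda>s. sliding g (x s)) has_vector_derivative e2 t) (at t) \<and>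
        (e2 has_vector_derivative e3 t) (at t))) \<and>
    (\<exists>b'. has_ac_derivative (\<lambda>t. b_term g (u t) (x t)) b' \<and>
      (\<forall>i. AE t in lebesgue. t \<ge> 0 \<longrightarrow> \<bar>b' t $ i\<bar> \<le> \<beta>max i))"

end

theory Submission
  imports Defs
begin

text \<open>Since \<open>\<one>\<^sup>T \<L>\<^sub>c = 0\<close>, the sum of the entries of \<open>\<theta>\<close> stays \<open>0\<close>, so it suffices that every
  component \<open>y\<close> of the sliding function \<open>\<sigma>\<close> reaches \<open>0\<close> in finite time and stays there. The
  acceleration of \<open>y\<close> is \<open>b\<^sub>i + G\<^sub>d\<^sub>i u\<^sub>i\<close> almost everywhere.

  For the suboptimal scheme, from one extremal value of \<open>y\<close> to the next the modulus shrinks by a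
  factor \<open>\<rho> < 1\<close>, and the elapsed time is at most a constant times the root of the first modulus;
  the elapsed times are therefore summable.

  For the third order scheme, \<open>\<M>\<^sub>2\<close> is reached because the sign of \<open>s\<close> never helps \<open>\<bar>s\<bar>\<close> to grow;
  on \<open>\<M>\<^sub>2\<close> the condition \<open>s = 0\<close> itself forces the jerk to be the time-optimal one
  \<open>\<plusminus>\<alpha>\<^sub>r\<close>, so that the values of the control on the null sets \<open>\<M>\<^sub>1\<close> and \<open>\<M>\<^sub>2\<close>, which Filippov's
  convexification ignores, do not matter. The trajectory then reaches \<open>\<M>\<^sub>1\<close> and finally \<open>\<M>\<^sub>0\<close>.\<close>

section \<open>Real functions\<close>

text \<open>Accelerations and jerks exist only almost everywhere, and on a discontinuity set the
  convexification leaves the input undetermined. Both schemes are therefore reduced to scalar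
  problems whose hypotheses bound increments over intervals inside which the trajectory stays on one
  side of the discontinuity. The switching function of the third order law then need not have a time
  derivative, and its monotonicity is read off one-sided first order expansions. In the suboptimal
  scheme the update instants are a priori just a set, which may accumulate, and at time 0 the
  velocity may be nonzero. Hence contraction starts at some update after time 0, and a supremum
  argument replaces the iteration of phases. The factor \<rho> < 1 comes from the second bound on
  \<open>Umax\<close>, which says that the largest acceleration of the approach is less than three
  times the smallest one of the braking.\<close>

lemma right_dini_nonincreasing:
  fixes f :: "real \<Rightarrow> real"
  assumes cont: "continuous_on {p..q} f" and "p \<le> q"
    and dini: "\<And>t \<epsilon>. p < t \<Longrightarrow> t < q \<Longrightarrow> 0 < \<epsilon> \<Longrightarrow> \<forall>\<^sub>F h in at_right 0. f (t + h) \<le> f t + \<epsilon> * h"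
  shows "f q \<le> f p"
proof -
  have *: "f q \<le> f a + \<epsilon> * (q - a)" if a: "p < a" "a < q" and \<epsilon>: "0 < \<epsilon>" for a \<epsilon>
  proof -
    \<comment> \<open>By the Dini condition the largest point of \<open>A\<close> can be moved
      further to the right unless it is \<open>q\<close>.\<close>
    define A where "A = {t \<in> {a..q}. f t \<le> f a + \<epsilon> * (t - a)}"
    have "compact A"
    proof -
      have "continuous_on {a..q} f" using cont by (rule continuous_on_subset) (use a in auto)
      then have "continuous_on {a..q} (\<lambda>t. f t - (f a + \<epsilon> * (t - a)))"
        by (intro continuous_intros)
      then have "closed ({a..q} \<inter> (\<lambda>t. f t - (f a + \<epsilon> * (t - a))) -` {..0})"
        by (rule continuous_closed_preimage) auto
      moreover have "{a..q} \<inter> (\<lambda>t. f t - (f a + \<epsilon> * (t - a))) -` {..0} = A"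
        by (auto simp: A_def)
      ultimately have "closed A" by simp
      moreover have "bounded A" by (rule bounded_subset[of "{a..q}"]) (auto simp: A_def)
      ultimately show ?thesis by (simp add: compact_eq_bounded_closed)
    qed
    moreover have "a \<in> A" using a by (auto simp: A_def)
    ultimately obtain c where c: "c \<in> A" "\<And>t. t \<in> A \<Longrightarrow> t \<le> c"
      using compact_attains_sup[of A] by blast
    have "c = q"
    proof (rule ccontr)
      assume "c \<noteq> q"
      then have cq: "p < c" "c < q" using c(1) a by (auto simp: A_def)
      have "\<forall>\<^sub>F h in at_right 0. h < q - c"
        using cq by (auto simp: eventually_at_right_field intro!: exI[of _ "q - c"])
      moreover have "\<forall>\<^sub>F h in at_right (0::real). 0 < h"
        by (simp add: eventually_at_right_less)
      ultimately have "\<forall>\<^sub>F h in at_right 0. f (c + h) \<le> f c + \<epsilon> * h \<and> h < q - c \<and> 0 < h"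
        using dini[OF cq \<epsilon>] by eventually_elim auto
      then obtain h where "f (c + h) \<le> f c + \<epsilon> * h" "h < q - c" "0 < h"
        using eventually_happens[of _ "at_right (0::real)"] by (auto simp: trivial_limit_at_right_real)
      then have "c + h \<in> A" using c(1) by (auto simp: A_def algebra_simps)
      then show False using c(2)[of "c + h"] \<open>0 < h\<close> by simp
    qed
    then show ?thesis using c by (auto simp: A_def)
  qed
  show ?thesis
  proof (cases "p = q")
    case False
    then have pq: "p < q" using assms by simp
    have **: "f q \<le> f a" if a: "p < a" "a < q" for a
    proof (rule field_le_epsilon)
      fix e :: real assume "0 < e"
      then show "f q \<le> f a + e" using *[OF a, of "e / (q - a)"] a by auto
    qed
    \<comment> \<open>The Dini condition is given at interior points; the left end is reached by
      letting \<open>a\<close> tend to \<open>p\<close>.\<close>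
    have "(f \<longlongrightarrow> f p) (at p within {p..q})"
      using cont pq by (auto simp: continuous_on)
    then have "(f \<longlongrightarrow> f p) (at_right p)"
      using pq by (simp add: at_within_Icc_at_right)
    moreover have "\<forall>\<^sub>F a in at_right p. f q \<le> f a"
      using pq ** by (auto simp: eventually_at_right_field intro!: exI[of _ q])
    ultimately show ?thesis
      by (intro tendsto_lowerbound[of f "f p" "at_right p"]) auto
  qed auto
qed

text \<open>A Lyapunov argument without derivatives, applied to the surface, to the curve on it and
  to \<open>y3\<close>. The half-open intervals let \<open>p\<close> be a zero: after the last zero
  \<open>c\<close> before a nonzero value \<open>f\<close> has one sign, so its modulus cannot have
  grown from 0.\<close>

lemma zero_reached_and_kept:
  fixes f :: "real \<Rightarrow> real"
  assumes cont: "continuous_on {T..} f"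
    and pos: "\<And>p q. T \<le> p \<Longrightarrow> p < q \<Longrightarrow> (\<And>t. p < t \<Longrightarrow> t \<le> q \<Longrightarrow> 0 < f t) \<Longrightarrow> f q \<le> f p"
    and neg: "\<And>p q. T \<le> p \<Longrightarrow> p < q \<Longrightarrow> (\<And>t. p < t \<Longrightarrow> t \<le> q \<Longrightarrow> f t < 0) \<Longrightarrow> f p \<le> f q"
    and npos: "\<exists>t\<ge>T. f t \<le> 0" and nneg: "\<exists>t\<ge>T. 0 \<le> f t"
  shows "\<exists>T'\<ge>T. \<forall>t\<ge>T'. f t = 0"
proof -
  obtain t1 t2 where t: "T \<le> t1" "f t1 \<le> 0" "T \<le> t2" "0 \<le> f t2" using npos nneg by auto
  have "\<exists>T'\<ge>T. f T' = 0"
  proof (cases "t1 \<le> t2")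
    case True
    have "continuous_on {t1..t2} f" using cont by (rule continuous_on_subset) (use t in auto)
    from IVT'[OF t(2) t(4) True this] show ?thesis using t by (meson order_trans)
  next
    case False
    have "continuous_on {t2..t1} f" using cont by (rule continuous_on_subset) (use t in auto)
    from IVT2'[OF t(2) t(4) _ this] show ?thesis using t False by (meson order_trans linear)
  qed
  then obtain T' where T': "T \<le> T'" "f T' = 0" by auto
  have "f t = 0" if "T' \<le> t" for t
  proof (rule ccontr)
    assume nz: "f t \<noteq> 0"
    define A where "A = {T'..t} \<inter> f -` {0}"
    have cT: "continuous_on {T'..t} f" using cont by (rule continuous_on_subset) (use T' in auto)
    have "closed A" unfolding A_def by (rule continuous_closed_preimage[OF cT]) auto
    moreover have "bounded A" by (rule bounded_subset[of "{T'..t}"]) (auto simp: A_def)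
    moreover have "T' \<in> A" using T' that by (auto simp: A_def)
    ultimately obtain c where c: "c \<in> A" "\<And>t. t \<in> A \<Longrightarrow> t \<le> c"
      using compact_attains_sup[of A] compact_eq_bounded_closed[of A] by blast
    have ct: "c < t" "T \<le> c" "f c = 0" using c(1) nz T' by (auto simp: A_def less_le)
    have nzc: "f r \<noteq> 0" if "c < r" "r \<le> t" for r
      using c(2)[of r] that c(1) by (auto simp: A_def)
    have same: "0 < f r * f t" if r: "c < r" "r \<le> t" for r
    proof (rule ccontr)
      assume "\<not> 0 < f r * f t"
      then have "f r * f t < 0" using nzc[of r] r nz by (simp add: not_less le_less)
      then have sg: "(f r \<le> 0 \<and> 0 \<le> f t) \<or> (0 \<le> f r \<and> f t \<le> 0)" by (auto simp: mult_less_0_iff)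
      have "continuous_on {r..t} f" using cT by (rule continuous_on_subset) (use r c in \<open>auto simp: A_def\<close>)
      then obtain x where "r \<le> x" "x \<le> t" "f x = 0"
        using sg IVT'[of f r 0 t] IVT2'[of f t 0 r] r by auto
      then show False using nzc[of x] r by auto
    qed
    show False
    proof (cases "0 < f t")
      case True
      then have "f t \<le> f c" using same by (intro pos ct) (auto simp: zero_less_mult_iff)
      then show False using True ct by auto
    next
      case False
      then have "f c \<le> f t" using same nz by (intro neg ct) (auto simp: zero_less_mult_iff)
      then show False using False nz ct by auto
    qed
  qed
  then show ?thesis using T' by auto
qed

lemma eventually_le_minus_one:
  fixes f f' :: "real \<Rightarrow> real"
  assumes "\<And>t. T \<le> t \<Longrightarrow> (f has_real_derivative f' t) (at t)"
    and "\<exists>T1\<ge>T. \<forall>t\<ge>T1. f' t \<le> -1"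
  shows "\<exists>T1\<ge>T. \<forall>t\<ge>T1. f t \<le> -1"
proof -
  obtain T1 where T1: "T \<le> T1" "\<And>t. T1 \<le> t \<Longrightarrow> f' t \<le> -1" using assms by auto
  have "f t \<le> f T1 - (t - T1)" if "T1 \<le> t" for t
  proof -
    have "(\<lambda>t. f t + t) t \<le> (\<lambda>t. f t + t) T1"
    proof (rule DERIV_nonpos_imp_nonincreasing[OF that])
      fix x assume "T1 \<le> x" "x \<le> t"
      then show "\<exists>y. ((\<lambda>t. f t + t) has_real_derivative y) (at x) \<and> y \<le> 0"
        using T1(1) T1(2)[of x] assms(1)[of x]
        by (intro exI[of _ "f' x + 1"] conjI DERIV_add DERIV_ident) auto
    qed
    then show ?thesis by simp
  qed
  then have "f t \<le> -1" if "T1 + \<bar>f T1\<bar> + 1 \<le> t" for t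
  proof -
    have "T1 \<le> t" using that by simp
    with \<open>\<And>t. T1 \<le> t \<Longrightarrow> f t \<le> f T1 - (t - T1)\<close> have "f t \<le> f T1 - (t - T1)" .
    then show ?thesis using that by linarith
  qed
  then show ?thesis using T1(1) by (intro exI[of _ "T1 + \<bar>f T1\<bar> + 1"]) auto
qed


lemma has_derivative_eventually_le:
  assumes "(F has_derivative F') (at x)" "0 < e" "filterlim Y (nhds x) G"
  shows "\<forall>\<^sub>F h in G. norm (F (Y h) - F x - F' (Y h - x)) \<le> e * norm (Y h - x)"
proof -
  obtain d where "0 < d" and d: "\<And>y. norm (y - x) < d \<Longrightarrow> norm (F y - F x - F' (y - x)) \<le> e * norm (y - x)"
    using assms(1,2) unfolding has_derivative_at_alt by blast
  have "\<forall>\<^sub>F h in G. dist (Y h) x < d"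
    using assms(3) \<open>0 < d\<close> by (simp add: tendsto_iff)
  then show ?thesis by eventually_elim (auto intro: d simp: dist_norm)
qed

lemma has_real_derivative_at_right_le:
  fixes f :: "real \<Rightarrow> real"
  assumes "(f has_real_derivative f') (at t)" "0 < e"
  shows "\<forall>\<^sub>F h in at_right 0. \<bar>f (t + h) - f t - f' * h\<bar> \<le> e * h"
proof -
  have "((\<lambda>h. t + h) \<longlongrightarrow> t) (at_right 0)" by (auto intro!: tendsto_eq_intros)
  from has_derivative_eventually_le[OF assms(1)[unfolded has_field_derivative_def] assms(2) this]
  have "\<forall>\<^sub>F h in at_right 0. norm (f (t + h) - f t - f' * h) \<le> e * norm h" by simp
  moreover have "\<forall>\<^sub>F h in at_right (0::real). 0 < h" by (simp add: eventually_at_right_less)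
  ultimately show ?thesis by eventually_elim simp
qed

lemma continuous_on_tendsto_at_right:
  assumes "continuous_on {T..} f" "T \<le> (t::real)"
  shows "((\<lambda>h. f (t + h)) \<longlongrightarrow> f t) (at_right 0)"
proof (rule continuous_on_tendsto_compose[OF assms(1)])
  show "((\<lambda>h. t + h) \<longlongrightarrow> t) (at_right 0)" by (auto intro!: tendsto_eq_intros)
  have "\<forall>\<^sub>F h in at_right (0::real). 0 < h" by (simp add: eventually_at_right_less)
  then show "\<forall>\<^sub>F h in at_right 0. t + h \<in> {T..}" by eventually_elim (use assms(2) in auto)
qed (use assms(2) in simp)

lemma has_real_derivative_times_abs:
  "((\<lambda>x::real. x * \<bar>x\<bar>) has_real_derivative 2 * \<bar>x\<bar>) (at x)"
proof -
  consider "0 < x" | "x < 0" | "x = 0" by linarith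
  then show ?thesis
  proof cases
    case 1
    have "((\<lambda>x. x * x) has_real_derivative 2 * \<bar>x\<bar>) (at x)"
      using 1 by (auto intro!: derivative_eq_intros)
    then show ?thesis
      by (rule has_field_derivative_transform_within_open[of _ _ _ "{0<..}"]) (use 1 in auto)
  next
    case 2
    have "((\<lambda>x. x * - x) has_real_derivative 2 * \<bar>x\<bar>) (at x)"
      using 2 by (auto intro!: derivative_eq_intros)
    then show ?thesis
      by (rule has_field_derivative_transform_within_open[of _ _ _ "{..<0}"]) (use 2 in auto)
  next
    case 3
    have "((\<lambda>h::real. \<bar>h\<bar>) \<longlongrightarrow> \<bar>0\<bar>) (at 0)" by (intro tendsto_intros)
    moreover have "\<forall>\<^sub>F h in at (0::real). h * \<bar>h\<bar> / h = \<bar>h\<bar>" by (simp add: eventually_at_filter)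
    ultimately have "((\<lambda>h::real. h * \<bar>h\<bar> / h) \<longlongrightarrow> 0) (at 0)" by (simp add: tendsto_cong)
    then show ?thesis using 3 by (simp add: DERIV_def)
  qed
qed

section \<open>Triple integrators and the switching surface\<close>

text \<open>For \<open>c \<ge> 0\<close> this is \<open>c powr (3 / 2)\<close>; the odd extension is differentiable everywhere, so that both
  branches of \<open>sw\<close> can be differentiated on the curve where they meet.\<close>

definition pow32 :: "real \<Rightarrow> real" where "pow32 c = c * sqrt \<bar>c\<bar>"

lemma DERIV_pow32: "(pow32 has_real_derivative 3 / 2 * sqrt \<bar>c\<bar>) (at c)"
proof -
  consider "0 < c" | "c < 0" | "c = 0" by linarith
  then show ?thesis
  proof cases
    case 1
    have "((\<lambda>c. c * sqrt c) has_real_derivative 3 / 2 * sqrt \<bar>c\<bar>) (at c)"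
      using 1 by (auto intro!: derivative_eq_intros simp: field_simps)
    then show ?thesis
      by (rule DERIV_cong_ev[THEN iffD1, rotated -1])
        (use 1 in \<open>auto simp: pow32_def intro!: eventually_mono[OF eventually_nhds_in_open[of "{0<..}"]]\<close>)
  next
    case 2
    have "((\<lambda>c. c * sqrt (- c)) has_real_derivative 3 / 2 * sqrt \<bar>c\<bar>) (at c)"
      using 2 by (auto intro!: derivative_eq_intros simp: field_simps)
    then show ?thesis
      by (rule DERIV_cong_ev[THEN iffD1, rotated -1])
        (use 2 in \<open>auto simp: pow32_def intro!: eventually_mono[OF eventually_nhds_in_open[of "{..<0}"]]\<close>)
  next
    case 3
    have "((\<lambda>h. sqrt \<bar>h\<bar>) \<longlongrightarrow> sqrt \<bar>0\<bar>) (at 0)" by (intro tendsto_intros)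
    moreover have "\<forall>\<^sub>F h in at 0. pow32 h / h = sqrt \<bar>h\<bar>"
      by (simp add: eventually_at_filter pow32_def)
    ultimately have "((\<lambda>h. pow32 h / h) \<longlongrightarrow> 0) (at 0)"
      by (simp add: tendsto_cong)
    then show ?thesis using 3 by (simp add: DERIV_def pow32_def)
  qed
qed

lemma pow32_nonneg: "0 \<le> c \<Longrightarrow> 0 \<le> pow32 c"
  by (simp add: pow32_def)

text \<open>A first integral of the flow with jerk -1, along which
  \<open>y2 + y3\<^sup>2 / 2\<close> and \<open>y1 + y2 * y3 + y3 ^ 3 / 3\<close> are both constant.
  From its zeros above the curve that flow leads to the curve at a point with
  \<open>y1 = y3 ^ 3 / 6\<close>.\<close>

definition sw_plus :: "real \<times> real \<times> real \<Rightarrow> real" where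
  "sw_plus = (\<lambda>(y1, y2, y3). y1 + y2 * y3 + y3 ^ 3 / 3 + pow32 (y2 + y3\<^sup>2 / 2))"

definition sw_minus :: "real \<times> real \<times> real \<Rightarrow> real" where
  "sw_minus y = - sw_plus (- y)"

definition sw_curve :: "real \<Rightarrow> real \<Rightarrow> real" where
  "sw_curve y2 y3 = y2 + y3 * \<bar>y3\<bar> / 2"

text \<open>\<open>tsm_s\<close> for \<open>\<alpha>\<^sub>r = 1\<close>, to which the general case scales. On the curve \<open>v\<^sub>2 = 0\<close>, where
  \<open>sgn 0 = 0\<close> makes \<open>tsm_s\<close> discontinuous, \<open>sw\<close> takes the limit instead.\<close>

definition sw :: "real \<times> real \<times> real \<Rightarrow> real" where
  "sw y = (if 0 \<le> sw_curve (fst (snd y)) (snd (snd y)) then sw_plus y else sw_minus y)"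

text \<open>The partial derivative of \<open>sw_plus\<close> in \<open>y3\<close>. As jerk -1
  preserves \<open>sw_plus\<close>, its rate along a trajectory is this slope times (jerk +
  1).\<close>

definition sw_slope :: "real \<Rightarrow> real \<Rightarrow> real" where
  "sw_slope y2 y3 = y2 + y3\<^sup>2 + 3 / 2 * sqrt \<bar>y2 + y3\<^sup>2 / 2\<bar> * y3"

lemma sw_curve_uminus: "sw_curve (- y2) (- y3) = - sw_curve y2 y3"
  by (simp add: sw_curve_def)

text \<open>Eliminating \<open>y2\<close> in favour of \<open>sqrt c\<close> leaves a quadratic in
  \<open>y3\<close> with roots \<open>- sqrt c\<close> and \<open>- 2 * sqrt c\<close>. On or above
  the curve \<open>y3\<close> is not below the larger root.\<close>

lemma sw_slope_factor:
  assumes "0 \<le> c" "c = y2 + y3\<^sup>2 / 2"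
  shows "sw_slope y2 y3 = (y3 + sqrt c) * (y3 + 2 * sqrt c) / 2"
proof -
  have "c = sqrt c * sqrt c" using assms by simp
  then have "y2 = sqrt c * sqrt c - y3\<^sup>2 / 2" using assms by simp
  then show ?thesis using assms
    by (simp add: sw_slope_def algebra_simps power2_eq_square)
qed

lemma sw_curve_nonneg_imp:
  assumes "0 \<le> sw_curve y2 y3"
  shows "0 \<le> y2 + y3\<^sup>2 / 2" "0 \<le> y3 + sqrt (y2 + y3\<^sup>2 / 2)"
proof -
  show c: "0 \<le> y2 + y3\<^sup>2 / 2"
  proof (cases "0 \<le> y3")
    case False
    then have "y3\<^sup>2 \<le> 2 * y2" using assms by (simp add: sw_curve_def power2_eq_square)
    then show ?thesis using zero_le_power2[of y3] by linarith
  qed (use assms in \<open>simp add: sw_curve_def power2_eq_square\<close>)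
  show "0 \<le> y3 + sqrt (y2 + y3\<^sup>2 / 2)"
  proof (cases "0 \<le> y3")
    case False
    then have "(- y3)\<^sup>2 \<le> y2 + y3\<^sup>2 / 2" using assms by (simp add: sw_curve_def power2_eq_square)
    then have "- y3 \<le> sqrt (y2 + y3\<^sup>2 / 2)" by (rule real_le_rsqrt)
    then show ?thesis by simp
  qed (use c in auto)
qed

lemma sw_curve_pos_imp:
  assumes "0 < sw_curve y2 y3"
  shows "0 < y3 + sqrt (y2 + y3\<^sup>2 / 2)"
proof (cases "0 < y3")
  case True
  then show ?thesis using sw_curve_nonneg_imp(1)[of y2 y3] assms by (simp add: add_pos_nonneg)
next
  case False
  then have "(- y3)\<^sup>2 < y2 + y3\<^sup>2 / 2" using assms by (simp add: sw_curve_def power2_eq_square)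
  then have "- y3 < sqrt (y2 + y3\<^sup>2 / 2)" by (rule real_less_rsqrt)
  then show ?thesis by simp
qed

lemma sw_slope_nonneg:
  assumes "0 \<le> sw_curve y2 y3" shows "0 \<le> sw_slope y2 y3"
proof -
  note c = sw_curve_nonneg_imp[OF assms]
  then have "0 \<le> y3 + 2 * sqrt (y2 + y3\<^sup>2 / 2)" using real_sqrt_ge_zero[OF c(1)] by linarith
  then show ?thesis unfolding sw_slope_factor[OF c(1) refl] using c(2) by simp
qed

lemma sw_slope_pos:
  assumes "0 < sw_curve y2 y3" shows "0 < sw_slope y2 y3"
proof -
  have c: "0 \<le> y2 + y3\<^sup>2 / 2" using sw_curve_nonneg_imp assms by simp
  have p: "0 < y3 + sqrt (y2 + y3\<^sup>2 / 2)" by (rule sw_curve_pos_imp[OF assms])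
  then have "0 < y3 + 2 * sqrt (y2 + y3\<^sup>2 / 2)" using real_sqrt_ge_zero[OF c] by linarith
  with p show ?thesis unfolding sw_slope_factor[OF c refl] by simp
qed

text \<open>The common value makes \<open>sw\<close> continuous and is the expression in the
  definition of \<open>tsm_M1\<close>. Where \<open>y3\<close> vanishes as well it is
  \<open>y1\<close> itself, which finishes the convergence proof.\<close>

lemma sw_on_curve:
  assumes "sw_curve y2 y3 = 0"
  shows "sw_plus (y1, y2, y3) = y1 - y3 ^ 3 / 6" "sw_minus (y1, y2, y3) = y1 - y3 ^ 3 / 6"
proof -
  have y2: "y2 = - (y3 * \<bar>y3\<bar> / 2)" using assms by (simp add: sw_curve_def)
  have sq: "sqrt (y3 * y3) = \<bar>y3\<bar>" by simp
  show "sw_plus (y1, y2, y3) = y1 - y3 ^ 3 / 6"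
    unfolding sw_plus_def y2
    by (cases "0 \<le> y3")
      (auto simp: pow32_def power3_eq_cube power2_eq_square field_simps abs_mult)
  show "sw_minus (y1, y2, y3) = y1 - y3 ^ 3 / 6"
    unfolding sw_minus_def sw_plus_def y2
    by (cases "0 \<le> y3")
      (auto simp: pow32_def power3_eq_cube power2_eq_square field_simps abs_mult)
qed

text \<open>Through this symmetry the statements about trajectories are proved for one sign and
  transferred by reflection.\<close>

lemma sw_uminus: "sw (- y) = - sw y"
proof (cases y)
  case (fields y1 y2 y3)
  consider "sw_curve y2 y3 = 0" | "sw_curve y2 y3 < 0" | "sw_curve y2 y3 > 0" by linarith
  then show ?thesis
  proof cases
    case 1
    then have "sw_plus y = sw_minus y" using sw_on_curve fields by simp
    then show ?thesis using 1 fields by (simp add: sw_def sw_curve_uminus sw_minus_def)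
  qed (use fields in \<open>auto simp: sw_def sw_curve_uminus sw_minus_def\<close>)
qed

lemma has_derivative_sw_plus:
  "(sw_plus has_derivative (\<lambda>(d1, d2, d3).
      d1 + (y3 + 3 / 2 * sqrt \<bar>y2 + y3\<^sup>2 / 2\<bar>) * d2 + sw_slope y2 y3 * d3)) (at (y1, y2, y3))"
proof -
  let ?c = "\<lambda>y::real\<times>real\<times>real. fst (snd y) + (snd (snd y))\<^sup>2 / 2"
  have c: "(?c has_derivative (\<lambda>d. fst (snd d) + y3 * snd (snd d))) (at (y1, y2, y3))"
    by (auto intro!: derivative_eq_intros simp: fun_eq_iff)
  have "((\<lambda>y. pow32 (?c y)) has_derivative
      (\<lambda>d. (3 / 2 * sqrt \<bar>y2 + y3\<^sup>2 / 2\<bar>) * (fst (snd d) + y3 * snd (snd d)))) (at (y1, y2, y3))"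
    using has_derivative_compose[OF c] DERIV_pow32[of "y2 + y3\<^sup>2 / 2"]
    unfolding has_field_derivative_def by fastforce
  moreover have "((\<lambda>y::real\<times>real\<times>real. fst y + fst (snd y) * snd (snd y) + snd (snd y) ^ 3 / 3)
      has_derivative (\<lambda>d. fst d + y3 * fst (snd d) + (y2 + y3\<^sup>2) * snd (snd d))) (at (y1, y2, y3))"
    by (auto intro!: derivative_eq_intros simp: fun_eq_iff algebra_simps)
  ultimately have "((\<lambda>y. (fst y + fst (snd y) * snd (snd y) + snd (snd y) ^ 3 / 3) + pow32 (?c y))
      has_derivative (\<lambda>d. (fst d + y3 * fst (snd d) + (y2 + y3\<^sup>2) * snd (snd d)) +
        (3 / 2 * sqrt \<bar>y2 + y3\<^sup>2 / 2\<bar>) * (fst (snd d) + y3 * snd (snd d)))) (at (y1, y2, y3))"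
    by (rule has_derivative_add[rotated])
  moreover have "sw_plus = (\<lambda>y. (fst y + fst (snd y) * snd (snd y) + snd (snd y) ^ 3 / 3) + pow32 (?c y))"
    by (auto simp: sw_plus_def fun_eq_iff)
  moreover have "(\<lambda>(d1, d2, d3). d1 + (y3 + 3 / 2 * sqrt \<bar>y2 + y3\<^sup>2 / 2\<bar>) * d2 + sw_slope y2 y3 * d3) =
    (\<lambda>d. (fst d + y3 * fst (snd d) + (y2 + y3\<^sup>2) * snd (snd d)) +
        (3 / 2 * sqrt \<bar>y2 + y3\<^sup>2 / 2\<bar>) * (fst (snd d) + y3 * snd (snd d)))"
    by (auto simp: sw_slope_def algebra_simps)
  ultimately show ?thesis by (simp only:)
qed

lemma continuous_on_pow32 [continuous_intros]:
  "continuous_on A f \<Longrightarrow> continuous_on A (\<lambda>x. pow32 (f x))"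
  unfolding pow32_def by (intro continuous_intros)

lemma continuous_on_sw_curve [continuous_intros]:
  "continuous_on A f \<Longrightarrow> continuous_on A g \<Longrightarrow> continuous_on A (\<lambda>x. sw_curve (f x) (g x))"
  unfolding sw_curve_def by (intro continuous_intros) auto

lemma continuous_on_sw: "continuous_on UNIV sw"
proof -
  let ?P = "\<lambda>y::real\<times>real\<times>real. sw_curve (fst (snd y)) (snd (snd y))"
  have P: "continuous_on UNIV ?P" by (intro continuous_intros)
  have plus: "continuous_on A sw_plus" for A
    unfolding sw_plus_def split_beta by (intro continuous_intros) auto
  have minus: "continuous_on A sw_minus" for A
    unfolding sw_minus_def by (intro continuous_intros continuous_on_compose2[OF plus[of UNIV]]) auto
  have "continuous_on ({y. 0 \<le> ?P y} \<union> {y. ?P y \<le> 0}) (\<lambda>y. if 0 \<le> ?P y then sw_plus y else sw_minus y)"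
  proof (rule continuous_on_If)
    show "closed {y. 0 \<le> ?P y}" "closed {y. ?P y \<le> 0}"
      using P by (auto intro!: closed_Collect_le continuous_intros)
    fix y assume "y \<in> {y. 0 \<le> ?P y}" "\<not> 0 \<le> ?P y"
    then show "sw_plus y = sw_minus y" by simp
  next
    fix y assume "y \<in> {y. ?P y \<le> 0}" "0 \<le> ?P y"
    then have "?P y = 0" by simp
    then show "sw_plus y = sw_minus y" by (cases y) (simp add: sw_on_curve)
  qed (use plus minus in auto)
  moreover have "{y. 0 \<le> ?P y} \<union> {y. ?P y \<le> 0} = UNIV" by auto
  ultimately show ?thesis by (simp add: sw_def)
qed


section \<open>Trajectories reach the switching surface\<close>

lemma norm_triple_le: "norm (a::real, b::real, c::real) \<le> \<bar>a\<bar> + \<bar>b\<bar> + \<bar>c\<bar>"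
  using norm_Pair_le[of a "(b, c)"] norm_Pair_le[of b c] by simp

text \<open>\<open>y3\<close> has a derivative only almost everywhere; bounds on its increments suffice for the sequel.\<close>

locale triple_integrator =
  fixes T K :: real and y1 y2 y3 :: "real \<Rightarrow> real"
  assumes y1: "T \<le> t \<Longrightarrow> (y1 has_real_derivative y2 t) (at t)"
    and y2: "T \<le> t \<Longrightarrow> (y2 has_real_derivative y3 t) (at t)"
    and y3_lipschitz: "T \<le> p \<Longrightarrow> p \<le> q \<Longrightarrow> \<bar>y3 q - y3 p\<bar> \<le> K * (q - p)"
    and y3_pos: "T \<le> p \<Longrightarrow> p \<le> q \<Longrightarrow> (\<And>t. p < t \<Longrightarrow> t < q \<Longrightarrow> 0 < sw (y1 t, y2 t, y3 t)) \<Longrightarrow>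
      y3 q - y3 p \<le> - (q - p)"
    and y3_neg: "T \<le> p \<Longrightarrow> p \<le> q \<Longrightarrow> (\<And>t. p < t \<Longrightarrow> t < q \<Longrightarrow> sw (y1 t, y2 t, y3 t) < 0) \<Longrightarrow>
      q - p \<le> y3 q - y3 p"
begin

lemma uminus: "triple_integrator T K (\<lambda>t. - y1 t) (\<lambda>t. - y2 t) (\<lambda>t. - y3 t)"
proof
  fix p q :: real assume pq: "T \<le> p" "p \<le> q"
  show "\<bar>- y3 q - - y3 p\<bar> \<le> K * (q - p)" using y3_lipschitz[OF pq] by simp
  have m: "sw (- y1 t, - y2 t, - y3 t) = - sw (y1 t, y2 t, y3 t)" for t
    using sw_uminus[of "(y1 t, y2 t, y3 t)"] by simp
  show "- y3 q - - y3 p \<le> - (q - p)" if "\<And>t. p < t \<Longrightarrow> t < q \<Longrightarrow> 0 < sw (- y1 t, - y2 t, - y3 t)"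
    using y3_neg[OF pq] that m by simp
  show "q - p \<le> - y3 q - - y3 p" if "\<And>t. p < t \<Longrightarrow> t < q \<Longrightarrow> sw (- y1 t, - y2 t, - y3 t) < 0"
    using y3_pos[OF pq] that m by simp
qed (auto intro!: DERIV_minus y1 y2)

lemma continuous:
  "continuous_on {T..} y1" "continuous_on {T..} y2" "continuous_on {T..} y3"
proof -
  show "continuous_on {T..} y1" "continuous_on {T..} y2"
    by (auto intro!: continuous_at_imp_continuous_on DERIV_isCont[OF y1] DERIV_isCont[OF y2])
  have "dist (y3 q) (y3 p) \<le> \<bar>K\<bar> * dist q p" if "T \<le> p" "T \<le> q" for p q
  proof (cases "p \<le> q")
    case True
    have "K * (q - p) \<le> \<bar>K\<bar> * (q - p)" using True by (intro mult_right_mono) auto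
    then show ?thesis using y3_lipschitz[OF that(1) True] True by (simp add: dist_real_def)
  next
    case False
    then have pq: "q \<le> p" by simp
    then have "K * (p - q) \<le> \<bar>K\<bar> * (p - q)" by (intro mult_right_mono) auto
    moreover have "\<bar>y3 p - y3 q\<bar> \<le> K * (p - q)" using y3_lipschitz[OF that(2) pq] .
    ultimately have "\<bar>y3 p - y3 q\<bar> \<le> \<bar>K\<bar> * (p - q)" by linarith
    then show ?thesis using pq by (simp add: dist_real_def abs_minus_commute)
  qed
  then have "\<bar>K\<bar>-lipschitz_on {T..} y3" by (intro lipschitz_onI) auto
  then show "continuous_on {T..} y3" by (rule lipschitz_on_continuous_on)
qed

lemma continuous_sw: "continuous_on {T..} (\<lambda>t. sw (y1 t, y2 t, y3 t))"
  by (intro continuous_on_compose2[OF continuous_on_sw] continuous_intros continuous) auto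

text \<open>As jerk -1 preserves \<open>sw_plus\<close>, the linear terms coming from
  \<open>y1\<close> and \<open>y2\<close> add up to the slope times \<open>h\<close>. The increment
  of \<open>y3\<close> is kept as it is, because \<open>y3\<close> need not be differentiable at
  \<open>t\<close>.\<close>

lemma sw_plus_expansion:
  assumes t: "T \<le> t" and "0 < \<epsilon>"
  shows "\<forall>\<^sub>F h in at_right 0.
    \<bar>sw_plus (y1 (t + h), y2 (t + h), y3 (t + h)) - sw_plus (y1 t, y2 t, y3 t)
      - sw_slope (y2 t) (y3 t) * (y3 (t + h) - y3 t + h)\<bar> \<le> \<epsilon> * h"
proof -
  let ?Y = "\<lambda>h. (y1 (t + h), y2 (t + h), y3 (t + h))" and ?x = "(y1 t, y2 t, y3 t)"
  define F2 where "F2 = y3 t + 3 / 2 * sqrt \<bar>y2 t + (y3 t)\<^sup>2 / 2\<bar>"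
  \<comment> \<open>\<open>M * h\<close> will bound the increment of the whole state, which makes
    the error of the linearization one of order \<open>h\<close>. The errors of \<open>y1\<close>
    and of \<open>y2\<close>, the latter weighted by \<open>F2\<close>, are absorbed by
    \<open>e2\<close>; each of the two parts gets half of \<epsilon>.\<close>
  define M where "M = \<bar>y2 t\<bar> + 1 + (\<bar>y3 t\<bar> + 1) + \<bar>K\<bar>"
  have M: "0 < M" by (simp add: M_def)
  have h0: "\<forall>\<^sub>F h in at_right (0::real). 0 < h" by (simp add: eventually_at_right_less)
  have Y: "(?Y \<longlongrightarrow> ?x) (at_right 0)"
    by (intro tendsto_Pair continuous_on_tendsto_at_right[OF _ t] continuous)
  define e2 where "e2 = \<epsilon> / (2 * (1 + \<bar>F2\<bar>))"
  have e2: "0 < e2" "e2 * (1 + \<bar>F2\<bar>) = \<epsilon> / 2" using \<open>0 < \<epsilon>\<close> by (auto simp: e2_def field_simps)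
  have e1: "0 < \<epsilon> / (2 * M)" using M \<open>0 < \<epsilon>\<close> by simp
  note D = has_derivative_eventually_le[OF has_derivative_sw_plus e1 Y]
  from D h0 has_real_derivative_at_right_le[OF y1[OF t] zero_less_one]
    has_real_derivative_at_right_le[OF y2[OF t] zero_less_one]
    has_real_derivative_at_right_le[OF y1[OF t] e2(1)] has_real_derivative_at_right_le[OF y2[OF t] e2(1)]
  show ?thesis
  proof eventually_elim
    case (elim h)
    define d1 d2 d3 where "d1 = y1 (t + h) - y1 t" and "d2 = y2 (t + h) - y2 t" and "d3 = y3 (t + h) - y3 t"
    have *: "\<bar>a\<bar> \<le> (\<bar>b\<bar> + 1) * h" if "\<bar>a - b * h\<bar> \<le> 1 * h" for a b :: real
    proof -
      have "\<bar>a\<bar> \<le> \<bar>a - b * h\<bar> + \<bar>b * h\<bar>" by linarith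
      also have "\<bar>b * h\<bar> = \<bar>b\<bar> * h" using elim by (simp add: abs_mult)
      finally show ?thesis using that by (simp add: algebra_simps)
    qed
    have "\<bar>d3\<bar> \<le> K * h" using y3_lipschitz[OF t, of "t + h"] elim by (simp add: d3_def)
    also have "K * h \<le> \<bar>K\<bar> * h" using elim by (intro mult_right_mono) auto
    finally have "\<bar>d1\<bar> + \<bar>d2\<bar> + \<bar>d3\<bar> \<le> M * h"
      using *[of d1 "y2 t"] *[of d2 "y3 t"] elim by (simp add: M_def d1_def d2_def algebra_simps)
    then have n: "norm (d1, d2, d3) \<le> M * h" using norm_triple_le order_trans by blast
    have "\<bar>sw_plus (?Y h) - sw_plus ?x - (d1 + F2 * d2 + sw_slope (y2 t) (y3 t) * d3)\<bar>
        \<le> \<epsilon> / (2 * M) * norm (d1, d2, d3)"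
      using elim(1) by (simp add: d1_def d2_def d3_def F2_def)
    also have "\<dots> \<le> \<epsilon> / (2 * M) * (M * h)" using n e1 by (intro mult_left_mono) auto
    also have "\<dots> = \<epsilon> / 2 * h" using M by (simp add: field_simps)
    finally have A: "\<bar>sw_plus (?Y h) - sw_plus ?x - (d1 + F2 * d2 + sw_slope (y2 t) (y3 t) * d3)\<bar> \<le> \<epsilon> / 2 * h" .
    have "\<bar>F2 * (d2 - y3 t * h)\<bar> \<le> \<bar>F2\<bar> * (e2 * h)"
      unfolding abs_mult using elim by (intro mult_left_mono) (auto simp: d2_def)
    then have "\<bar>(d1 - y2 t * h) + F2 * (d2 - y3 t * h)\<bar> \<le> e2 * h + \<bar>F2\<bar> * (e2 * h)"
      using elim(5) unfolding d1_def by linarith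
    also have "\<dots> = e2 * (1 + \<bar>F2\<bar>) * h" by (simp add: algebra_simps)
    finally have B: "\<bar>(d1 - y2 t * h) + F2 * (d2 - y3 t * h)\<bar> \<le> \<epsilon> / 2 * h" by (simp only: e2(2))
    have "y2 t * h + F2 * (y3 t * h) = sw_slope (y2 t) (y3 t) * h"
      by (simp add: sw_slope_def F2_def algebra_simps power2_eq_square)
    then have "sw_plus (?Y h) - sw_plus ?x - sw_slope (y2 t) (y3 t) * (d3 + h) =
      (sw_plus (?Y h) - sw_plus ?x - (d1 + F2 * d2 + sw_slope (y2 t) (y3 t) * d3)) +
      ((d1 - y2 t * h) + F2 * (d2 - y3 t * h))" by (simp add: algebra_simps)
    then show ?case using A B unfolding d3_def by linarith
  qed
qed

lemma sw_minus_expansion: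
  assumes t: "T \<le> t" and "0 < \<epsilon>"
  shows "\<forall>\<^sub>F h in at_right 0.
    \<bar>sw_minus (y1 (t + h), y2 (t + h), y3 (t + h)) - sw_minus (y1 t, y2 t, y3 t)
      - sw_slope (- y2 t) (- y3 t) * (y3 (t + h) - y3 t - h)\<bar> \<le> \<epsilon> * h"
  using triple_integrator.sw_plus_expansion[OF uminus assms]
proof eventually_elim
  case (elim h)
  let ?A = "sw_plus (- y1 (t + h), - y2 (t + h), - y3 (t + h))" and ?B = "sw_plus (- y1 t, - y2 t, - y3 t)"
  let ?s = "sw_slope (- y2 t) (- y3 t)"
  have "- ?A - - ?B - ?s * (y3 (t + h) - y3 t - h) = - (?A - ?B - ?s * (- y3 (t + h) - - y3 t + h))"
    by (simp add: algebra_simps)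
  then show ?case using elim unfolding sw_minus_def by (simp only: uminus_Pair abs_minus_cancel)
qed

text \<open>Where \<open>sw\<close> is positive \<open>y3\<close> falls with rate at least 1, so the
  slope, which is nonnegative, is multiplied by something nonpositive; below the curve this factor
  is even at most \<open>- 2 * h\<close>. On the curve both branches start from the same value and
  both obey the bound, whichever of them the trajectory enters.\<close>

lemma sw_right_dini:
  assumes t: "T \<le> t" "t < q" and pos: "\<And>r. t < r \<Longrightarrow> r < q \<Longrightarrow> 0 < sw (y1 r, y2 r, y3 r)" and "0 < \<epsilon>"
  shows "\<forall>\<^sub>F h in at_right 0. sw (y1 (t + h), y2 (t + h), y3 (t + h)) \<le> sw (y1 t, y2 t, y3 t) + \<epsilon> * h"
proof -
  let ?P = "\<lambda>t. sw_curve (y2 t) (y3 t)" and ?Y = "\<lambda>t. (y1 t, y2 t, y3 t)"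
  have h0: "\<forall>\<^sub>F h in at_right (0::real). 0 < h" by (simp add: eventually_at_right_less)
  have hq: "\<forall>\<^sub>F h in at_right 0. h < q - t"
    using t by (auto simp: eventually_at_right_field intro!: exI[of _ "q - t"])
  have y3h: "\<forall>\<^sub>F h in at_right 0. y3 (t + h) - y3 t + h \<le> 0"
    using h0 hq
  proof eventually_elim
    case (elim h)
    then show ?case using y3_pos[of t "t + h"] t pos by auto
  qed
  have plus: "\<forall>\<^sub>F h in at_right 0. sw_plus (?Y (t + h)) \<le> sw_plus (?Y t) + \<epsilon> * h" if "0 \<le> ?P t"
    using sw_plus_expansion[OF t(1) \<open>0 < \<epsilon>\<close>] y3h
  proof eventually_elim
    case (elim h)
    have "sw_slope (y2 t) (y3 t) * (y3 (t + h) - y3 t + h) \<le> 0"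
      using sw_slope_nonneg[OF that] elim by (intro mult_nonneg_nonpos) auto
    then show ?case using elim by linarith
  qed
  have minus: "\<forall>\<^sub>F h in at_right 0. sw_minus (?Y (t + h)) \<le> sw_minus (?Y t) + \<epsilon> * h" if "?P t \<le> 0"
    using sw_minus_expansion[OF t(1) \<open>0 < \<epsilon>\<close>] y3h h0
  proof eventually_elim
    case (elim h)
    have "sw_slope (- y2 t) (- y3 t) * (y3 (t + h) - y3 t - h) \<le> 0"
      using sw_slope_nonneg[of "- y2 t" "- y3 t"] that elim by (intro mult_nonneg_nonpos) (auto simp: sw_curve_uminus)
    then show ?case using elim by linarith
  qed
  have P: "((\<lambda>h. ?P (t + h)) \<longlongrightarrow> ?P t) (at_right 0)"
    by (rule continuous_on_tendsto_at_right[OF _ t(1)]) (intro continuous_intros continuous)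
  consider "0 < ?P t" | "?P t < 0" | "?P t = 0" by linarith
  then show ?thesis
  proof cases
    case 1
    note order_tendstoD(1)[OF P 1]
    moreover have "\<forall>\<^sub>F h in at_right 0. sw_plus (?Y (t + h)) \<le> sw_plus (?Y t) + \<epsilon> * h"
      by (rule plus) (use 1 in simp)
    ultimately show ?thesis by eventually_elim (use 1 in \<open>simp add: sw_def\<close>)
  next
    case 2
    note order_tendstoD(2)[OF P 2]
    moreover have "\<forall>\<^sub>F h in at_right 0. sw_minus (?Y (t + h)) \<le> sw_minus (?Y t) + \<epsilon> * h"
      by (rule minus) (use 2 in simp)
    ultimately show ?thesis by eventually_elim (use 2 in \<open>simp add: sw_def\<close>)
  next
    case 3
    then have "sw_plus (?Y t) = sw_minus (?Y t)" by (simp add: sw_on_curve)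
    moreover from this have "sw (?Y t) = sw_plus (?Y t)" by (simp add: sw_def)
    ultimately have "\<forall>\<^sub>F h in at_right 0. sw_plus (?Y (t + h)) \<le> sw (?Y t) + \<epsilon> * h"
      "\<forall>\<^sub>F h in at_right 0. sw_minus (?Y (t + h)) \<le> sw (?Y t) + \<epsilon> * h"
      using plus minus 3 by simp_all
    then show ?thesis by eventually_elim (simp add: sw_def)
  qed
qed

lemma sw_nonincreasing:
  assumes "T \<le> p" "p < q" "\<And>t. p < t \<Longrightarrow> t \<le> q \<Longrightarrow> 0 < sw (y1 t, y2 t, y3 t)"
  shows "sw (y1 q, y2 q, y3 q) \<le> sw (y1 p, y2 p, y3 p)"
proof (rule right_dini_nonincreasing[of p q "\<lambda>t. sw (y1 t, y2 t, y3 t)"])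
  fix t \<epsilon> :: real assume t: "p < t" "t < q" "0 < \<epsilon>"
  show "\<forall>\<^sub>F h in at_right 0. sw (y1 (t + h), y2 (t + h), y3 (t + h)) \<le> sw (y1 t, y2 t, y3 t) + \<epsilon> * h"
    by (rule sw_right_dini[of t q]) (use assms t in auto)
next
  show "continuous_on {p..q} (\<lambda>t. sw (y1 t, y2 t, y3 t))"
    using continuous_sw by (rule continuous_on_subset) (use assms in auto)
qed (use assms in auto)

text \<open>Refutes that \<open>sw\<close>, \<open>sw_curve\<close> or \<open>y3\<close> stays
  positive forever: each time \<open>y3\<close> would fall with rate at least 1, and at the instant
  obtained here none of the three is positive.\<close>

lemma eventually_all_le_minus_one:
  assumes "\<And>t. T \<le> t \<Longrightarrow> y3 t - y3 T \<le> - (t - T)"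
  shows "\<exists>t\<ge>T. y1 t \<le> -1 \<and> y2 t \<le> -1 \<and> y3 t \<le> -1"
proof -
  have "y3 t \<le> -1" if "T + \<bar>y3 T\<bar> + 1 \<le> t" for t
    using assms[of t] that by linarith
  then have 3: "\<exists>T1\<ge>T. \<forall>t\<ge>T1. y3 t \<le> -1" by (intro exI[of _ "T + \<bar>y3 T\<bar> + 1"]) auto
  have 2: "\<exists>T1\<ge>T. \<forall>t\<ge>T1. y2 t \<le> -1" by (rule eventually_le_minus_one[OF y2 3])
  have 1: "\<exists>T1\<ge>T. \<forall>t\<ge>T1. y1 t \<le> -1" by (rule eventually_le_minus_one[OF y1 2])
  from 1 2 3 obtain a b c where "T \<le> a" "\<And>t. a \<le> t \<Longrightarrow> y1 t \<le> -1" "\<And>t. b \<le> t \<Longrightarrow> y2 t \<le> -1"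
    "\<And>t. c \<le> t \<Longrightarrow> y3 t \<le> -1" by blast
  then show ?thesis by (intro exI[of _ "max a (max b c)"]) auto
qed

lemma sw_le_0: "\<exists>t\<ge>T. sw (y1 t, y2 t, y3 t) \<le> 0"
proof (rule ccontr)
  assume "\<not> ?thesis"
  then have pos: "0 < sw (y1 t, y2 t, y3 t)" if "T \<le> t" for t using that not_le by blast
  have "\<exists>t\<ge>T. y1 t \<le> -1 \<and> y2 t \<le> -1 \<and> y3 t \<le> -1"
    by (rule eventually_all_le_minus_one, rule y3_pos) (auto intro: pos)
  then obtain t where t: "T \<le> t" "y1 t \<le> -1" "y2 t \<le> -1" "y3 t \<le> -1" by blast
  have "y3 t * \<bar>y3 t\<bar> \<le> 0" using t by (intro mult_nonpos_nonneg) auto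
  then have "sw_curve (y2 t) (y3 t) < 0" using t unfolding sw_curve_def by linarith
  moreover have "0 \<le> sw_plus (- y1 t, - y2 t, - y3 t)"
  proof -
    have "0 \<le> - y1 t + (- y2 t) * (- y3 t) + (- y3 t) ^ 3 / 3 + pow32 (- y2 t + (- y3 t)\<^sup>2 / 2)"
      using t by (intro add_nonneg_nonneg pow32_nonneg mult_nonneg_nonneg divide_nonneg_nonneg zero_le_power) auto
    then show ?thesis unfolding sw_plus_def by simp
  qed
  ultimately have "sw (y1 t, y2 t, y3 t) \<le> 0" by (simp add: sw_def sw_minus_def)
  then show False using pos[OF t(1)] by simp
qed

lemma sw_zero: "\<exists>T'\<ge>T. \<forall>t\<ge>T'. sw (y1 t, y2 t, y3 t) = 0"
proof (rule zero_reached_and_kept[OF continuous_sw])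
  interpret neg: triple_integrator T K "\<lambda>t. - y1 t" "\<lambda>t. - y2 t" "\<lambda>t. - y3 t" by (rule uminus)
  have m: "sw (- y1 t, - y2 t, - y3 t) = - sw (y1 t, y2 t, y3 t)" for t
    using sw_uminus[of "(y1 t, y2 t, y3 t)"] by simp
  show "\<exists>t\<ge>T. 0 \<le> sw (y1 t, y2 t, y3 t)" using neg.sw_le_0 by (simp add: m)
  show "sw (y1 p, y2 p, y3 p) \<le> sw (y1 q, y2 q, y3 q)"
    if "T \<le> p" "p < q" "\<And>t. p < t \<Longrightarrow> t \<le> q \<Longrightarrow> sw (y1 t, y2 t, y3 t) < 0" for p q
    using neg.sw_nonincreasing[OF that(1,2)] that(3) by (simp add: m)
qed (fact sw_nonincreasing sw_le_0)+

section \<open>Motion on the surface, then on the curve\<close>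

lemma restrict: "T \<le> T' \<Longrightarrow> triple_integrator T' K y1 y2 y3"
  by unfold_locales (use y1 y2 y3_lipschitz y3_pos y3_neg in auto)


text \<open>On the switching surface, above the switching curve, \<open>sw_plus\<close> is constant along the
  trajectory, which by \<open>sw_slope_pos\<close> leaves \<open>-1\<close> as the only possible velocity of \<open>y3\<close>.\<close>

lemma y3_on_surface:
  assumes "T \<le> p" "p \<le> q" and sw: "\<And>t. p \<le> t \<Longrightarrow> t \<le> q \<Longrightarrow> sw (y1 t, y2 t, y3 t) = 0"
    and curve: "\<And>t. p < t \<Longrightarrow> t \<le> q \<Longrightarrow> 0 < sw_curve (y2 t) (y3 t)"
  shows "y3 q - y3 p = - (q - p)"
proof -
  let ?Y = "\<lambda>t. (y1 t, y2 t, y3 t)"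
  have near: "\<forall>\<^sub>F h in at_right 0. \<bar>y3 (t + h) - y3 t + h\<bar> \<le> \<epsilon> * h"
    if t: "p < t" "t < q" and "0 < \<epsilon>" for t \<epsilon>
  proof -
    define s where "s = sw_slope (y2 t) (y3 t)"
    have s: "0 < s" unfolding s_def using curve t by (intro sw_slope_pos) auto
    have plus0: "sw_plus (?Y r) = 0" if "p < r" "r \<le> q" for r
      using sw[of r] curve[of r] that by (simp add: sw_def)
    have h0: "\<forall>\<^sub>F h in at_right (0::real). 0 < h" by (simp add: eventually_at_right_less)
    have hq: "\<forall>\<^sub>F h in at_right 0. h < q - t"
      using t by (auto simp: eventually_at_right_field intro!: exI[of _ "q - t"])
    \<comment> \<open>The error is taken as \<open>\<epsilon> * s\<close> so that division by the
      slope leaves \<epsilon>.\<close>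
    have "T \<le> t" "0 < \<epsilon> * s" using t assms(1) s \<open>0 < \<epsilon>\<close> by auto
    from sw_plus_expansion[OF this] h0 hq show ?thesis
    proof eventually_elim
      case (elim h)
      have "\<bar>s * (y3 (t + h) - y3 t + h)\<bar> \<le> \<epsilon> * s * h"
        using elim plus0[of t] plus0[of "t + h"] t by (simp add: s_def)
      then have "s * \<bar>y3 (t + h) - y3 t + h\<bar> \<le> s * (\<epsilon> * h)"
        using s by (simp add: abs_mult mult_ac)
      then show ?case using s by simp
    qed
  qed
  have c: "continuous_on {p..q} y3" using continuous(3) by (rule continuous_on_subset) (use assms in auto)
  have "(\<lambda>t. y3 t + t) q \<le> (\<lambda>t. y3 t + t) p"
  proof (rule right_dini_nonincreasing[OF _ assms(2)])
    fix t \<epsilon> :: real assume "p < t" "t < q" "0 < \<epsilon>"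
    from near[OF this] show "\<forall>\<^sub>F h in at_right 0. y3 (t + h) + (t + h) \<le> y3 t + t + \<epsilon> * h"
      by eventually_elim linarith
  qed (intro continuous_intros c)
  moreover have "(\<lambda>t. - y3 t - t) q \<le> (\<lambda>t. - y3 t - t) p"
  proof (rule right_dini_nonincreasing[OF _ assms(2)])
    fix t \<epsilon> :: real assume "p < t" "t < q" "0 < \<epsilon>"
    from near[OF this] show "\<forall>\<^sub>F h in at_right 0. - y3 (t + h) - (t + h) \<le> - y3 t - t + \<epsilon> * h"
      by eventually_elim linarith
  qed (intro continuous_intros c)
  ultimately show ?thesis by simp
qed

text \<open>Above the curve \<open>y3\<close> has velocity exactly -1, so \<open>sw_curve\<close>
  becomes differentiable, with derivative \<open>y3 - \<bar>y3\<bar>\<close>, which is never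
  positive.\<close>

lemma sw_curve_nonincreasing:
  assumes p: "T \<le> p" "p < q" and sw: "\<And>t. p \<le> t \<Longrightarrow> t \<le> q \<Longrightarrow> sw (y1 t, y2 t, y3 t) = 0"
    and curve: "\<And>t. p < t \<Longrightarrow> t \<le> q \<Longrightarrow> 0 < sw_curve (y2 t) (y3 t)"
  shows "sw_curve (y2 q) (y3 q) \<le> sw_curve (y2 p) (y3 p)"
proof -
  have y3t: "y3 t = y3 p - (t - p)" if "p \<le> t" "t \<le> q" for t
    using y3_on_surface[OF p(1), of t] that sw curve by auto
  \<comment> \<open>The affine formula for \<open>y3\<close> is differentiable at the end points
    too.\<close>
  let ?f = "\<lambda>t. sw_curve (y2 t) (y3 p - (t - p))"
  have "?f q \<le> ?f p"
  proof (rule DERIV_nonpos_imp_nonincreasing[of p q ?f])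
    fix t assume t: "p \<le> t" "t \<le> q"
    have "((\<lambda>t. y3 p - (t - p)) has_real_derivative -1) (at t)"
      by (auto intro!: derivative_eq_intros)
    from DERIV_chain2[OF has_real_derivative_times_abs this]
    have "((\<lambda>t. (y3 p - (t - p)) * \<bar>y3 p - (t - p)\<bar>) has_real_derivative - 2 * \<bar>y3 t\<bar>) (at t)"
      using y3t[OF t] by simp
    then have "(?f has_real_derivative y3 t + - 2 * \<bar>y3 t\<bar> / 2) (at t)"
      unfolding sw_curve_def using p t
      by (intro DERIV_add y2 DERIV_cdivide) auto
    then show "\<exists>y. (?f has_real_derivative y) (at t) \<and> y \<le> 0"
      by (intro exI conjI) auto
  qed (use p in auto)
  then show ?thesis using y3t[of q] y3t[of p] p by simp
qed

lemma sw_curve_le_0: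
  assumes sw: "\<And>t. T \<le> t \<Longrightarrow> sw (y1 t, y2 t, y3 t) = 0"
  shows "\<exists>t\<ge>T. sw_curve (y2 t) (y3 t) \<le> 0"
proof (rule ccontr)
  assume "\<not> ?thesis"
  then have pos: "0 < sw_curve (y2 t) (y3 t)" if "T \<le> t" for t using that not_le by blast
  have "\<exists>t\<ge>T. y1 t \<le> -1 \<and> y2 t \<le> -1 \<and> y3 t \<le> -1"
    by (rule eventually_all_le_minus_one, rule eq_refl, rule y3_on_surface) (auto intro: pos sw)
  then obtain t where t: "T \<le> t" "y1 t \<le> -1" "y2 t \<le> -1" "y3 t \<le> -1" by blast
  have "y3 t * \<bar>y3 t\<bar> \<le> 0" using t by (intro mult_nonpos_nonneg) auto
  then have "sw_curve (y2 t) (y3 t) < 0" using t unfolding sw_curve_def by linarith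
  then show False using pos[OF t(1)] by simp
qed

lemma sw_curve_zero:
  assumes sw: "\<And>t. T \<le> t \<Longrightarrow> sw (y1 t, y2 t, y3 t) = 0"
  shows "\<exists>T'\<ge>T. \<forall>t\<ge>T'. sw_curve (y2 t) (y3 t) = 0"
proof (rule zero_reached_and_kept)
  interpret neg: triple_integrator T K "\<lambda>t. - y1 t" "\<lambda>t. - y2 t" "\<lambda>t. - y3 t" by (rule uminus)
  have m: "sw (- y1 t, - y2 t, - y3 t) = - sw (y1 t, y2 t, y3 t)" for t
    using sw_uminus[of "(y1 t, y2 t, y3 t)"] by simp
  show "continuous_on {T..} (\<lambda>t. sw_curve (y2 t) (y3 t))" by (intro continuous_intros continuous)
  show "\<exists>t\<ge>T. sw_curve (y2 t) (y3 t) \<le> 0" by (rule sw_curve_le_0[OF sw])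
  show "\<exists>t\<ge>T. 0 \<le> sw_curve (y2 t) (y3 t)"
    using neg.sw_curve_le_0 sw by (simp add: m sw_curve_uminus)
  fix p q :: real assume pq: "T \<le> p" "p < q"
  show "sw_curve (y2 q) (y3 q) \<le> sw_curve (y2 p) (y3 p)"
    if "\<And>t. p < t \<Longrightarrow> t \<le> q \<Longrightarrow> 0 < sw_curve (y2 t) (y3 t)"
    using pq sw that by (intro sw_curve_nonincreasing) auto
  show "sw_curve (y2 p) (y3 p) \<le> sw_curve (y2 q) (y3 q)"
    if "\<And>t. p < t \<Longrightarrow> t \<le> q \<Longrightarrow> sw_curve (y2 t) (y3 t) < 0"
    using neg.sw_curve_nonincreasing[OF pq] sw pq that by (simp add: m sw_curve_uminus)
qed

text \<open>On the curve \<open>y3 = sqrt (- 2 * y2)\<close> inherits differentiability from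
  \<open>y2\<close>, with derivative \<open>- y3 / y3 = - 1\<close>. Thus the geometry of the curve
  fixes the jerk, as that of the surface did before.\<close>

lemma y3_on_curve:
  assumes p: "T \<le> p" "p \<le> q" and curve: "\<And>t. p \<le> t \<Longrightarrow> t \<le> q \<Longrightarrow> sw_curve (y2 t) (y3 t) = 0"
    and pos: "\<And>t. p < t \<Longrightarrow> t \<le> q \<Longrightarrow> 0 < y3 t"
  shows "y3 q - y3 p = - (q - p)"
proof (cases "p = q")
  case False
  have y3t: "y3 t = sqrt (- 2 * y2 t)" "y2 t < 0" if "p < t" "t \<le> q" for t
  proof -
    have e: "- 2 * y2 t = y3 t * y3 t" using curve[of t] pos[of t] that by (simp add: sw_curve_def)
    moreover have "0 < y3 t * y3 t" using pos[of t] that by simp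
    ultimately show "y2 t < 0" by linarith
    show "y3 t = sqrt (- 2 * y2 t)" unfolding e using pos[of t] that by simp
  qed
  have "continuous_on {p..q} (\<lambda>t. y3 t + t)"
    using continuous(3) p by (intro continuous_intros) (auto elim: continuous_on_subset)
  moreover have "((\<lambda>t. y3 t + t) has_real_derivative 0) (at t)" if t: "p < t" "t < q" for t
  proof -
    have "((\<lambda>t. sqrt (- 2 * y2 t) + t) has_real_derivative
        inverse (sqrt (- 2 * y2 t)) / 2 * (- 2 * y3 t) + 1) (at t)"
      using y3t(2)[of t] t p
      by (intro DERIV_add DERIV_ident DERIV_chain2[OF DERIV_real_sqrt] DERIV_cmult y2) auto
    moreover have "inverse (sqrt (- 2 * y2 t)) / 2 * (- 2 * y3 t) + 1 = 0"
      using pos[of t] t unfolding y3t(1)[of t, symmetric, OF t(1) less_imp_le[OF t(2)]] by simp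
    ultimately have "((\<lambda>t. sqrt (- 2 * y2 t) + t) has_real_derivative 0) (at t)" by simp
    then show ?thesis
    proof (rule has_field_derivative_transform_within_open[of _ _ _ "{p<..<q}"])
      fix x assume "x \<in> {p<..<q}"
      then show "sqrt (- 2 * y2 x) + x = y3 x + x" using y3t(1)[of x] by simp
    qed (use t in auto)
  qed
  ultimately have "y3 q + q = y3 p + p" using False p by (intro DERIV_isconst2[of p q "\<lambda>t. y3 t + t"]) auto
  then show ?thesis by simp
qed simp

lemma y3_le_0:
  assumes curve: "\<And>t. T \<le> t \<Longrightarrow> sw_curve (y2 t) (y3 t) = 0"
  shows "\<exists>t\<ge>T. y3 t \<le> 0"
proof (rule ccontr)
  assume "\<not> ?thesis"
  then have pos: "0 < y3 t" if "T \<le> t" for t using that not_le by blast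
  have "\<exists>t\<ge>T. y1 t \<le> -1 \<and> y2 t \<le> -1 \<and> y3 t \<le> -1"
    by (rule eventually_all_le_minus_one, rule eq_refl, rule y3_on_curve) (auto intro: pos curve)
  then obtain t where t: "T \<le> t" "y3 t \<le> -1" by blast
  then show False using pos[OF t(1)] by simp
qed

lemma y3_zero:
  assumes curve: "\<And>t. T \<le> t \<Longrightarrow> sw_curve (y2 t) (y3 t) = 0"
  shows "\<exists>T'\<ge>T. \<forall>t\<ge>T'. y3 t = 0"
proof (rule zero_reached_and_kept[OF continuous(3)])
  interpret neg: triple_integrator T K "\<lambda>t. - y1 t" "\<lambda>t. - y2 t" "\<lambda>t. - y3 t" by (rule uminus)
  show "\<exists>t\<ge>T. y3 t \<le> 0" by (rule y3_le_0[OF curve])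
  show "\<exists>t\<ge>T. 0 \<le> y3 t" using neg.y3_le_0 curve by (simp add: sw_curve_uminus)
  fix p q :: real assume pq: "T \<le> p" "p < q"
  show "y3 q \<le> y3 p" if "\<And>t. p < t \<Longrightarrow> t \<le> q \<Longrightarrow> 0 < y3 t"
    using y3_on_curve[OF pq(1), of q] pq curve that by auto
  show "y3 p \<le> y3 q" if "\<And>t. p < t \<Longrightarrow> t \<le> q \<Longrightarrow> y3 t < 0"
    using neg.y3_on_curve[OF pq(1), of q] pq curve that by (auto simp: sw_curve_uminus)
qed

theorem finite_time_convergence: "\<exists>T'\<ge>T. \<forall>t\<ge>T'. y1 t = 0"
proof -
  obtain T1 where T1: "T \<le> T1" "\<And>t. T1 \<le> t \<Longrightarrow> sw (y1 t, y2 t, y3 t) = 0"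
    using sw_zero by blast
  obtain T2 where T2: "T1 \<le> T2" "\<And>t. T2 \<le> t \<Longrightarrow> sw_curve (y2 t) (y3 t) = 0"
    using triple_integrator.sw_curve_zero[OF restrict T1(2)] T1(1) by blast
  have "T \<le> T2" using T1 T2 by simp
  then obtain T3 where T3: "T2 \<le> T3" "\<And>t. T3 \<le> t \<Longrightarrow> y3 t = 0"
    using triple_integrator.y3_zero[OF restrict T2(2)] by blast
  have "y1 t = 0" if "T3 \<le> t" for t
  proof -
    have "T2 \<le> t" "T1 \<le> t" using T2 T3 that by auto
    note T3(2)[OF that] T2(2)[OF this(1)] T1(2)[OF this(2)]
    then show ?thesis using sw_on_curve(1)[of "y2 t" "y3 t" "y1 t"] by (simp add: sw_def)
  qed
  then show ?thesis using T1 T2 T3 by (intro exI[of _ T3]) auto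
qed

end

section \<open>Double integrators with suboptimal feedback\<close>

text \<open>Two equal values enclose an extremum; if \<open>f\<close> is constant between them the
  midpoint is one, because weak extrema count. Hence \<open>f\<close> is injective.\<close>

lemma strict_monotone_if_no_local_extremum:
  fixes f :: "real \<Rightarrow> real"
  assumes cont: "continuous_on {a..b} f" and no: "\<And>t. a < t \<Longrightarrow> t < b \<Longrightarrow> \<not> local_extremum f t"
  shows "strict_mono_on {a..b} f \<or> strict_antimono_on {a..b} f"
proof -
  have False if xz: "x \<in> {a..b}" "z \<in> {a..b}" "x < z" "f x = f z" for x z
  proof -
    have c: "continuous_on {x..z} f" using cont by (rule continuous_on_subset) (use xz in auto)
    have ne: "compact {x..z}" "{x..z} \<noteq> {}" using xz by auto
    have interior: "local_extremum f t"
      if t: "x < t" "t < z" and ex: "(\<forall>r\<in>{x..z}. f r \<le> f t) \<or> (\<forall>r\<in>{x..z}. f t \<le> f r)" for t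
    proof -
      have ev: "\<forall>\<^sub>F r in nhds t. r \<in> {x<..<z}"
        using t by (intro eventually_nhds_in_open) auto
      have "\<forall>\<^sub>F r in nhds t. f r \<le> f t" if "\<forall>r\<in>{x..z}. f r \<le> f t"
        using ev by eventually_elim (use that in auto)
      moreover have "\<forall>\<^sub>F r in nhds t. f t \<le> f r" if "\<forall>r\<in>{x..z}. f t \<le> f r"
        using ev by eventually_elim (use that in auto)
      ultimately show ?thesis using ex unfolding local_extremum_def by blast
    qed
    obtain u where u: "u \<in> {x..z}" "\<And>r. r \<in> {x..z} \<Longrightarrow> f r \<le> f u"
      using continuous_attains_sup[OF ne c] by blast
    obtain l where l: "l \<in> {x..z}" "\<And>r. r \<in> {x..z} \<Longrightarrow> f l \<le> f r"
      using continuous_attains_inf[OF ne c] by blast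
    have "\<exists>t. x < t \<and> t < z \<and> local_extremum f t"
    proof (cases "(x < u \<and> u < z) \<or> (x < l \<and> l < z)")
      case True
      then show ?thesis
      proof
        assume "x < u \<and> u < z"
        then have "local_extremum f u" using u(2) by (intro interior) auto
        then show ?thesis using \<open>x < u \<and> u < z\<close> by blast
      next
        assume "x < l \<and> l < z"
        then have "local_extremum f l" using l(2) by (intro interior) auto
        then show ?thesis using \<open>x < l \<and> l < z\<close> by blast
      qed
    next
      case False
      then have "u = x \<or> u = z" "l = x \<or> l = z" using u(1) l(1) by auto
      then have "f u = f x" "f l = f x" using xz(4) by auto
      then have eq: "f r = f x" if "r \<in> {x..z}" for r using u(2)[OF that] l(2)[OF that] by linarith
      have "\<forall>r\<in>{x..z}. f r \<le> f ((x + z) / 2)"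
      proof
        fix r assume "r \<in> {x..z}"
        moreover have "(x + z) / 2 \<in> {x..z}" using xz(3) by simp
        ultimately show "f r \<le> f ((x + z) / 2)" using eq[of r] eq[of "(x + z) / 2"] by linarith
      qed
      then have "local_extremum f ((x + z) / 2)" using xz(3) by (intro interior) auto
      then show ?thesis using xz(3) by (intro exI[of _ "(x + z) / 2"]) auto
    qed
    then show False using no xz by auto
  qed
  then have "inj_on f {a..b}" unfolding inj_on_def by (metis linorder_neqE)
  then show ?thesis using injective_eq_monotone_map[of "{a..b}" f] cont is_interval_cc by blast
qed

lemma local_extremum_uminus: "local_extremum (\<lambda>t. - y t) = local_extremum y"
  by (auto simp: local_extremum_def fun_eq_iff)

text \<open>\<open>p\<close> is the velocity and \<open>S\<close> the set of update instants.
  \<kappa> is the guaranteed acceleration towards \<open>m / 2\<close>, \<open>K\<close> the largest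
  one between \<open>m\<close> and \<open>m / 2\<close>, where the gain is reduced, and \<kappa>'
  the guaranteed braking beyond \<open>m / 2\<close>. All of them bound increments of
  \<open>p\<close>, which has no pointwise derivative in general.\<close>

locale suboptimal =
  fixes \<kappa> \<kappa>' K :: real and y p m :: "real \<Rightarrow> real" and S :: "real set"
  assumes gains: "0 < \<kappa>" "0 < \<kappa>'" "0 < K" "K < 3 * \<kappa>'"
    and y: "0 < t \<Longrightarrow> (y has_real_derivative p t) (at t)"
    and continuous_y: "continuous_on {0..} y" and continuous_p: "continuous_on {0..} p"
    and S: "0 \<in> S" "S \<subseteq> {0..}"
    and extremum_in_S: "0 < s \<Longrightarrow> local_extremum y s \<Longrightarrow> s \<in> S"
    and p_S: "s \<in> S \<Longrightarrow> 0 < s \<Longrightarrow> p s = 0"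
    and last_S: "0 \<le> t \<Longrightarrow> \<exists>s\<in>S. s \<le> t \<and> (\<forall>r\<in>S. r \<le> t \<longrightarrow> r \<le> s) \<and> m t = y s"
    and above: "0 \<le> a \<Longrightarrow> a \<le> b \<Longrightarrow> (\<And>t. a < t \<Longrightarrow> t < b \<Longrightarrow> m t / 2 < y t) \<Longrightarrow>
      p b - p a \<le> - \<kappa> * (b - a)"
    and below: "0 \<le> a \<Longrightarrow> a \<le> b \<Longrightarrow> (\<And>t. a < t \<Longrightarrow> t < b \<Longrightarrow> y t < m t / 2) \<Longrightarrow>
      \<kappa> * (b - a) \<le> p b - p a"
    and slow_pos: "0 \<le> a \<Longrightarrow> a \<le> b \<Longrightarrow>
      (\<And>t. a < t \<Longrightarrow> t < b \<Longrightarrow> 0 < m t \<and> m t / 2 < y t \<and> y t < m t) \<Longrightarrow> - K * (b - a) \<le> p b - p a"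
    and slow_neg: "0 \<le> a \<Longrightarrow> a \<le> b \<Longrightarrow>
      (\<And>t. a < t \<Longrightarrow> t < b \<Longrightarrow> m t < 0 \<and> m t < y t \<and> y t < m t / 2) \<Longrightarrow> p b - p a \<le> K * (b - a)"
    and fast_pos: "0 \<le> a \<Longrightarrow> a \<le> b \<Longrightarrow>
      (\<And>t. a < t \<Longrightarrow> t < b \<Longrightarrow> 0 < m t \<and> y t < m t / 2) \<Longrightarrow> \<kappa>' * (b - a) \<le> p b - p a"
    and fast_neg: "0 \<le> a \<Longrightarrow> a \<le> b \<Longrightarrow>
      (\<And>t. a < t \<Longrightarrow> t < b \<Longrightarrow> m t < 0 \<and> m t / 2 < y t) \<Longrightarrow> p b - p a \<le> - \<kappa>' * (b - a)"
begin

lemma uminus: "suboptimal \<kappa> \<kappa>' K (\<lambda>t. - y t) (\<lambda>t. - p t) (\<lambda>t. - m t) S"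
proof
  fix a b :: real assume ab: "0 \<le> a" "a \<le> b"
  show "- p b - - p a \<le> - \<kappa> * (b - a)" if "\<And>t. a < t \<Longrightarrow> t < b \<Longrightarrow> - m t / 2 < - y t"
    using below[OF ab] that by simp
  show "\<kappa> * (b - a) \<le> - p b - - p a" if "\<And>t. a < t \<Longrightarrow> t < b \<Longrightarrow> - y t < - m t / 2"
    using above[OF ab] that by simp
  show "- K * (b - a) \<le> - p b - - p a"
    if "\<And>t. a < t \<Longrightarrow> t < b \<Longrightarrow> 0 < - m t \<and> - m t / 2 < - y t \<and> - y t < - m t"
    using slow_neg[OF ab] that by simp
  show "- p b - - p a \<le> K * (b - a)"
    if "\<And>t. a < t \<Longrightarrow> t < b \<Longrightarrow> - m t < 0 \<and> - m t < - y t \<and> - y t < - m t / 2"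
    using slow_pos[OF ab] that by simp
  show "\<kappa>' * (b - a) \<le> - p b - - p a" if "\<And>t. a < t \<Longrightarrow> t < b \<Longrightarrow> 0 < - m t \<and> - y t < - m t / 2"
    using fast_neg[OF ab] that by simp
  show "- p b - - p a \<le> - \<kappa>' * (b - a)" if "\<And>t. a < t \<Longrightarrow> t < b \<Longrightarrow> - m t < 0 \<and> - m t / 2 < - y t"
    using fast_pos[OF ab] that by simp
next
  fix t :: real assume "0 \<le> t"
  then show "\<exists>s\<in>S. s \<le> t \<and> (\<forall>r\<in>S. r \<le> t \<longrightarrow> r \<le> s) \<and> - m t = - y s" using last_S by auto
qed (use gains S continuous_y continuous_p y p_S extremum_in_S in
    \<open>auto intro!: continuous_on_minus DERIV_minus simp: local_extremum_uminus\<close>)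

text \<open>From rest at \<open>q > 0\<close>, the fall to \<open>q / 2\<close> with acceleration at
  most \<open>K\<close> yields a squared speed of at most \<open>K * q\<close>. Braking with at
  least \<kappa>' then covers at most \<open>K * q / (2 * \<kappa>')\<close> and so ends at or above
  \<open>- ((K / \<kappa>' - 1) / 2) * q\<close>. The 1 / 2 accounts for a stop on the original
  side, which lies below \<open>q / 2\<close>.\<close>

definition \<rho> :: real where "\<rho> = max (1 / 2) ((K / \<kappa>' - 1) / 2)"
text \<open>The two terms, multiplied by \<open>sqrt q\<close>, bound the durations of the fall to
  \<open>q / 2\<close> and of the braking.\<close>

definition C :: real where "C = 1 / sqrt \<kappa> + sqrt K / \<kappa>'"

lemma \<rho>: "1 / 2 \<le> \<rho>" "\<rho> < 1"
  using gains by (auto simp: \<rho>_def field_simps)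

lemma C_pos: "0 < C"
  using gains by (auto simp: C_def intro!: add_pos_pos)

section \<open>One phase between updates\<close>

lemma upper_parabola:
  assumes "0 \<le> a" "a \<le> b" "\<And>t. a < t \<Longrightarrow> t < b \<Longrightarrow> p t \<le> A + B * (t - a)"
  shows "y b \<le> y a + A * (b - a) + B * (b - a)\<^sup>2 / 2"
proof -
  let ?f = "\<lambda>t. A * (t - a) + B * (t - a)\<^sup>2 / 2 - y t"
  have "?f a \<le> ?f b"
  proof (rule DERIV_nonneg_imp_increasing_open[OF assms(2)])
    fix t assume t: "a < t" "t < b"
    have "(?f has_real_derivative (A + B * (t - a)) - p t) (at t)"
      using t assms(1) by (auto intro!: derivative_eq_intros y)
    then show "\<exists>l. (?f has_real_derivative l) (at t) \<and> 0 \<le> l"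
      using assms(3)[OF t] by (intro exI conjI) auto
  qed (intro continuous_intros continuous_on_subset[OF continuous_y], use assms in auto)
  then show ?thesis by simp
qed

lemma lower_parabola:
  assumes "0 \<le> a" "a \<le> b" "\<And>t. a < t \<Longrightarrow> t < b \<Longrightarrow> A + B * (t - a) \<le> p t"
  shows "y a + A * (b - a) + B * (b - a)\<^sup>2 / 2 \<le> y b"
proof -
  have "- p t \<le> - A + - B * (t - a)" if "a < t" "t < b" for t using assms(3)[OF that] by simp
  from suboptimal.upper_parabola[OF uminus assms(1,2) this] show ?thesis by simp
qed

lemma near:
  fixes f :: "real \<Rightarrow> real"
  assumes "continuous_on {0..} f" "0 \<le> r" "l < f r" "f r < u"
  obtains \<delta> where "0 < \<delta>" "\<And>t. 0 \<le> t \<Longrightarrow> \<bar>t - r\<bar> \<le> \<delta> \<Longrightarrow> l < f t \<and> f t < u"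
proof -
  obtain d where d: "0 < d" "\<And>t. 0 \<le> t \<Longrightarrow> dist t r < d \<Longrightarrow> dist (f t) (f r) < min (f r - l) (u - f r)"
    using assms(1)[unfolded continuous_on_iff, rule_format, of r "min (f r - l) (u - f r)"] assms
    by auto
  show thesis
  proof (rule that[of "d / 2"])
    fix t assume "0 \<le> t" "\<bar>t - r\<bar> \<le> d / 2"
    then show "l < f t \<and> f t < u" using d(1) d(2)[of t] by (auto simp: dist_real_def)
  qed (use d in simp)
qed

lemma m_eq:
  assumes "r \<in> S" "r \<le> t" "\<And>s. r < s \<Longrightarrow> s \<le> t \<Longrightarrow> s \<notin> S"
  shows "m t = y r"
proof -
  have "0 \<le> t" using assms S(2) by auto
  from last_S[OF this] obtain s where s: "s \<in> S" "s \<le> t" "\<forall>r\<in>S. r \<le> t \<longrightarrow> r \<le> s" "m t = y s" by auto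
  then have "r \<le> s" using assms by auto
  then show ?thesis using assms(3)[of s] s by (cases "r = s") auto
qed

lemma monotone_gap:
  assumes "0 \<le> a" "\<And>s. a < s \<Longrightarrow> s < b \<Longrightarrow> s \<notin> S"
  shows "strict_mono_on {a..b} y \<or> strict_antimono_on {a..b} y"
proof (rule strict_monotone_if_no_local_extremum)
  show "continuous_on {a..b} y" using continuous_y by (rule continuous_on_subset) (use assms in auto)
  show "\<not> local_extremum y t" if "a < t" "t < b" for t
    using extremum_in_S[of t] assms that by auto
qed

text \<open>Without updates \<open>y\<close> is strictly monotone, and a start from rest above
  \<open>m / 2\<close> decides the direction.\<close>

lemma decreasing_gap:
  assumes r: "0 \<le> r" "p r = 0" "r < b" and gap: "\<And>s. r < s \<Longrightarrow> s < b \<Longrightarrow> s \<notin> S"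
    and e: "r < e" "e \<le> b" "\<And>t. r < t \<Longrightarrow> t < e \<Longrightarrow> m t / 2 < y t"
  shows "strict_antimono_on {r..b} y"
proof -
  have "p t \<le> 0 + - \<kappa> * (t - r)" if "r < t" "t < e" for t
    using above[OF r(1), of t] that e r by auto
  from upper_parabola[OF r(1) less_imp_le[OF e(1)] this]
  have "y e \<le> y r - \<kappa> * (e - r)\<^sup>2 / 2" by simp
  moreover have "0 < \<kappa> * (e - r)\<^sup>2 / 2" using gains e by simp
  ultimately have "y e < y r" by linarith
  then have "\<not> strict_mono_on {r..b} y" using e monotone_onD[of "{r..b}" "(<)" "(<)" y r e] by auto
  then show ?thesis using monotone_gap[OF r(1) gap] by blast
qed

lemma p_le_0:
  assumes "strict_antimono_on {r..b} y" "0 \<le> r" "r < b"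
  shows "p b \<le> 0"
proof (rule ccontr)
  assume "\<not> p b \<le> 0"
  then obtain d where d: "0 < d" "\<And>h. 0 < h \<Longrightarrow> h < d \<Longrightarrow> y (b - h) < y b"
    using DERIV_pos_inc_left[OF y[of b], of ] assms by auto
  define h where "h = min (d / 2) (b - r)"
  have "0 < h" "h < d" "r \<le> b - h" using d assms by (auto simp: h_def)
  moreover have "y b < y (b - h)"
    using monotone_onD[OF assms(1), of "b - h" b] \<open>0 < h\<close> \<open>r \<le> b - h\<close> assms by auto
  ultimately show False using d(2)[of h] by simp
qed

lemma phase_pos:
  assumes r: "r \<in> S" "p r = 0" "0 < y r" "r < b" and gap: "\<And>s. r < s \<Longrightarrow> s < b \<Longrightarrow> s \<notin> S"
  shows "y b < y r" "- \<rho> * y r \<le> y b" "b - r \<le> C * sqrt (y r)" "p b = 0 \<Longrightarrow> y b \<le> \<rho> * y r"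
proof -
  define q where "q = y r"
  have q: "0 < q" using r by (simp add: q_def)
  have r0: "0 \<le> r" using r S by auto
  have m: "m t = q" if "r < t" "t < b" for t
    unfolding q_def using m_eq[OF r(1), of t] gap that by auto
  \<comment> \<open>The phase starts at the stored value \<open>q\<close>, so \<open>y\<close> is
    above \<open>m / 2 = q / 2\<close> for a while and the fall begins.\<close>
  obtain \<delta> where \<delta>: "0 < \<delta>" "\<And>t. 0 \<le> t \<Longrightarrow> \<bar>t - r\<bar> \<le> \<delta> \<Longrightarrow> q / 2 < y t \<and> y t < q + 1"
    using near[OF continuous_y r0, of "q / 2" "q + 1"] q by (auto simp: q_def)
  have anti: "strict_antimono_on {r..b} y"
    by (rule decreasing_gap[OF r0 r(2) r(4) gap, of "min b (r + \<delta>)"]) (use r0 \<delta> m r(4) in auto)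
  have dec: "y t < y s" if "r \<le> s" "s < t" "t \<le> b" for s t
    using monotone_onD[OF anti, of s t] that by auto
  have k: "0 < \<kappa>" "0 < \<kappa>'" "0 < K" using gains by auto
  \<comment> \<open>The fall covers \<open>\<kappa> * (c - r)\<^sup>2 / 2\<close>, and only
    \<open>q / 2\<close> is available. The velocity bound also excludes \<open>p b = 0\<close> as
    long as \<open>y b\<close> is at least \<open>q / 2\<close>.\<close>
  have first: "p c \<le> - \<kappa> * (c - r) \<and> c - r \<le> sqrt q / sqrt \<kappa>" if c: "r < c" "c \<le> b" "q / 2 \<le> y c" for c
  proof -
    have up: "q / 2 < y t" if "r < t" "t < c" for t using dec[of t c] that c by simp
    have pt: "p t \<le> - \<kappa> * (t - r)" if "r < t" "t \<le> c" for t
      using above[OF r0, of t] that up m c r by auto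
    have "y c \<le> q + 0 * (c - r) + - \<kappa> * (c - r)\<^sup>2 / 2"
      unfolding q_def by (rule upper_parabola) (use pt r0 c in auto)
    then have "\<kappa> * (c - r)\<^sup>2 \<le> q" using c by simp
    then have "(c - r)\<^sup>2 \<le> q / \<kappa>" using k by (simp add: field_simps)
    then have "c - r \<le> sqrt (q / \<kappa>)" by (rule real_le_rsqrt)
    then show ?thesis using pt[of c] c by (simp add: real_sqrt_divide)
  qed
  have "- \<rho> * q \<le> y b \<and> b - r \<le> C * sqrt q \<and> (p b = 0 \<longrightarrow> y b \<le> \<rho> * q)"
  proof (cases "q / 2 \<le> y b")
    case True
    note f = first[OF r(4) order_refl True]
    have "- \<rho> * q \<le> 0" using \<rho> q by simp
    moreover have "b - r \<le> C * sqrt q"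
    proof -
      have "sqrt q / sqrt \<kappa> \<le> C * sqrt q" using q k by (simp add: C_def distrib_right)
      then show ?thesis using f by linarith
    qed
    moreover have "p b < 0"
    proof -
      have "0 < \<kappa> * (b - r)" using k r(4) by simp
      then show ?thesis using f by linarith
    qed
    ultimately show ?thesis using True q by auto
  next
    case False
    have "continuous_on {r..b} y" using continuous_y by (rule continuous_on_subset) (use r0 in auto)
    then obtain c where c: "r \<le> c" "c \<le> b" "y c = q / 2"
      using IVT2'[of y b "q / 2" r] False q r(4) by (auto simp: q_def)
    then have c': "r < c" "c < b" using False q by (auto simp: q_def le_less)
    note f = first[OF c'(1) c(2)]
    define v where "v = - p c"
    have "0 < \<kappa> * (c - r)" using k c' by simp
    then have v: "0 < v" using f c unfolding v_def by linarith
    have pc: "- K * (c - t) \<le> p c - p t" if "r \<le> t" "t \<le> c" for t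
    proof (rule slow_pos)
      fix s assume s: "t < s" "s < c"
      then show "0 < m s \<and> m s / 2 < y s \<and> y s < m s"
        using m[of s] dec[of s c] dec[of r s] that c c' q by (simp add: q_def)
    qed (use that r0 in auto)
    \<comment> \<open>Followed backwards from \<open>c\<close>, the speed \<open>v\<close> decreases
      by at most \<open>K\<close> per unit of time, so the fall lasted at least \<open>d\<close>.
      The distance \<open>K * d\<^sup>2 / 2 = v\<^sup>2 / (2 * K)\<close> covered meanwhile cannot
      exceed \<open>q / 2\<close>.\<close>
    define d where "d = v / K"
    have d: "0 < d" "K * d = v" using v k by (auto simp: d_def)
    have "K * d \<le> K * (c - r)" using pc[of r] c' r(2) d by (simp add: v_def)
    then have dr: "r \<le> c - d" using k by simp
    have "y c \<le> y (c - d) + 0 * (c - (c - d)) + - K * (c - (c - d))\<^sup>2 / 2"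
    proof (rule upper_parabola)
      fix t assume t: "c - d < t" "t < c"
      show "p t \<le> 0 + - K * (t - (c - d))"
        using pc[of t] t dr d by (simp add: v_def algebra_simps)
    qed (use dr d r0 in auto)
    moreover have "y (c - d) \<le> q" using dec[of r "c - d"] dr d c' by (cases "r = c - d") (auto simp: q_def)
    ultimately have "K * d\<^sup>2 \<le> q" using c by simp
    then have "(K * d)\<^sup>2 \<le> K * q" using k by (simp add: power2_eq_square mult_ac)
    then have v2: "v\<^sup>2 \<le> K * q" using d by simp
    have pt: "- v + \<kappa>' * (t - c) \<le> p t" if "c < t" "t \<le> b" for t
    proof -
      have "\<kappa>' * (t - c) \<le> p t - p c"
      proof (rule fast_pos)
        fix s assume s: "c < s" "s < t"
        then show "0 < m s \<and> y s < m s / 2"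
          using m[of s] dec[of c s] that c c' q by simp
      qed (use that c' r0 in auto)
      then show ?thesis by (simp add: v_def)
    qed
    have "y c + - v * (b - c) + \<kappa>' * (b - c)\<^sup>2 / 2 \<le> y b"
      by (rule lower_parabola) (use pt c' r0 in auto)
    \<comment> \<open>Completing the square gives the braking distance.\<close>
    moreover have "- (v\<^sup>2 / (2 * \<kappa>')) \<le> - v * (b - c) + \<kappa>' * (b - c)\<^sup>2 / 2"
    proof -
      have "0 \<le> (v - \<kappa>' * (b - c))\<^sup>2 / (2 * \<kappa>')" using k by simp
      also have "\<dots> = v\<^sup>2 / (2 * \<kappa>') - v * (b - c) + \<kappa>' * (b - c)\<^sup>2 / 2"
        using k by (simp add: field_simps power2_eq_square)
      finally show ?thesis by simp
    qed
    moreover have "v\<^sup>2 / (2 * \<kappa>') \<le> K * q / (2 * \<kappa>')" using v2 k by (intro divide_right_mono) auto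
    moreover have "q / 2 - K * q / (2 * \<kappa>') = - ((K / \<kappa>' - 1) / 2) * q" using k by (simp add: field_simps)
    moreover have "(K / \<kappa>' - 1) / 2 * q \<le> \<rho> * q" using q by (intro mult_right_mono) (auto simp: \<rho>_def)
    ultimately have low: "- \<rho> * q \<le> y b" using c by linarith
    \<comment> \<open>Up to \<open>b\<close> the motion has not been reversed, which bounds the
      braking time.\<close>
    have "- v + \<kappa>' * (b - c) \<le> 0"
      using pt[of b] c' p_le_0[OF anti r0 r(4)] by simp
    then have "b - c \<le> v / \<kappa>'" using k by (simp add: field_simps)
    also have "v / \<kappa>' \<le> sqrt (K * q) / \<kappa>'" using v2 k by (intro divide_right_mono real_le_rsqrt) auto
    finally have "b - r \<le> sqrt q / sqrt \<kappa> + sqrt (K * q) / \<kappa>'" using f c by simp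
    also have "\<dots> = C * sqrt q" by (simp add: C_def real_sqrt_mult distrib_right)
    finally have "b - r \<le> C * sqrt q" .
    moreover have "1 / 2 * q \<le> \<rho> * q" using \<rho> q by (intro mult_right_mono) auto
    ultimately show ?thesis using low False by auto
  qed
  then show "- \<rho> * y r \<le> y b" "b - r \<le> C * sqrt (y r)" "p b = 0 \<Longrightarrow> y b \<le> \<rho> * y r"
    by (auto simp: q_def)
  show "y b < y r" using dec[of r b] r by simp
qed

text \<open>No gap can follow an update at rest with value 0: \<open>y\<close> would leave 0
  monotonically, whereas the acceleration points back to \<open>m / 2 = 0\<close>. For
  \<open>y r < 0\<close> the reflected system is used.\<close>

lemma phase:
  assumes r: "r \<in> S" "p r = 0" "r < b" and gap: "\<And>s. r < s \<Longrightarrow> s < b \<Longrightarrow> s \<notin> S"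
  shows "y r \<noteq> 0" "\<bar>y b\<bar> \<le> \<bar>y r\<bar>" "b - r \<le> C * sqrt \<bar>y r\<bar>" "p b = 0 \<Longrightarrow> \<bar>y b\<bar> \<le> \<rho> * \<bar>y r\<bar>"
proof -
  interpret neg: suboptimal \<kappa> \<kappa>' K "\<lambda>t. - y t" "\<lambda>t. - p t" "\<lambda>t. - m t" S by (rule uminus)
  have r0: "0 \<le> r" using r S by auto
  have m: "m t = y r" if "r < t" "t < b" for t
    using m_eq[OF r(1), of t] gap that by auto
  have nz: "y r \<noteq> 0"
  proof
    assume y0: "y r = 0"
    from monotone_gap[OF r0 gap] show False
    proof
      assume mono: "strict_mono_on {r..b} y"
      have "\<not> strict_mono_on {r..b} y"
      proof -
        have "strict_antimono_on {r..b} y"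
          using monotone_onD[OF mono, of r] y0 m
          by (intro decreasing_gap[OF r0 r(2) r(3) gap r(3)]) auto
        from monotone_onD[OF this, of r b] monotone_onD[OF mono, of r b] show ?thesis using r(3) by auto
      qed
      then show False using mono by simp
    next
      assume anti: "strict_antimono_on {r..b} y"
      have "strict_antimono_on {r..b} (\<lambda>t. - y t)"
        using monotone_onD[OF anti, of r] y0 m r
        by (intro neg.decreasing_gap[OF r0 _ r(3) gap r(3)]) auto
      from monotone_onD[OF this, of r b] monotone_onD[OF anti, of r b] show False using r(3) by auto
    qed
  qed
  have "\<bar>y b\<bar> \<le> \<bar>y r\<bar> \<and> b - r \<le> C * sqrt \<bar>y r\<bar> \<and> (p b = 0 \<longrightarrow> \<bar>y b\<bar> \<le> \<rho> * \<bar>y r\<bar>)"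
  proof (cases "0 < y r")
    case True
    have ph: "y b < y r" "- \<rho> * y r \<le> y b" "b - r \<le> C * sqrt (y r)" "p b = 0 \<longrightarrow> y b \<le> \<rho> * y r"
      using phase_pos[OF r(1,2) True r(3)] gap by blast+
    have "\<rho> * y r \<le> 1 * y r" using \<rho> True by (intro mult_right_mono) auto
    then have "\<bar>y b\<bar> \<le> y r" using ph(1,2) by linarith
    moreover have "\<bar>y b\<bar> \<le> \<rho> * y r" if "p b = 0" using ph(2,4) that by linarith
    ultimately show ?thesis using ph(3) True by simp
  next
    case False
    then have n: "0 < - y r" using nz by simp
    have "- p r = 0" using r by simp
    have ph: "- y b < - y r" "- \<rho> * - y r \<le> - y b" "b - r \<le> C * sqrt (- y r)"
      "- p b = 0 \<longrightarrow> - y b \<le> \<rho> * - y r"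
      using neg.phase_pos[OF r(1) \<open>- p r = 0\<close> n r(3)] gap by blast+
    have "\<rho> * - y r \<le> 1 * - y r" using \<rho> n by (intro mult_right_mono) auto
    then have "\<bar>y b\<bar> \<le> - y r" using ph(1,2) by linarith
    moreover have "\<bar>y b\<bar> \<le> \<rho> * - y r" if "p b = 0"
    proof -
      have "- p b = 0" using that by simp
      then show ?thesis using ph(2) ph(4) by linarith
    qed
    ultimately show ?thesis using ph(3) n by simp
  qed
  then show "y r \<noteq> 0" "\<bar>y b\<bar> \<le> \<bar>y r\<bar>" "b - r \<le> C * sqrt \<bar>y r\<bar>" "p b = 0 \<Longrightarrow> \<bar>y b\<bar> \<le> \<rho> * \<bar>y r\<bar>"
    using nz by auto
qed

text \<open>\<open>S\<close> need not contain the limits of its points from the right. Such a limit also counts as a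
  rest point, but \<open>step\<close> shows that this only happens where \<open>y\<close> vanishes.\<close>

definition rest :: "real \<Rightarrow> bool" where
  "rest r \<longleftrightarrow> 0 \<le> r \<and> p r = 0 \<and> (\<forall>b>r. \<exists>s\<in>S. r \<le> s \<and> s \<le> b)"

section \<open>Chains of phases\<close>

lemma rest_S: "s \<in> S \<Longrightarrow> p s = 0 \<Longrightarrow> rest s"
  using S by (auto simp: rest_def)

text \<open>Initialization puts 0 into \<open>S\<close> although the velocity there may be nonzero.
  A rest point shields later times from this: the update governing them is one with
  \<open>p s = 0\<close>.\<close>

lemma last_S_rest:
  assumes "rest r" "r < t"
  obtains s where "s \<in> S" "r \<le> s" "s \<le> t" "\<And>q. q \<in> S \<Longrightarrow> q \<le> t \<Longrightarrow> q \<le> s" "m t = y s" "p s = 0"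
proof -
  have "0 \<le> t" using assms by (auto simp: rest_def)
  from last_S[OF this] obtain s where s: "s \<in> S" "s \<le> t" "\<forall>r\<in>S. r \<le> t \<longrightarrow> r \<le> s" "m t = y s" by blast
  obtain s' where "s' \<in> S" "r \<le> s'" "s' \<le> t" using assms by (auto simp: rest_def)
  then have rs: "r \<le> s" using s by force
  have "p s = 0" using p_S[OF s(1)] assms rs by (cases "s = r") (auto simp: rest_def)
  then show thesis using that s rs by blast
qed

lemma rest_limit:
  assumes "0 < b" "\<And>c. b < c \<Longrightarrow> \<exists>s\<in>S. b \<le> s \<and> s \<le> c"
  shows "rest b"
proof -
  have "p b = 0"
  proof (rule ccontr)
    assume "p b \<noteq> 0"
    then have "0 < \<bar>p b\<bar>" by simp
    have "continuous_on {0..} (\<lambda>t. \<bar>p t\<bar>)" by (intro continuous_intros continuous_p)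
    then obtain \<delta> where \<delta>: "0 < \<delta>" "\<And>t. 0 \<le> t \<Longrightarrow> \<bar>t - b\<bar> \<le> \<delta> \<Longrightarrow> 0 < \<bar>p t\<bar> \<and> \<bar>p t\<bar> < \<bar>p b\<bar> + 1"
      by (rule near[of _ b 0 "\<bar>p b\<bar> + 1"]) (use assms \<open>0 < \<bar>p b\<bar>\<close> in auto)
    obtain s where "s \<in> S" "b \<le> s" "s \<le> b + \<delta>" using assms(2)[of "b + \<delta>"] \<delta> by auto
    then show False using \<delta>(2)[of s] p_S[of s] assms by auto
  qed
  then show ?thesis using assms by (auto simp: rest_def)
qed

text \<open>A value stored after \<open>r\<close> is a value of \<open>y\<close> near
  \<open>r\<close>, so by the choice of 2 / 3 and 4 / 3 half of it is below every nearby value of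
  \<open>y\<close>. Hence \<open>p\<close> becomes negative at once, which excludes updates.\<close>

lemma not_S_after_rest_pos:
  assumes r: "rest r" and pos: "0 < y r"
  shows "\<exists>\<delta>>0. \<forall>s. r < s \<and> s \<le> r + \<delta> \<longrightarrow> s \<notin> S"
proof -
  have r0: "0 \<le> r" "p r = 0" using r by (auto simp: rest_def)
  obtain \<delta> where \<delta>: "0 < \<delta>"
    "\<And>t. 0 \<le> t \<Longrightarrow> \<bar>t - r\<bar> \<le> \<delta> \<Longrightarrow> 2 / 3 * y r < y t \<and> y t < 4 / 3 * y r"
    using near[OF continuous_y r0(1), of "2 / 3 * y r" "4 / 3 * y r"] pos by auto
  have "m t / 2 < y t" if t: "r < t" "t \<le> r + \<delta>" for t
  proof -
    from last_S_rest[OF r t(1)] obtain s where s: "r \<le> s" "s \<le> t" "m t = y s" by blast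
    have "y s < 4 / 3 * y r" "2 / 3 * y r < y t" using \<delta>(2)[of s] \<delta>(2)[of t] s t r0 by auto
    then show ?thesis using s by simp
  qed
  then have "p t \<le> - \<kappa> * (t - r)" if t: "r < t" "t \<le> r + \<delta>" for t
    using above[OF r0(1), of t] r0 t by auto
  then have "t \<notin> S" if t: "r < t" "t \<le> r + \<delta>" for t
  proof -
    have "0 < \<kappa> * (t - r)" using gains t by simp
    then have "p t < 0" using \<open>\<And>t. r < t \<Longrightarrow> t \<le> r + \<delta> \<Longrightarrow> p t \<le> - \<kappa> * (t - r)\<close>[OF t] by linarith
    then show ?thesis using p_S[of t] t r0 by auto
  qed
  then show ?thesis using \<delta>(1) by blast
qed

lemma not_S_after_rest:
  assumes r: "rest r" and nz: "y r \<noteq> 0"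
  shows "\<exists>\<delta>>0. \<forall>s. r < s \<and> s \<le> r + \<delta> \<longrightarrow> s \<notin> S"
proof (cases "0 < y r")
  case True
  then show ?thesis using not_S_after_rest_pos[OF r] by simp
next
  case False
  interpret neg: suboptimal \<kappa> \<kappa>' K "\<lambda>t. - y t" "\<lambda>t. - p t" "\<lambda>t. - m t" S by (rule uminus)
  have "neg.rest r" using r by (simp add: rest_def neg.rest_def)
  then show ?thesis using neg.not_S_after_rest_pos[of r] False nz by simp
qed

text \<open>The next rest point is the infimum of the later updates. These exist because a gap has
  bounded length, and they keep a distance from \<open>r\<close>. That the infimum itself belongs to
  \<open>S\<close> is not known at this stage, which is why \<open>rest\<close> admits
  limits.\<close>

lemma step:
  assumes r: "rest r" and nz: "y r \<noteq> 0"
  obtains b where "r \<in> S" "r < b" "rest b" "\<And>s. r < s \<Longrightarrow> s < b \<Longrightarrow> s \<notin> S"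
    "\<bar>y b\<bar> \<le> \<rho> * \<bar>y r\<bar>" "b - r \<le> C * sqrt \<bar>y r\<bar>"
proof -
  have r0: "0 \<le> r" "p r = 0" using r by (auto simp: rest_def)
  obtain \<delta> where \<delta>: "0 < \<delta>" "\<And>s. r < s \<Longrightarrow> s \<le> r + \<delta> \<Longrightarrow> s \<notin> S"
    using not_S_after_rest[OF r nz] by blast
  have rS: "r \<in> S"
  proof -
    obtain s where "s \<in> S" "r \<le> s" "s \<le> r + \<delta>" using r \<delta>(1) by (auto simp: rest_def dest!: spec[of _ "r + \<delta>"])
    then show ?thesis using \<delta>(2)[of s] by (cases "s = r") auto
  qed
  define A where "A = S \<inter> {r<..}"
  have "A \<noteq> {}"
  proof
    assume "A = {}"
    then have "\<And>s. r < s \<Longrightarrow> s \<notin> S" by (auto simp: A_def)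
    moreover have "0 \<le> C * sqrt \<bar>y r\<bar>" using C_pos by (intro mult_nonneg_nonneg) auto
    ultimately show False using phase(3)[OF rS r0(2), of "r + C * sqrt \<bar>y r\<bar> + 1"] by auto
  qed
  have A: "r + \<delta> \<le> s" if "s \<in> A" for s using \<delta>(2)[of s] that by (force simp: A_def)
  have bdd: "bdd_below A" using A by (auto simp: bdd_below_def)
  define b where "b = Inf A"
  have "r + \<delta> \<le> b" unfolding b_def using A \<open>A \<noteq> {}\<close> by (intro cInf_greatest) auto
  then have rb: "r < b" using \<delta>(1) by simp
  have gap: "s \<notin> S" if "r < s" "s < b" for s
  proof
    assume "s \<in> S"
    then have "b \<le> s" unfolding b_def using bdd that by (intro cInf_lower) (auto simp: A_def)
    then show False using that by simp
  qed
  have "rest b"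
  proof (rule rest_limit)
    fix c assume "b < c"
    then obtain s where s: "s \<in> A" "s < c" unfolding b_def using cInf_less_iff[OF \<open>A \<noteq> {}\<close> bdd] by blast
    then have "b \<le> s" unfolding b_def using bdd by (intro cInf_lower)
    then show "\<exists>s\<in>S. b \<le> s \<and> s \<le> c" using s by (auto simp: A_def)
  qed (use rb r0 in simp)
  then have "p b = 0" by (simp add: rest_def)
  have "\<bar>y b\<bar> \<le> \<rho> * \<bar>y r\<bar>" "b - r \<le> C * sqrt \<bar>y r\<bar>"
    using phase(3,4)[OF rS r0(2) rb] gap \<open>p b = 0\<close> by blast+
  then show thesis using that rS rb \<open>rest b\<close> gap by blast
qed

lemma gap_le:
  assumes r: "r \<in> S" "p r = 0" "r \<le> b" and gap: "\<And>s. r < s \<Longrightarrow> s < b \<Longrightarrow> s \<notin> S"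
  shows "\<bar>y b\<bar> \<le> \<bar>y r\<bar>"
  using phase(2)[OF r(1,2) _ gap] r(3) by (cases "r = b") auto

text \<open>The first instant \<open>c\<close> at which \<open>\<bar>y\<bar>\<close> is maximal must be an update instant, and then the
  contraction of the step ending at \<open>c\<close> contradicts continuity.\<close>

lemma zero_kept:
  assumes r: "rest r" and y0: "y r = 0" and rt: "r \<le> t"
  shows "y t = 0"
proof (rule ccontr)
  assume nz: "y t \<noteq> 0"
  have r0: "0 \<le> r" "p r = 0" using r by (auto simp: rest_def)
  have cont: "continuous_on {r..t} (\<lambda>t. \<bar>y t\<bar>)"
    by (intro continuous_intros continuous_on_subset[OF continuous_y]) (use r0 in auto)
  obtain c0 where c0: "c0 \<in> {r..t}" "\<And>s. s \<in> {r..t} \<Longrightarrow> \<bar>y s\<bar> \<le> \<bar>y c0\<bar>"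
    using continuous_attains_sup[OF _ _ cont] rt by auto
  define A where "A = \<bar>y c0\<bar>"
  have A: "0 < A" using c0(2)[of t] nz rt unfolding A_def by simp
  let ?M = "{r..t} \<inter> (\<lambda>t. \<bar>y t\<bar>) -` {A}"
  have "closed ?M" by (rule continuous_closed_preimage[OF cont]) auto
  moreover have "bounded ?M" by (rule bounded_subset[of "{r..t}"]) auto
  moreover have "c0 \<in> ?M" using c0 by (simp add: A_def)
  ultimately obtain c where c: "c \<in> ?M" "\<And>s. s \<in> ?M \<Longrightarrow> c \<le> s"
    using compact_attains_inf[of ?M] compact_eq_bounded_closed[of ?M] by blast
  have yc: "\<bar>y c\<bar> = A" "r \<le> c" "c \<le> t" using c(1) by auto
  have rc: "r < c" using yc A y0 by (cases "r = c") auto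
  have le: "\<bar>y s\<bar> \<le> A" if "r \<le> s" "s \<le> t" for s using c0(2) that by (simp add: A_def)
  obtain s where s: "s \<in> S" "r \<le> s" "s \<le> c" "\<And>q. q \<in> S \<Longrightarrow> q \<le> c \<Longrightarrow> q \<le> s" "p s = 0"
    using last_S_rest[OF r rc] by metis
  have "A \<le> \<bar>y s\<bar>" unfolding yc(1)[symmetric]
    by (rule gap_le[OF s(1,5,3)]) (use s(4) in force)
  then have "\<bar>y s\<bar> = A" using le[of s] s yc by simp
  then have "s = c" using c(2)[of s] s yc by auto
  then have cS: "c \<in> S" using s by simp
  have "\<rho> * A < A" using A \<rho> by simp
  moreover have "continuous_on {0..} (\<lambda>t. \<bar>y t\<bar>)" by (intro continuous_intros continuous_y)
  ultimately obtain \<delta> where \<delta>: "0 < \<delta>"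
    "\<And>t. 0 \<le> t \<Longrightarrow> \<bar>t - c\<bar> \<le> \<delta> \<Longrightarrow> \<rho> * A < \<bar>y t\<bar> \<and> \<bar>y t\<bar> < A + 1"
    using near[of "\<lambda>t. \<bar>y t\<bar>" c "\<rho> * A" "A + 1"] yc r0 by auto
  \<comment> \<open>\<open>e\<close> lies strictly after \<open>r\<close> and within \<delta> of
    \<open>c\<close>. The step from the last update up to \<open>e\<close> then ends between
    \<open>e\<close> and \<open>c\<close>, where \<open>\<bar>y\<bar>\<close> exceeds
    \<open>\<rho> * A\<close>.\<close>
  define e where "e = max (c - \<delta>) ((r + c) / 2)"
  have e: "r < e" "e < c" "c - \<delta> \<le> e" using rc \<delta>(1) by (simp_all add: e_def less_max_iff_disj)
  obtain s' where s': "s' \<in> S" "r \<le> s'" "s' \<le> e" "\<And>q. q \<in> S \<Longrightarrow> q \<le> e \<Longrightarrow> q \<le> s'" "p s' = 0"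
    using last_S_rest[OF r e(1)] by metis
  have "\<bar>y e\<bar> \<le> \<bar>y s'\<bar>" by (rule gap_le[OF s'(1,5,3)]) (use s'(4) in force)
  moreover have "\<rho> * A < \<bar>y e\<bar>" using \<delta>(2)[of e] e r0 by auto
  moreover have "0 \<le> \<rho> * A" using A \<rho> by simp
  ultimately have "y s' \<noteq> 0" by auto
  from step[OF rest_S[OF s'(1,5)] this] obtain b where b: "s' < b" "rest b"
    "\<And>s. s' < s \<Longrightarrow> s < b \<Longrightarrow> s \<notin> S" "\<bar>y b\<bar> \<le> \<rho> * \<bar>y s'\<bar>" by blast
  have bc: "b \<le> c" using b(3)[of c] cS s' e by force
  have eb: "e \<le> b"
  proof (rule ccontr)
    assume "\<not> e \<le> b"
    then obtain q where "q \<in> S" "b \<le> q" "q \<le> e" using b(2) by (force simp: rest_def)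
    then show False using s'(4)[of q] b(1) by simp
  qed
  have "\<rho> * A < \<bar>y b\<bar>" using \<delta>(2)[of b] bc eb e r0 by auto
  moreover have "\<rho> * \<bar>y s'\<bar> \<le> \<rho> * A" using le[of s'] s' e yc \<rho> by (intro mult_left_mono) auto
  ultimately show False using b(4) by simp
qed

text \<open>Without updates the stored value is frozen, while an acceleration of at most
  \<open>- \<kappa>\<close> forever pushes \<open>y\<close> below every bound.\<close>

lemma not_eventually_above:
  assumes "0 \<le> a" "\<And>t. a < t \<Longrightarrow> t \<notin> S"
  shows "\<not> (\<forall>t>a. m t / 2 < y t)"
proof
  assume ab: "\<forall>t>a. m t / 2 < y t"
  have m: "m t = m a" if "a \<le> t" for t
  proof -
    from last_S[OF assms(1)] obtain s where s: "s \<in> S" "s \<le> a" "\<forall>r\<in>S. r \<le> a \<longrightarrow> r \<le> s" "m a = y s" by blast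
    have "m t = y s"
    proof (rule m_eq[OF s(1)])
      fix q assume "s < q" "q \<le> t"
      then show "q \<notin> S" using s(3) assms(2)[of q] by (cases "q \<le> a") auto
    qed (use s that in simp)
    then show ?thesis using s by simp
  qed
  have "p t \<le> p a - \<kappa> * (t - a)" if "a \<le> t" for t
    using above[OF assms(1) that] ab by auto
  then have "p t \<le> -1" if "a + 1 + (\<bar>p a\<bar> + 1) / \<kappa> \<le> t" for t
  proof -
    have "0 \<le> (\<bar>p a\<bar> + 1) / \<kappa>" using gains by simp
    then have t: "a \<le> t" "(\<bar>p a\<bar> + 1) / \<kappa> \<le> t - a" using that by linarith+
    have "\<bar>p a\<bar> + 1 \<le> \<kappa> * (t - a)" using t(2) gains by (simp add: field_simps)
    then show ?thesis using \<open>\<And>t. a \<le> t \<Longrightarrow> p t \<le> p a - \<kappa> * (t - a)\<close>[OF t(1)] by linarith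
  qed
  moreover have "a + 1 \<le> a + 1 + (\<bar>p a\<bar> + 1) / \<kappa>" using gains by simp
  ultimately have p1: "\<exists>T\<ge>a + 1. \<forall>t\<ge>T. p t \<le> -1" by blast
  have "\<exists>T\<ge>a + 1. \<forall>t\<ge>T. y t - m a / 2 \<le> -1"
  proof (rule eventually_le_minus_one[OF _ p1])
    fix t assume "a + 1 \<le> t"
    then show "((\<lambda>t. y t - m a / 2) has_real_derivative p t) (at t)"
      using assms(1) by (auto intro!: derivative_eq_intros y)
  qed
  then obtain T where "a + 1 \<le> T" "y T - m a / 2 \<le> -1" by blast
  then show False using ab[rule_format, of T] m[of T] by simp
qed

text \<open>Supplies the start of the contraction, which time 0 cannot be when the initial velocity
  is nonzero. Without a later update \<open>y\<close> would be strictly monotone on the whole half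
  line and finally stay on one side of \<open>y 0 / 2\<close>.\<close>

lemma ex_S_pos: "\<exists>s\<in>S. 0 < s"
proof (rule ccontr)
  assume "\<not> ?thesis"
  then have none: "t \<notin> S" if "0 < t" for t using that by auto
  interpret neg: suboptimal \<kappa> \<kappa>' K "\<lambda>t. - y t" "\<lambda>t. - p t" "\<lambda>t. - m t" S by (rule uminus)
  have m: "m t = y 0" if "0 \<le> t" for t using m_eq[OF S(1) that] none by auto
  have one_side: False
    if a: "0 \<le> a" and side: "(\<forall>t>a. y 0 / 2 < y t) \<or> (\<forall>t>a. y t < y 0 / 2)" for a
    using side
  proof
    assume "\<forall>t>a. y 0 / 2 < y t"
    then have "\<forall>t>a. m t / 2 < y t" using m a by simp
    then show False using not_eventually_above[OF a] none a by auto
  next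
    assume "\<forall>t>a. y t < y 0 / 2"
    then have "\<forall>t>a. - m t / 2 < - y t" using m a by simp
    then show False using neg.not_eventually_above[OF a] none a by auto
  qed
  have sided: False
    if mono: "(\<forall>s t. 0 \<le> s \<and> s < t \<longrightarrow> y s < y t) \<or> (\<forall>s t. 0 \<le> s \<and> s < t \<longrightarrow> y t < y s)"
    using mono
  proof
    assume inc: "\<forall>s t. 0 \<le> s \<and> s < t \<longrightarrow> y s < y t"
    show False
    proof (cases "\<exists>a\<ge>0. y 0 / 2 \<le> y a")
      case True
      then obtain a where a: "0 \<le> a" "y 0 / 2 \<le> y a" by blast
      then have "\<forall>t>a. y 0 / 2 < y t" using inc by (meson le_less_trans)
      then show False using one_side[OF a(1)] by blast
    next
      case False
      then have "\<forall>t>0. y t < y 0 / 2" by (meson not_le less_imp_le)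
      then show False using one_side[of 0] by blast
    qed
  next
    assume dec: "\<forall>s t. 0 \<le> s \<and> s < t \<longrightarrow> y t < y s"
    show False
    proof (cases "\<exists>a\<ge>0. y a \<le> y 0 / 2")
      case True
      then obtain a where a: "0 \<le> a" "y a \<le> y 0 / 2" by blast
      then have "\<forall>t>a. y t < y 0 / 2" using dec by (meson less_le_trans)
      then show False using one_side[OF a(1)] by blast
    next
      case False
      then have "\<forall>t>0. y 0 / 2 < y t" by (meson not_le less_imp_le)
      then show False using one_side[of 0] by blast
    qed
  qed
  have mono: "strict_mono_on {0..b} y \<or> strict_antimono_on {0..b} y" for b
    using monotone_gap[of 0 b] none by simp
  show False
  proof (rule sided, cases "y 0 < y 1")
    case True
    \<comment> \<open>The interval up to \<open>1 + t\<close> contains 0, 1 and \<open>t\<close>, so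
      comparing \<open>y 0\<close> with \<open>y 1\<close> fixes one direction for all
      intervals.\<close>
    have "y s < y t" if "0 \<le> s" "s < t" for s t
      using mono[of "1 + t"]
    proof
      assume "strict_mono_on {0..1 + t} y"
      moreover have "0 \<le> t" using that by simp
      ultimately show ?thesis using monotone_onD[of "{0..1 + t}" _ _ y s t] that by fastforce
    next
      assume "strict_antimono_on {0..1 + t} y"
      moreover have "0 \<le> t" using that by simp
      ultimately show ?thesis using monotone_onD[of "{0..1 + t}" _ _ y 0 1] True by fastforce
    qed
    then show "(\<forall>s t. 0 \<le> s \<and> s < t \<longrightarrow> y s < y t) \<or> (\<forall>s t. 0 \<le> s \<and> s < t \<longrightarrow> y t < y s)" by blast
  next
    case False
    have "y t < y s" if "0 \<le> s" "s < t" for s t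
      using mono[of "1 + t"]
    proof
      assume "strict_antimono_on {0..1 + t} y"
      moreover have "0 \<le> t" using that by simp
      ultimately show ?thesis using monotone_onD[of "{0..1 + t}" _ _ y s t] that by fastforce
    next
      assume "strict_mono_on {0..1 + t} y"
      moreover have "0 \<le> t" using that by simp
      ultimately show ?thesis using monotone_onD[of "{0..1 + t}" _ _ y 0 1] False by fastforce
    qed
    then show "(\<forall>s t. 0 \<le> s \<and> s < t \<longrightarrow> y s < y t) \<or> (\<forall>s t. 0 \<le> s \<and> s < t \<longrightarrow> y t < y s)" by blast
  qed
qed

theorem finite_time_convergence: "\<exists>T\<ge>0. \<forall>t\<ge>T. y t = 0"
proof -
  obtain r0 where r0: "r0 \<in> S" "0 < r0" using ex_S_pos by blast
  \<comment> \<open>\<open>D\<close> sums the geometric series: phase durations are at most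
    \<open>C\<close> times the root of the modulus, which shrinks by \<open>sqrt \<rho>\<close> per
    step. So \<open>D * sqrt \<bar>y t\<bar>\<close> bounds the time still to come, and
    \<open>f\<close> does not increase along a step.\<close>
  define D where "D = C / (1 - sqrt \<rho>)"
  have sr: "0 < sqrt \<rho>" "sqrt \<rho> < 1" using \<rho> by (auto simp: real_sqrt_lt_1_iff)
  have D: "0 < D" "D * (1 - sqrt \<rho>) = C" using C_pos sr by (auto simp: D_def)
  define f where "f t = t + D * sqrt \<bar>y t\<bar>" for t
  have cf: "continuous_on {0..} f" unfolding f_def by (intro continuous_intros continuous_y)
  \<comment> \<open>Even if steps accumulate, the latest point \<open>z\<close> of \<open>X\<close>
    exists; were \<open>y z\<close> nonzero, a further step would stay in \<open>X\<close>.\<close>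
  define X where "X = {r. r0 \<le> r \<and> rest r \<and> f r \<le> f r0}"
  have "rest r0" using r0 p_S rest_S by blast
  then have r0X: "r0 \<in> X" by (simp add: X_def)
  have ub: "r \<le> f r0" if "r \<in> X" for r
  proof -
    have "0 \<le> D * sqrt \<bar>y r\<bar>" using D by (intro mult_nonneg_nonneg) auto
    then show ?thesis using that by (simp add: X_def f_def)
  qed
  then have bdd: "bdd_above X" by (rule bdd_aboveI)
  define z where "z = Sup X"
  have up: "r \<le> z" if "r \<in> X" for r unfolding z_def using bdd that by (intro cSup_upper)
  have "z \<in> X"
  proof (rule ccontr)
    assume nX: "z \<notin> X"
    have ap: "\<exists>x\<in>X. c < x \<and> x < z" if "c < z" for c
    proof -
      have "X \<noteq> {}" using r0X by auto
      moreover have "c < Sup X" using that by (simp add: z_def)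
      ultimately have "\<exists>x\<in>X. c < x" by (rule less_cSupD)
      then obtain x where x: "x \<in> X" "c < x" ..
      moreover have "x \<noteq> z" using x nX by auto
      ultimately show ?thesis using up[OF x(1)] by (intro bexI[of _ x]) auto
    qed
    have z0: "0 < z" "r0 \<le> z" using up[OF r0X] r0 by auto
    from last_S[of z] z0(1) obtain s where s: "s \<in> S" "s \<le> z" "\<forall>r\<in>S. r \<le> z \<longrightarrow> r \<le> s" by auto
    \<comment> \<open>Points of \<open>X\<close> accumulate at \<open>z\<close> from the left, and
      each has an update between itself and \<open>z\<close>.\<close>
    have "\<not> s < z"
    proof
      assume "s < z"
      then obtain x where x: "x \<in> X" "s < x" "x < z" using ap by blast
      then obtain q where "q \<in> S" "x \<le> q" "q \<le> z" by (auto simp: X_def rest_def)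
      then show False using s(3) x by fastforce
    qed
    then have "s = z" using s by simp
    then have "rest z" using s(1) p_S[of z] z0 rest_S[of z] by simp
    moreover have "f z \<le> f r0"
    proof (rule ccontr)
      assume "\<not> f z \<le> f r0"
      then obtain \<delta> where \<delta>: "0 < \<delta>" "\<And>t. 0 \<le> t \<Longrightarrow> \<bar>t - z\<bar> \<le> \<delta> \<Longrightarrow> f r0 < f t \<and> f t < f z + 1"
        using near[OF cf, of z "f r0" "f z + 1"] z0 by auto
      obtain x where "x \<in> X" "z - \<delta> < x" "x < z" using ap[of "z - \<delta>"] \<delta> by auto
      then show False using \<delta>(2)[of x] r0 by (auto simp: X_def)
    qed
    ultimately show False using nX z0 by (simp add: X_def)
  qed
  then have z: "r0 \<le> z" "rest z" "f z \<le> f r0" by (auto simp: X_def)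
  have "y z = 0"
  proof (rule ccontr)
    assume "y z \<noteq> 0"
    from step[OF z(2) this] obtain b where b: "z < b" "rest b" "\<bar>y b\<bar> \<le> \<rho> * \<bar>y z\<bar>"
      "b - z \<le> C * sqrt \<bar>y z\<bar>" by blast
    have "sqrt \<bar>y b\<bar> \<le> sqrt \<rho> * sqrt \<bar>y z\<bar>"
      using real_sqrt_le_mono[OF b(3)] by (simp add: real_sqrt_mult)
    then have "D * sqrt \<bar>y b\<bar> \<le> D * (sqrt \<rho> * sqrt \<bar>y z\<bar>)" using D by (intro mult_left_mono) auto
    moreover have "C * sqrt \<bar>y z\<bar> = D * sqrt \<bar>y z\<bar> - D * (sqrt \<rho> * sqrt \<bar>y z\<bar>)"
      by (subst D(2)[symmetric]) (simp add: algebra_simps)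
    ultimately have "f b \<le> f z" using b(4) by (simp add: f_def)
    then have "b \<in> X" using b z by (simp add: X_def)
    then show False using up[of b] b by simp
  qed
  then show ?thesis using zero_kept[OF z(2)] z r0 by (intro exI[of _ z]) auto
qed

end

section \<open>Filippov solutions\<close>

text \<open>The preimage of \<open>C\<close> under \<open>h\<close> is closed and convex, so it
  contains the closed convex hull of the essential values.\<close>

lemma filippov_in_closed_convex:
  assumes q: "q \<in> filippov f x" and h: "bounded_linear h" and C: "closed C" "convex C"
    and "0 < \<delta>" "negligible N" and fC: "\<And>z. z \<in> ball x \<delta> \<Longrightarrow> z \<notin> N \<Longrightarrow> h (f z) \<in> C"
  shows "h q \<in> C"
proof -
  have "q \<in> closure (convex hull (f ` (ball x \<delta> - N)))"
    using q assms(5,6) unfolding filippov_def by blast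
  moreover have "closure (convex hull (f ` (ball x \<delta> - N))) \<subseteq> h -` C"
  proof (intro closure_minimal hull_minimal)
    show "f ` (ball x \<delta> - N) \<subseteq> h -` C" using fC by auto
    show "convex (h -` C)" using C(2) h by (intro convex_linear_vimage bounded_linear.linear)
    show "closed (h -` C)"
      using C(1) h by (intro closed_vimage linear_continuous_on[THEN continuous_on_subset]) auto
  qed
  ultimately show ?thesis by auto
qed

text \<open>The bound may depend continuously on the state, so that continuous parts of a field can
  be moved to the other side.\<close>

lemma filippov_le:
  fixes h :: "'a::euclidean_space \<Rightarrow> real"
  assumes q: "q \<in> filippov f x" and h: "bounded_linear h" and w: "isCont w x"
    and \<delta>: "0 < \<delta>" "negligible N" and fw: "\<And>z. z \<in> ball x \<delta> \<Longrightarrow> z \<notin> N \<Longrightarrow> h (f z) \<le> w z"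
  shows "h q \<le> w x"
proof (rule field_le_epsilon)
  fix e :: real assume "0 < e"
  then obtain d where d: "0 < d" "\<And>z. dist z x < d \<Longrightarrow> dist (w z) (w x) < e"
    using w unfolding continuous_at_eps_delta by (metis dist_commute)
  have "h q \<in> {..w x + e}"
  proof (rule filippov_in_closed_convex[OF q h])
    show "0 < min d \<delta>" using d \<delta> by simp
    fix z assume z: "z \<in> ball x (min d \<delta>)" "z \<notin> N"
    then have "h (f z) \<le> w z" using fw by simp
    moreover have "dist (w z) (w x) < e" using d(2)[of z] z by (simp add: dist_commute)
    ultimately show "h (f z) \<in> {..w x + e}" by (auto simp: dist_real_def)
  qed (use \<delta> in auto)
  then show "h q \<le> w x + e" by simp
qed

lemma filippov_ge:
  fixes h :: "'a::euclidean_space \<Rightarrow> real"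
  assumes q: "q \<in> filippov f x" and h: "bounded_linear h" and w: "isCont w x"
    and \<delta>: "0 < \<delta>" "negligible N" and fw: "\<And>z. z \<in> ball x \<delta> \<Longrightarrow> z \<notin> N \<Longrightarrow> w z \<le> h (f z)"
  shows "w x \<le> h q"
proof -
  have "- h q \<le> - w x"
    by (rule filippov_le[OF q bounded_linear_minus[OF h] continuous_minus[OF w] \<delta>]) (use fw in auto)
  then show ?thesis by simp
qed

section \<open>Absolutely continuous functions and their increments\<close>

lemma has_ac_derivativeD:
  assumes "has_ac_derivative x x'" "0 \<le> T"
  shows "x' absolutely_integrable_on {0..T}" "x T = x 0 + integral {0..T} x'"
  using assms unfolding has_ac_derivative_def by blast+

lemma has_ac_derivative_linear:
  assumes "has_ac_derivative x x'" "bounded_linear h"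
  shows "has_ac_derivative (\<lambda>t. h (x t)) (\<lambda>t. h (x' t))"
  unfolding has_ac_derivative_def
proof (intro allI impI conjI)
  fix T :: real assume "0 \<le> T"
  note a = has_ac_derivativeD(1)[OF assms(1) this] and i = has_ac_derivativeD(2)[OF assms(1) this]
  show "(\<lambda>t. h (x' t)) absolutely_integrable_on {0..T}"
    using absolutely_integrable_linear[OF a assms(2)] by (simp add: o_def)
  have "integral {0..T} (\<lambda>t. h (x' t)) = h (integral {0..T} x')"
    using integral_linear[OF absolutely_integrable_on_def[THEN iffD1, THEN conjunct1, OF a] assms(2)]
    by (simp add: o_def)
  then show "h (x T) = h (x 0) + integral {0..T} (\<lambda>t. h (x' t))"
    by (simp only: i linear_add[OF bounded_linear.linear[OF assms(2)]])
qed

lemma has_ac_derivative_add: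
  assumes "has_ac_derivative f f'" "has_ac_derivative g g'"
  shows "has_ac_derivative (\<lambda>t. f t + g t) (\<lambda>t. f' t + g' t)"
  unfolding has_ac_derivative_def
proof (intro allI impI conjI)
  fix T :: real assume "0 \<le> T"
  note a = has_ac_derivativeD(1)[OF assms(1) this] has_ac_derivativeD(1)[OF assms(2) this]
    and i = has_ac_derivativeD(2)[OF assms(1) this] has_ac_derivativeD(2)[OF assms(2) this]
  show "(\<lambda>t. f' t + g' t) absolutely_integrable_on {0..T}" using a by (rule set_integral_add)
  show "f T + g T = f 0 + g 0 + integral {0..T} (\<lambda>t. f' t + g' t)"
  proof -
    have "integral {0..T} (\<lambda>t. f' t + g' t) = integral {0..T} f' + integral {0..T} g'"
      using a by (intro Henstock_Kurzweil_Integration.integral_add) (auto simp: absolutely_integrable_on_def)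
    then show ?thesis unfolding i by simp
  qed
qed

lemma has_ac_derivative_integrable:
  "has_ac_derivative x x' \<Longrightarrow> 0 \<le> a \<Longrightarrow> x' integrable_on {a..b}"
proof (cases "a \<le> b")
  case True
  assume "has_ac_derivative x x'" "0 \<le> a"
  then have "x' integrable_on {0..b}"
    using True has_ac_derivativeD(1)[of x x' b] by (simp add: absolutely_integrable_on_def)
  then show ?thesis by (rule integrable_on_subinterval) (use \<open>0 \<le> a\<close> in auto)
qed (simp add: integrable_on_empty)

lemma has_ac_derivative_diff:
  assumes "has_ac_derivative x x'" "0 \<le> a" "a \<le> b"
  shows "x b - x a = integral {a..b} x'"
proof -
  have "integral {0..a} x' + integral {a..b} x' = integral {0..b} x'"
    by (rule Henstock_Kurzweil_Integration.integral_combine[OF assms(2,3)])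
      (rule has_ac_derivative_integrable[OF assms(1) order_refl])
  then have "integral {a..b} x' = integral {0..b} x' - integral {0..a} x'" by (simp add: eq_diff_eq add.commute)
  moreover have "x b = x 0 + integral {0..b} x'" "x a = x 0 + integral {0..a} x'"
    by (rule has_ac_derivativeD(2)[OF assms(1)], use assms(2,3) in linarith)+
  ultimately show ?thesis by (simp only: add_diff_add diff_self add_0_left add_diff_cancel_left)
qed

lemma has_ac_derivative_le:
  fixes f :: "real \<Rightarrow> real"
  assumes f: "has_ac_derivative f f'" and ab: "0 \<le> a" "a \<le> b"
    and ae: "AE t in lebesgue. a < t \<longrightarrow> t < b \<longrightarrow> f' t \<le> c"
  shows "f b - f a \<le> c * (b - a)"
proof -
  obtain N where N: "negligible N" "{t. \<not> (a < t \<longrightarrow> t < b \<longrightarrow> f' t \<le> c)} \<subseteq> N"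
    using ae unfolding eventually_ae_filter_negligible by blast
  let ?N = "N \<union> {a, b}"
  have i: "(f' has_integral (f b - f a)) {a..b}"
    using has_ac_derivative_integrable[OF f ab(1)] has_ac_derivative_diff[OF f ab]
    by (simp add: has_integral_iff)
  have "((\<lambda>t. if t \<in> ?N then c else f' t) has_integral (f b - f a)) {a..b}"
    by (rule has_integral_spike[OF _ _ i, of ?N]) (use N in auto)
  moreover have "((\<lambda>t. c) has_integral (c * (b - a))) {a..b}"
    using has_integral_const_real[of c a b] ab by (simp add: mult.commute)
  ultimately show ?thesis
    by (rule has_integral_le) (use N in \<open>force simp: less_le\<close>)
qed

lemma has_ac_derivative_ge:
  fixes f :: "real \<Rightarrow> real"
  assumes f: "has_ac_derivative f f'" and ab: "0 \<le> a" "a \<le> b"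
    and ae: "AE t in lebesgue. a < t \<longrightarrow> t < b \<longrightarrow> c \<le> f' t"
  shows "c * (b - a) \<le> f b - f a"
proof -
  have "AE t in lebesgue. a < t \<longrightarrow> t < b \<longrightarrow> - f' t \<le> - c" using ae by eventually_elim auto
  from has_ac_derivative_le[OF has_ac_derivative_linear[OF f bounded_linear_minus[OF bounded_linear_ident]] ab this]
  show ?thesis by simp
qed

lemma has_ac_derivative_continuous:
  assumes "has_ac_derivative x x'"
  shows "continuous_on {0..} x"
  unfolding continuous_on_eq_continuous_within
proof
  fix t :: real assume t: "t \<in> {0..}"
  have "continuous_on {0..t + 1} (\<lambda>t. x 0 + integral {0..t} x')"
    by (intro continuous_intros indefinite_integral_continuous_1 has_ac_derivative_integrable[OF assms]) auto
  then have "continuous_on {0..t + 1} x"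
    by (rule continuous_on_eq) (rule has_ac_derivativeD(2)[OF assms, symmetric], simp)
  then have "continuous (at t within {0..t + 1}) x"
    using t by (simp add: continuous_on_eq_continuous_within)
  moreover have "at t within {0..} = at t within {0..t + 1}"
    by (rule at_within_nhd[of t "{..<t + 1}"]) auto
  ultimately show "continuous (at t within {0..}) x" by simp
qed

text \<open>An almost everywhere derivative that agrees with a continuous function is an ordinary
  one. This makes \<sigma> continuously differentiable, and twice so when the input is absolutely
  continuous.\<close>

lemma has_ac_derivative_vector_derivative:
  assumes x: "has_ac_derivative x x'" and w: "continuous_on {0..} w"
    and ae: "AE t in lebesgue. 0 \<le> t \<longrightarrow> x' t = w t" and t: "0 < t"
  shows "(x has_vector_derivative w t) (at t)"
proof -
  obtain N where N: "negligible N" "{t. \<not> (0 \<le> t \<longrightarrow> x' t = w t)} \<subseteq> N"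
    using ae unfolding eventually_ae_filter_negligible by blast
  have eq: "x 0 + integral {0..s} w = x s" if "0 \<le> s" for s
  proof -
    have "integral {0..s} w = integral {0..s} x'"
      by (rule integral_spike[OF N(1)]) (use N(2) in auto)
    then show ?thesis using has_ac_derivativeD(2)[OF x that] by argo
  qed
  have "((\<lambda>s. integral {0..s} w) has_vector_derivative w t) (at t within {0..t + 1})"
    by (rule integral_has_vector_derivative) (use t in \<open>auto intro: continuous_on_subset[OF w]\<close>)
  then have "((\<lambda>s. x 0 + integral {0..s} w) has_vector_derivative w t) (at t within {0..t + 1})"
    by (auto intro!: derivative_eq_intros)
  moreover have "at t within {0..t + 1} = at t"
    using t by (intro at_within_interior) (auto simp: interior_atLeastAtMost_real)
  ultimately have "((\<lambda>s. x 0 + integral {0..s} w) has_vector_derivative w t) (at t)" by simp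
  then show ?thesis
    by (rule has_vector_derivative_transform_within_open[of _ _ _ "{0<..}"]) (use t eq in auto)
qed

text \<open>Invariance of \<psi> along \<open>b\<close> makes the set a graph over the hyperplane
  orthogonal to \<open>b\<close>, hence a differentiable image of a null set.\<close>

lemma negligible_graph:
  fixes \<psi> :: "'a::euclidean_space \<Rightarrow> real"
  assumes b: "norm b = 1" and diff: "\<psi> differentiable_on UNIV"
    and inv: "\<And>x c. \<psi> (x + c *\<^sub>R b) = \<psi> x"
  shows "negligible {x. x \<bullet> b = \<psi> x}"
proof -
  let ?\<phi> = "\<lambda>x. x + \<psi> x *\<^sub>R b"
  have "negligible {x. b \<bullet> x = 0}" using b by (intro negligible_hyperplane) auto
  moreover have "?\<phi> differentiable_on {x. b \<bullet> x = 0}"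
    by (intro differentiable_on_add differentiable_on_scaleR differentiable_on_ident differentiable_on_const
        differentiable_on_subset[OF diff]) auto
  ultimately have "negligible (?\<phi> ` {x. b \<bullet> x = 0})"
    by (intro negligible_differentiable_image_negligible) auto
  moreover have "{x. x \<bullet> b = \<psi> x} \<subseteq> ?\<phi> ` {x. b \<bullet> x = 0}"
  proof
    fix x assume x: "x \<in> {x. x \<bullet> b = \<psi> x}"
    have bb: "b \<bullet> b = 1" using b by (simp add: dot_square_norm)
    have "\<psi> (x - \<psi> x *\<^sub>R b) = \<psi> x" using inv[of x "- \<psi> x"] by simp
    then have "x = ?\<phi> (x - \<psi> x *\<^sub>R b)" by simp
    moreover have "b \<bullet> (x - \<psi> x *\<^sub>R b) = 0" using x bb by (simp add: inner_diff_right inner_commute)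
    ultimately show "x \<in> ?\<phi> ` {x. b \<bullet> x = 0}" by blast
  qed
  ultimately show ?thesis by (rule negligible_subset)
qed

section \<open>The sliding function along solutions\<close>

lemma diag_mat_mult: "diag_mat d *v x = (\<chi> i. d $ i * x $ i)"
proof -
  have "(\<Sum>j\<in>UNIV. (if i = j then d $ i else 0) * x $ j) = d $ i * x $ i" for i
  proof -
    have "(if i = j then d $ i else 0) * x $ j = (if i = j then d $ i * x $ i else 0)" for j by simp
    then show ?thesis by simp
  qed
  then show ?thesis by (simp add: diag_mat_def matrix_vector_mult_def vec_eq_iff)
qed

lemma diag_mat_mult_diag_mat: "diag_mat d ** diag_mat e = diag_mat (\<chi> i. d $ i * e $ i)"
  unfolding matrix_eq by (simp add: diag_mat_mult vec_eq_iff mult.assoc flip: matrix_vector_mul_assoc)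

lemma diag_mat_add: "diag_mat d + diag_mat e = diag_mat (\<chi> i. d $ i + e $ i)"
  by (simp add: diag_mat_def vec_eq_iff)

lemma matrix_inv_unique:
  fixes A :: "real^'n^'n"
  assumes "A ** B = mat 1" "B ** A = mat 1"
  shows "matrix_inv A = B"
proof -
  have "\<exists>A'. A ** A' = mat 1 \<and> A' ** A = mat 1" using assms by blast
  then have inv: "A ** matrix_inv A = mat 1 \<and> matrix_inv A ** A = mat 1"
    unfolding matrix_inv_def by (rule someI_ex)
  have "matrix_inv A = matrix_inv A ** (A ** B)" by (simp add: assms(1))
  also have "\<dots> = (matrix_inv A ** A) ** B" by (rule matrix_mul_assoc)
  also have "\<dots> = B" by (simp add: inv)
  finally show ?thesis .
qed

lemma matrix_inv_diag_mat:
  assumes "\<And>i. d $ i \<noteq> 0"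
  shows "matrix_inv (diag_mat d) = diag_mat (\<chi> i. 1 / d $ i)"
proof -
  have "diag_mat (\<chi> i. 1) = mat 1" by (simp add: diag_mat_def mat_def vec_eq_iff)
  then show ?thesis using assms by (intro matrix_inv_unique) (simp_all add: diag_mat_mult_diag_mat)
qed

lemma pos_def_diagonal_diag_mat:
  assumes "pos_def_diagonal A"
  obtains d where "A = diag_mat d" "\<And>i. 0 < d $ i"
proof
  show "A = diag_mat (\<chi> i. A $ i $ i)"
    using assms by (auto simp: diag_mat_def vec_eq_iff pos_def_diagonal_def)
  fix i
  have "0 < axis i 1 \<bullet> (A *v axis i 1)"
    using assms by (auto simp: pos_def_diagonal_def axis_eq_0_iff)
  then show "0 < (\<chi> i. A $ i $ i) $ i"
    by (simp add: inner_axis' matrix_vector_mult_basis column_def)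
qed

lemma matrix_vector_mult_uminus: "(A :: real^'n^'m) *v (- x) = - (A *v x)"
  by (rule linear_neg[OF matrix_vector_mul_linear])

text \<open>The linear part of \<open>sliding\<close>: it commutes with the integral of the
  velocity, and the constant \<open>V_ref\<close> disappears on differentiation.
  \<open>rate_lin\<close> does the same one derivative later, with \<open>I\<^sub>L\<close> as the
  constant.\<close>

definition sliding_lin :: "('n::finite, 'm::finite) microgrid \<Rightarrow> ('n, 'm) grid_state \<Rightarrow> real^'n" where
  "sliding_lin g z = matrix_inv (W_mat g) *v fst (snd z) - snd (snd (snd z))"

definition rate_lin :: "('n::finite, 'm::finite) microgrid \<Rightarrow> ('n, 'm) grid_state \<Rightarrow> real^'n" where
  "rate_lin g z = (matrix_inv (W_mat g) ** matrix_inv (C\<^sub>t g)) *v (fst z + incidence g *v fst (snd (snd z)))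
    + (comm_laplacian g ** W_mat g) *v fst z"

definition sliding_rate :: "('n::finite, 'm::finite) microgrid \<Rightarrow> ('n, 'm) grid_state \<Rightarrow> real^'n" where
  "sliding_rate g z = rate_lin g z - (matrix_inv (W_mat g) ** matrix_inv (C\<^sub>t g)) *v I\<^sub>L g"

lemma bounded_linear_matrix [intro]:
  "bounded_linear f \<Longrightarrow> bounded_linear (\<lambda>x. (A :: real^'n^'m) *v f x)"
  by (rule bounded_linear_compose[OF matrix_vector_mul_bounded_linear])

lemma bounded_linear_state:
  "bounded_linear (\<lambda>z. fst (snd z))" "bounded_linear (\<lambda>z. fst (snd (snd z)))"
  "bounded_linear (\<lambda>z. snd (snd (snd z)))"
  by (intro bounded_linear_fst bounded_linear_snd bounded_linear_fst_comp bounded_linear_snd_comp bounded_linear_ident)+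

lemma bounded_linear_sliding_lin: "bounded_linear (sliding_lin g)"
  unfolding sliding_lin_def[abs_def]
  by (intro bounded_linear_sub bounded_linear_matrix bounded_linear_state)

lemma bounded_linear_rate_lin: "bounded_linear (rate_lin g)"
  unfolding rate_lin_def[abs_def]
  by (intro bounded_linear_add bounded_linear_matrix bounded_linear_state bounded_linear_fst)

lemma sliding_eq: "sliding g z = sliding_lin g z - matrix_inv (W_mat g) *v V_ref g"
  by (cases z) (simp add: sliding_lin_def matrix_vector_mult_diff_distrib)

lemma sliding_lin_grid_field: "sliding_lin g (grid_field g u z) = sliding_rate g z"
  by (cases z) (simp add: sliding_lin_def sliding_rate_def rate_lin_def matrix_vector_right_distrib
      matrix_vector_mult_diff_distrib flip: matrix_vector_mul_assoc)

text \<open>The input first appears in the second derivative of \<sigma>. Its coupling to neighbours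
  through the adjacency matrix is counted in \<open>b_term\<close>, so that the remaining matrix
  \<open>G_d\<close> is diagonal.\<close>

lemma rate_lin_grid_field: "rate_lin g (grid_field g u z) = b_term g u z + G_d g *v u"
proof (cases z)
  case (fields It V I \<theta>)
  let ?WC = "matrix_inv (W_mat g) ** matrix_inv (C\<^sub>t g)"
  let ?e = "- (R\<^sub>t g *v It) - V + u" and ?f = "- (transpose (incidence g) *v V) - R\<^sub>l g *v I"
  define K where "K = (?WC + comm_laplacian g ** W_mat g) ** matrix_inv (L\<^sub>t g)"
  define P where "P = ?WC ** incidence g ** matrix_inv (L\<^sub>l g)"
  have "rate_lin g (grid_field g u z) = K *v ?e + P *v ?f"
    unfolding fields
    by (simp add: rate_lin_def K_def P_def matrix_vector_right_distrib matrix_vector_mult_add_rdistrib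
        flip: matrix_vector_mul_assoc)
  also have "K *v ?e = - ((K ** R\<^sub>t g) *v It) - K *v V + K *v u"
    by (simp add: matrix_vector_right_distrib matrix_vector_mult_diff_distrib matrix_vector_mult_uminus
        flip: matrix_vector_mul_assoc)
  also have "P *v ?f = - ((P ** transpose (incidence g)) *v V) - (P ** R\<^sub>l g) *v I"
    by (simp add: matrix_vector_mult_diff_distrib matrix_vector_mult_uminus flip: matrix_vector_mul_assoc)
  also have "K *v u = G_d g *v u - G_a g *v u"
    by (simp add: K_def G_d_def G_a_def comm_laplacian_def matrix_vector_mult_add_rdistrib
        matrix_vector_mult_diff_rdistrib flip: matrix_vector_mul_assoc)
  finally show ?thesis
    unfolding fields
    by (simp add: Let_def matrix_vector_mult_add_rdistrib flip: K_def P_def)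
qed

context
  fixes g :: "('n::finite, 'm::finite) microgrid"
  assumes g: "microgrid g"
begin

lemma G_d_mult: "(G_d g *v u) $ i = G_d g $ i $ i * u $ i"
proof -
  have W: "0 < weight g $ i" for i using g by (simp add: microgrid_def)
  have "pos_def_diagonal (C\<^sub>t g)" "pos_def_diagonal (L\<^sub>t g)" using g by (simp_all add: microgrid_def)
  then obtain c l where c: "C\<^sub>t g = diag_mat c" "\<And>i. 0 < c $ i" and l: "L\<^sub>t g = diag_mat l" "\<And>i. 0 < l $ i"
    by (metis pos_def_diagonal_diag_mat)
  have "matrix_inv (W_mat g) = diag_mat (\<chi> i. 1 / weight g $ i)"
    unfolding W_mat_def by (rule matrix_inv_diag_mat) (use W in \<open>metis less_irrefl\<close>)
  moreover have "matrix_inv (C\<^sub>t g) = diag_mat (\<chi> i. 1 / c $ i)"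
    unfolding c by (rule matrix_inv_diag_mat) (use c(2) in \<open>metis less_irrefl\<close>)
  moreover have "matrix_inv (L\<^sub>t g) = diag_mat (\<chi> i. 1 / l $ i)"
    unfolding l by (rule matrix_inv_diag_mat) (use l(2) in \<open>metis less_irrefl\<close>)
  ultimately obtain d where d: "G_d g = diag_mat d"
    unfolding G_d_def comm_degree_def W_mat_def by (simp add: diag_mat_mult_diag_mat diag_mat_add)
  show ?thesis unfolding d by (simp add: diag_mat_mult) (simp add: diag_mat_def)
qed

text \<open>The current equation is the row in which the input occurs; through it the input can be
  read off the velocity of a solution.\<close>

lemma grid_field_current:
  "L\<^sub>t g $ i $ i * fst (grid_field g u z) $ i = u $ i - (R\<^sub>t g *v fst z + fst (snd z)) $ i"
proof -
  have "pos_def_diagonal (L\<^sub>t g)" using g by (simp add: microgrid_def)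
  then obtain l where l: "L\<^sub>t g = diag_mat l" "\<And>i. 0 < l $ i" by (metis pos_def_diagonal_diag_mat)
  have "matrix_inv (L\<^sub>t g) = diag_mat (\<chi> i. 1 / l $ i)"
    unfolding l by (rule matrix_inv_diag_mat) (use l(2) in \<open>metis less_irrefl\<close>)
  moreover have "L\<^sub>t g $ i $ i = l $ i" unfolding l(1) by (simp add: diag_mat_def)
  ultimately show ?thesis using l(2)[of i]
    by (cases z) (simp add: diag_mat_mult field_simps)
qed

lemma comm_laplacian_sum: "(\<chi> i. 1) \<bullet> (comm_laplacian g *v x) = 0"
proof -
  let ?A = "comm_adjacency g"
  have sym: "?A $ i $ j = ?A $ j $ i" for i j
  proof -
    have "(i, j) \<in> comm_edges g \<longleftrightarrow> (j, i) \<in> comm_edges g"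
      using g by (auto simp: microgrid_def dest: symD)
    moreover have "comm_weight g i j = comm_weight g j i" if "(i, j) \<in> comm_edges g"
      using g that by (auto simp: microgrid_def)
    ultimately show ?thesis by (simp add: comm_adjacency_def)
  qed
  have "(comm_laplacian g *v x) $ i = (\<Sum>j\<in>UNIV. ?A $ i $ j * x $ i) - (\<Sum>j\<in>UNIV. ?A $ i $ j * x $ j)" for i
    by (simp add: comm_laplacian_def comm_degree_def matrix_vector_mult_diff_rdistrib diag_mat_mult
        sum_distrib_right) (simp add: matrix_vector_mult_def)
  moreover have "(\<Sum>i\<in>UNIV. \<Sum>j\<in>UNIV. ?A $ i $ j * x $ i) = (\<Sum>i\<in>UNIV. \<Sum>j\<in>UNIV. ?A $ i $ j * x $ j)"
    by (subst sum.swap) (simp add: sym)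
  ultimately show ?thesis by (simp add: inner_vec_def sum_subtractf)
qed

end

section \<open>Properties of solutions common to both schemes\<close>

lemma has_ac_derivative_diff_const:
  assumes "has_ac_derivative x x'"
  shows "has_ac_derivative (\<lambda>t. x t - c) x'"
  unfolding has_ac_derivative_def
proof (intro allI impI conjI)
  fix T :: real assume "0 \<le> T"
  note has_ac_derivativeD[OF assms this]
  then show "x' absolutely_integrable_on {0..T}" "x T - c = x 0 - c + integral {0..T} x'"
    by (simp_all only: diff_add_eq)
qed

lemma finite_uniform_time:
  assumes "\<And>i::'n::finite. \<exists>T\<ge>0. \<forall>t\<ge>T. P i t"
  shows "\<exists>T\<ge>0::real. \<forall>t\<ge>T. \<forall>i. P i t"
proof -
  obtain T where T: "\<And>i. 0 \<le> T i" "\<And>i t. T i \<le> t \<Longrightarrow> P i t" using assms by metis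
  \<comment> \<open>The times are nonnegative, so their sum is a common bound.\<close>
  have le: "T i \<le> (\<Sum>i\<in>UNIV. T i)" for i using T(1) by (intro member_le_sum) auto
  have "0 \<le> (\<Sum>i\<in>UNIV. T i)" using T(1) by (simp add: sum_nonneg)
  moreover have "\<forall>t\<ge>(\<Sum>i\<in>UNIV. T i). \<forall>i. P i t" using T(2) le order_trans by blast
  ultimately show ?thesis by blast
qed

locale grid_solution =
  fixes g :: "('n::finite, 'm::finite) microgrid" and x x' :: "real \<Rightarrow> ('n, 'm) grid_state"
    and u :: "real \<Rightarrow> real^'n"
  assumes g: "microgrid g" and ac: "has_ac_derivative x x'"
    and ae: "AE t in lebesgue. t \<ge> 0 \<longrightarrow> x' t = grid_field g (u t) (x t)"
begin

lemma continuous_x: "continuous_on {0..} x"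
  by (rule has_ac_derivative_continuous[OF ac])

lemma continuous_sliding: "continuous_on {0..} (\<lambda>t. sliding g (x t))"
  unfolding sliding_eq
  by (intro continuous_intros bounded_linear.continuous_on[OF bounded_linear_sliding_lin] continuous_x)

lemma continuous_rate: "continuous_on {0..} (\<lambda>t. sliding_rate g (x t))"
  unfolding sliding_rate_def
  by (intro continuous_intros bounded_linear.continuous_on[OF bounded_linear_rate_lin] continuous_x)

lemma sliding_derivative:
  assumes "0 < t"
  shows "((\<lambda>s. sliding g (x s)) has_vector_derivative sliding_rate g (x t)) (at t)"
  unfolding sliding_eq
proof (rule has_ac_derivative_vector_derivative[OF _ continuous_rate _ assms])
  show "has_ac_derivative (\<lambda>s. sliding_lin g (x s) - matrix_inv (W_mat g) *v V_ref g) (\<lambda>s. sliding_lin g (x' s))"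
    by (intro has_ac_derivative_diff_const has_ac_derivative_linear[OF ac bounded_linear_sliding_lin])
  show "AE t in lebesgue. 0 \<le> t \<longrightarrow> sliding_lin g (x' t) = sliding_rate g (x t)"
    using ae by eventually_elim (simp add: sliding_lin_grid_field)
qed

lemma rate_ac: "has_ac_derivative (\<lambda>t. sliding_rate g (x t)) (\<lambda>t. rate_lin g (x' t))"
  unfolding sliding_rate_def
  by (intro has_ac_derivative_diff_const has_ac_derivative_linear[OF ac bounded_linear_rate_lin])

lemma rate_ae: "AE t in lebesgue. t \<ge> 0 \<longrightarrow>
    (\<forall>i. rate_lin g (x' t) $ i = b_term g (u t) (x t) $ i + G_d g $ i $ i * u t $ i)"
  using ae by eventually_elim (simp add: rate_lin_grid_field G_d_mult[OF g])

lemma theta_sum: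
  assumes "0 \<le> t"
  shows "(\<chi> i. 1) \<bullet> snd (snd (snd (x t))) = (\<chi> i. 1) \<bullet> snd (snd (snd (x 0)))"
proof -
  let ?h = "\<lambda>z::('n, 'm) grid_state. (\<chi> i. 1) \<bullet> snd (snd (snd z))"
  have h: "bounded_linear ?h"
    by (rule bounded_linear_compose[OF bounded_linear_inner_right bounded_linear_state(3)])
  note A = has_ac_derivative_linear[OF ac h]
  have h0: "?h (grid_field g v z) = 0" for v z
    by (cases z) (simp add: comm_laplacian_sum[OF g] flip: matrix_vector_mul_assoc)
  have "AE s in lebesgue. 0 < s \<longrightarrow> s < t \<longrightarrow> ?h (x' s) \<le> 0"
    using ae by eventually_elim (auto simp: h0 simp del: grid_field.simps)
  from has_ac_derivative_le[OF A order_refl assms this]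
  have "?h (x t) - ?h (x 0) \<le> 0" by simp
  moreover have "AE s in lebesgue. 0 < s \<longrightarrow> s < t \<longrightarrow> 0 \<le> ?h (x' s)"
    using ae by eventually_elim (auto simp: h0 simp del: grid_field.simps)
  from has_ac_derivative_ge[OF A order_refl assms this]
  have "0 \<le> ?h (x t) - ?h (x 0)" by simp
  ultimately show ?thesis by simp
qed

lemma voltage_balance:
  assumes "\<And>i. \<exists>T\<ge>0. \<forall>t\<ge>T. sliding g (x t) $ i = 0" and "(\<chi> i. 1) \<bullet> snd (snd (snd (x 0))) = 0"
  shows "\<exists>T\<ge>0. \<forall>t\<ge>T. (\<chi> i. 1) \<bullet> (matrix_inv (W_mat g) *v fst (snd (x t))) =
    (\<chi> i. 1) \<bullet> (matrix_inv (W_mat g) *v V_ref g)"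
proof -
  obtain T where T: "0 \<le> T" "\<forall>t\<ge>T. \<forall>i. sliding g (x t) $ i = 0"
    using finite_uniform_time[of "\<lambda>i t. sliding g (x t) $ i = 0", OF assms(1)] by blast
  show ?thesis
  proof (intro exI conjI allI impI)
    fix t assume t: "T \<le> t"
    then have "sliding g (x t) = 0" using T by (simp add: vec_eq_iff)
    then have "(\<chi> i. 1) \<bullet> (matrix_inv (W_mat g) *v fst (snd (x t)))
        - (\<chi> i. 1) \<bullet> (matrix_inv (W_mat g) *v V_ref g) - (\<chi> i. 1) \<bullet> snd (snd (snd (x t))) = 0"
      unfolding sliding_eq sliding_lin_def by (simp add: algebra_simps flip: inner_diff_right inner_add_right)
    then show "(\<chi> i. 1) \<bullet> (matrix_inv (W_mat g) *v fst (snd (x t))) =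
        (\<chi> i. 1) \<bullet> (matrix_inv (W_mat g) *v V_ref g)"
      using theta_sum[of t] assms(2) T t by simp
  qed (rule T)
qed

end

section \<open>The input realized by a Filippov solution\<close>

lemma isCont_current_offset:
  "isCont (\<lambda>z. (R\<^sub>t g *v fst z + fst (snd z)) $ i) (z :: ('n::finite, 'm::finite) grid_state)"
proof -
  have "bounded_linear (\<lambda>z::('n, 'm) grid_state. R\<^sub>t g *v fst z + fst (snd z))"
    by (intro bounded_linear_add bounded_linear_matrix bounded_linear_fst bounded_linear_state)
  from bounded_linear_compose[OF bounded_linear_vec_nth this] show ?thesis
    by (rule linear_continuous_at)
qed

lemma isCont_sliding: "isCont (sliding g) z"
proof -
  have "isCont (\<lambda>z. sliding_lin g z - matrix_inv (W_mat g) *v V_ref g) z"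
    by (intro continuous_intros linear_continuous_at bounded_linear_sliding_lin)
  then show ?thesis by (simp add: sliding_eq[abs_def])
qed

text \<open>In the current equation the input stands beside terms continuous in the state, so bounds
  on the feedback near the current state pass to \<open>v\<close>. Only row \<open>i\<close> is
  tested, hence the other components may sit at their discontinuities.\<close>

lemma filippov_feedback:
  fixes g :: "('n::finite, 'm::finite) microgrid"
  assumes g: "microgrid g"
    and q: "grid_field g v x \<in> filippov (\<lambda>z. grid_field g (\<chi> i. \<phi> i (sliding g z $ i)) z) x"
    and P: "open P" "sliding g x $ i \<in> P"
  shows "(\<And>y. y \<in> P \<Longrightarrow> \<phi> i y \<le> c) \<Longrightarrow> v $ i \<le> c" "(\<And>y. y \<in> P \<Longrightarrow> c \<le> \<phi> i y) \<Longrightarrow> c \<le> v $ i"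
proof -
  let ?h = "\<lambda>q::('n, 'm) grid_state. L\<^sub>t g $ i $ i * fst q $ i"
  let ?o = "\<lambda>z::('n, 'm) grid_state. (R\<^sub>t g *v fst z + fst (snd z)) $ i"
  have h: "bounded_linear ?h"
    by (intro bounded_linear_const_mult bounded_linear_compose[OF bounded_linear_vec_nth bounded_linear_fst])
  have "isCont (\<lambda>z. sliding g z $ i) x" by (intro continuous_intros isCont_sliding)
  then have "((\<lambda>z. sliding g z $ i) \<longlongrightarrow> sliding g x $ i) (nhds x)"
    unfolding isCont_def by (rule tendsto_at_iff_tendsto_nhds[THEN iffD1])
  from topological_tendstoD[OF this P] have "\<forall>\<^sub>F z in nhds x. sliding g z $ i \<in> P" .
  then obtain \<delta> where \<delta>: "0 < \<delta>" "\<And>z. z \<in> ball x \<delta> \<Longrightarrow> sliding g z $ i \<in> P"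
    unfolding eventually_nhds_metric by (auto simp: dist_commute)
  show "v $ i \<le> c" if "\<And>y. y \<in> P \<Longrightarrow> \<phi> i y \<le> c"
  proof -
    have "?h (grid_field g v x) \<le> c - ?o x"
    proof (rule filippov_le[OF q h _ \<delta>(1) negligible_empty])
      fix z assume "z \<in> ball x \<delta>"
      then show "?h (grid_field g (\<chi> i. \<phi> i (sliding g z $ i)) z) \<le> c - ?o z"
        unfolding grid_field_current[OF g] using \<delta>(2) that by simp
    qed (intro continuous_intros isCont_current_offset)
    then show ?thesis unfolding grid_field_current[OF g] by simp
  qed
  show "c \<le> v $ i" if "\<And>y. y \<in> P \<Longrightarrow> c \<le> \<phi> i y"
  proof -
    have "c - ?o x \<le> ?h (grid_field g v x)"
    proof (rule filippov_ge[OF q h _ \<delta>(1) negligible_empty])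
      fix z assume "z \<in> ball x \<delta>"
      then show "c - ?o z \<le> ?h (grid_field g (\<chi> i. \<phi> i (sliding g z $ i)) z)"
        unfolding grid_field_current[OF g] using \<delta>(2) that by simp
    qed (intro continuous_intros isCont_current_offset)
    then show ?thesis unfolding grid_field_current[OF g] by simp
  qed
qed

lemma ssosm_input_bounds:
  assumes "0 < U" "0 < \<mu>" "\<mu> \<le> 1"
  shows "m / 2 < y \<Longrightarrow> ssosm_input \<mu> U m y \<le> - (\<mu> * U)" "y < m / 2 \<Longrightarrow> \<mu> * U \<le> ssosm_input \<mu> U m y"
    "0 < m \<Longrightarrow> m / 2 < y \<Longrightarrow> y < m \<Longrightarrow> ssosm_input \<mu> U m y = - (\<mu> * U)"
    "m < 0 \<Longrightarrow> m < y \<Longrightarrow> y < m / 2 \<Longrightarrow> ssosm_input \<mu> U m y = \<mu> * U"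
    "0 < m \<Longrightarrow> y < m / 2 \<Longrightarrow> ssosm_input \<mu> U m y = U"
    "m < 0 \<Longrightarrow> m / 2 < y \<Longrightarrow> ssosm_input \<mu> U m y = - U"
proof -
  have "\<mu> * U \<le> 1 * U" using assms by (intro mult_right_mono) auto
  then have U: "\<mu> * U \<le> U" by simp
  show "m / 2 < y \<Longrightarrow> ssosm_input \<mu> U m y \<le> - (\<mu> * U)" "y < m / 2 \<Longrightarrow> \<mu> * U \<le> ssosm_input \<mu> U m y"
    using U by (auto simp: ssosm_input_def)
  show "ssosm_input \<mu> U m y = - (\<mu> * U)" if "0 < m" "m / 2 < y" "y < m"
    using that mult_pos_pos[of "y - m / 2" "m - y"] by (simp add: ssosm_input_def)
  show "ssosm_input \<mu> U m y = \<mu> * U" if "m < 0" "m < y" "y < m / 2"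
    using that mult_neg_neg[of "y - m / 2" "m - y"] by (simp add: ssosm_input_def)
  show "ssosm_input \<mu> U m y = U" if "0 < m" "y < m / 2"
    using that mult_neg_pos[of "y - m / 2" "m - y"] by (simp add: ssosm_input_def)
  show "ssosm_input \<mu> U m y = - U" if "m < 0" "m / 2 < y"
    using that mult_pos_neg[of "y - m / 2" "m - y"] by (simp add: ssosm_input_def)
qed

section \<open>Finite time convergence of the sliding function\<close>

lemma ssosm_sliding_zero:
  fixes g :: "('n::finite, 'm::finite) microgrid"
  assumes sol: "grid_solution g x x' u"
    and G: "0 < Gmin" "Gmin \<le> G_d g $ i $ i" "G_d g $ i $ i \<le> Gmax"
    and \<mu>: "0 < \<mu>s i" "\<mu>s i \<le> 1" and b: "0 < bmax"
    and U1: "bmax / (\<mu>s i * Gmin) < Umax i" and U2: "4 * bmax / (3 * Gmin - \<mu>s i * Gmax) < Umax i"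
    and \<mu>G: "\<mu>s i < 3 * Gmin / Gmax"
    and m: "stores_extremum (\<lambda>t. sliding g (x t) $ i) (\<lambda>t. m t $ i)"
    and fil: "AE t in lebesgue. t \<ge> 0 \<longrightarrow> x' t \<in> filippov
      (\<lambda>z. grid_field g (\<chi> i. ssosm_input (\<mu>s i) (Umax i) (m t $ i) (sliding g z $ i)) z) (x t)"
    and bt: "AE t in lebesgue. t \<ge> 0 \<longrightarrow> \<bar>b_term g (u t) (x t) $ i\<bar> \<le> bmax"
  shows "\<exists>T\<ge>0. \<forall>t\<ge>T. sliding g (x t) $ i = 0"
proof -
  interpret grid_solution g x x' u by (rule sol)
  let ?G = "G_d g $ i $ i" and ?U = "Umax i" and ?\<mu> = "\<mu>s i"
  let ?y = "\<lambda>t. sliding g (x t) $ i" and ?p = "\<lambda>t. sliding_rate g (x t) $ i"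
    and ?w = "\<lambda>t. rate_lin g (x' t) $ i" and ?m = "\<lambda>t. m t $ i"
  \<comment> \<open>The extreme accelerations for reduced and full gain under the worst
    \<open>b_term\<close>. The first bound on \<open>Umax\<close> gives \<open>0 < \<kappa>\<close>,
    and the second is equivalent to \<open>K < 3 * \<kappa>'\<close>.\<close>
  define \<kappa> \<kappa>' K where "\<kappa> = Gmin * (?\<mu> * ?U) - bmax" and "\<kappa>' = Gmin * ?U - bmax"
    and "K = Gmax * (?\<mu> * ?U) + bmax"
  have "0 < Gmax" using G by linarith
  have "0 < bmax / (?\<mu> * Gmin)" using b \<mu> G by simp
  then have U: "0 < ?U" using U1 by linarith
  have \<mu>U: "0 < ?\<mu> * ?U" "?\<mu> * ?U \<le> ?U" using \<mu> U mult_right_mono[of ?\<mu> 1 ?U] by auto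
  have "bmax < ?U * (?\<mu> * Gmin)" using U1 \<mu> G by (simp add: pos_divide_less_eq)
  then have \<kappa>: "0 < \<kappa>" by (simp add: \<kappa>_def mult_ac)
  have K: "0 < K" unfolding K_def using mult_pos_pos[OF \<open>0 < Gmax\<close> \<mu>U(1)] b by simp
  have "0 < 3 * Gmin - ?\<mu> * Gmax" using \<mu>G \<open>0 < Gmax\<close> by (simp add: pos_less_divide_eq)
  then have "4 * bmax < ?U * (3 * Gmin - ?\<mu> * Gmax)" using U2 by (simp add: pos_divide_less_eq)
  then have K\<kappa>': "K < 3 * \<kappa>'" by (simp add: K_def \<kappa>'_def algebra_simps)
  then have \<kappa>': "0 < \<kappa>'" using K by simp
  \<comment> \<open>At a fixed instant the memory is a constant, and each premise describes an open
    set of values of \<open>y\<close> on which the input is bounded or constant.\<close>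
  have ae_bounds: "AE t in lebesgue. t \<ge> 0 \<longrightarrow>
      (?m t / 2 < ?y t \<longrightarrow> ?w t \<le> - \<kappa>) \<and> (?y t < ?m t / 2 \<longrightarrow> \<kappa> \<le> ?w t) \<and>
      (0 < ?m t \<and> ?m t / 2 < ?y t \<and> ?y t < ?m t \<longrightarrow> - K \<le> ?w t) \<and>
      (?m t < 0 \<and> ?m t < ?y t \<and> ?y t < ?m t / 2 \<longrightarrow> ?w t \<le> K) \<and>
      (0 < ?m t \<and> ?y t < ?m t / 2 \<longrightarrow> \<kappa>' \<le> ?w t) \<and>
      (?m t < 0 \<and> ?m t / 2 < ?y t \<longrightarrow> ?w t \<le> - \<kappa>')"
    using fil bt rate_ae ae
  proof eventually_elim
    case (elim t)
    show ?case
    proof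
      assume t: "t \<ge> 0"
      let ?M = "?m t" and ?v = "u t $ i"
      have w: "?w t = b_term g (u t) (x t) $ i + ?G * ?v" and bb: "\<bar>b_term g (u t) (x t) $ i\<bar> \<le> bmax"
        using elim t by auto
      have q: "grid_field g (u t) (x t) \<in> filippov
          (\<lambda>z. grid_field g (\<chi> i. ssosm_input (\<mu>s i) (Umax i) (m t $ i) (sliding g z $ i)) z) (x t)"
        using elim t by simp
      note F = filippov_feedback[OF g q, of _ i]
      note inp = ssosm_input_bounds[OF U \<mu>, where m = ?M]
      have up: "Gmin * c \<le> ?G * c" "?G * c \<le> Gmax * c" if "0 \<le> c" for c
        using G that by (auto intro: mult_right_mono)
      have mono: "?v \<le> c \<Longrightarrow> ?G * ?v \<le> ?G * c" "c \<le> ?v \<Longrightarrow> ?G * c \<le> ?G * ?v" for c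
        using G by (auto intro: mult_left_mono)
      have 1: "?w t \<le> - \<kappa>" if "?M / 2 < ?y t"
        using mono(1)[OF F(1)[of "{?M / 2<..}" "- (?\<mu> * ?U)"]] that inp(1) up(1)[of "?\<mu> * ?U"] \<mu>U w bb
        by (auto simp: \<kappa>_def)
      have 2: "\<kappa> \<le> ?w t" if "?y t < ?M / 2"
        using mono(2)[OF F(2)[of "{..<?M / 2}" "?\<mu> * ?U"]] that inp(2) up(1)[of "?\<mu> * ?U"] \<mu>U w bb
        by (auto simp: \<kappa>_def)
      have 3: "- K \<le> ?w t" if "0 < ?M" "?M / 2 < ?y t" "?y t < ?M"
        using mono(2)[OF F(2)[of "{?M / 2<..<?M}" "- (?\<mu> * ?U)"]] that inp(3) up(2)[of "?\<mu> * ?U"] \<mu>U w bb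
        by (auto simp: K_def)
      have 4: "?w t \<le> K" if "?M < 0" "?M < ?y t" "?y t < ?M / 2"
        using mono(1)[OF F(1)[of "{?M<..<?M / 2}" "?\<mu> * ?U"]] that inp(4) up(2)[of "?\<mu> * ?U"] \<mu>U w bb
        by (auto simp: K_def)
      have 5: "\<kappa>' \<le> ?w t" if "0 < ?M" "?y t < ?M / 2"
      proof -
        have "?G * ?U \<le> ?G * ?v" using mono(2)[OF F(2)[of "{..<?M / 2}" "?U"]] that inp(5) by auto
        then show ?thesis using up(1)[OF less_imp_le[OF U]] w bb unfolding \<kappa>'_def by linarith
      qed
      have 6: "?w t \<le> - \<kappa>'" if "?M < 0" "?M / 2 < ?y t"
      proof -
        have "?G * ?v \<le> ?G * - ?U" using mono(1)[OF F(1)[of "{?M / 2<..}" "- ?U"]] that inp(6) by auto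
        then show ?thesis using up(1)[OF less_imp_le[OF U]] w bb unfolding \<kappa>'_def by linarith
      qed
      show "(?m t / 2 < ?y t \<longrightarrow> ?w t \<le> - \<kappa>) \<and> (?y t < ?m t / 2 \<longrightarrow> \<kappa> \<le> ?w t) \<and>
          (0 < ?m t \<and> ?m t / 2 < ?y t \<and> ?y t < ?m t \<longrightarrow> - K \<le> ?w t) \<and>
          (?m t < 0 \<and> ?m t < ?y t \<and> ?y t < ?m t / 2 \<longrightarrow> ?w t \<le> K) \<and>
          (0 < ?m t \<and> ?y t < ?m t / 2 \<longrightarrow> \<kappa>' \<le> ?w t) \<and>
          (?m t < 0 \<and> ?m t / 2 < ?y t \<longrightarrow> ?w t \<le> - \<kappa>')"
        using 1 2 3 4 5 6 by blast
    qed
  qed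
  have pac: "has_ac_derivative ?p ?w"
    by (rule has_ac_derivative_linear[OF rate_ac bounded_linear_vec_nth])
  obtain S where S: "0 \<in> S" "S \<subseteq> {0..}" "\<And>s. 0 < s \<Longrightarrow> local_extremum ?y s \<Longrightarrow> s \<in> S"
    "\<And>s. s \<in> S \<Longrightarrow> 0 < s \<Longrightarrow> (?y has_real_derivative 0) (at s)"
    "\<And>t. 0 \<le> t \<Longrightarrow> \<exists>s\<in>S. s \<le> t \<and> (\<forall>r\<in>S. r \<le> t \<longrightarrow> r \<le> s) \<and> ?m t = ?y s"
    using m unfolding stores_extremum_def by blast
  have der: "(?y has_real_derivative ?p t) (at t)" if "0 < t" for t
    using bounded_linear.has_vector_derivative[OF bounded_linear_vec_nth sliding_derivative[OF that]]
    by (simp add: has_real_derivative_iff_has_vector_derivative)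
  interpret suboptimal \<kappa> \<kappa>' K ?y ?p ?m S
  proof
    show "continuous_on {0..} ?y" "continuous_on {0..} ?p"
      by (intro continuous_intros continuous_sliding continuous_rate)+
    show "?p s = 0" if "s \<in> S" "0 < s" for s
      using DERIV_unique[OF der[OF that(2)] S(4)[OF that]] .
    fix a b :: real assume ab: "0 \<le> a" "a \<le> b"
    show "?p b - ?p a \<le> - \<kappa> * (b - a)" if "\<And>t. a < t \<Longrightarrow> t < b \<Longrightarrow> ?m t / 2 < ?y t"
      by (rule has_ac_derivative_le[OF pac ab], use ae_bounds in eventually_elim) (use that ab in auto)
    show "\<kappa> * (b - a) \<le> ?p b - ?p a" if "\<And>t. a < t \<Longrightarrow> t < b \<Longrightarrow> ?y t < ?m t / 2"
      by (rule has_ac_derivative_ge[OF pac ab], use ae_bounds in eventually_elim) (use that ab in auto)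
    show "- K * (b - a) \<le> ?p b - ?p a"
      if "\<And>t. a < t \<Longrightarrow> t < b \<Longrightarrow> 0 < ?m t \<and> ?m t / 2 < ?y t \<and> ?y t < ?m t"
      by (rule has_ac_derivative_ge[OF pac ab], use ae_bounds in eventually_elim) (use that ab in auto)
    show "?p b - ?p a \<le> K * (b - a)"
      if "\<And>t. a < t \<Longrightarrow> t < b \<Longrightarrow> ?m t < 0 \<and> ?m t < ?y t \<and> ?y t < ?m t / 2"
      by (rule has_ac_derivative_le[OF pac ab], use ae_bounds in eventually_elim) (use that ab in auto)
    show "\<kappa>' * (b - a) \<le> ?p b - ?p a" if "\<And>t. a < t \<Longrightarrow> t < b \<Longrightarrow> 0 < ?m t \<and> ?y t < ?m t / 2"
      by (rule has_ac_derivative_ge[OF pac ab], use ae_bounds in eventually_elim) (use that ab in auto)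
    show "?p b - ?p a \<le> - \<kappa>' * (b - a)" if "\<And>t. a < t \<Longrightarrow> t < b \<Longrightarrow> ?m t < 0 \<and> ?m t / 2 < ?y t"
      by (rule has_ac_derivative_le[OF pac ab], use ae_bounds in eventually_elim) (use that ab in auto)
  qed (fact \<kappa> \<kappa>' K K\<kappa>' der S(1,2,3,5))+
  show ?thesis by (rule finite_time_convergence)
qed

section \<open>Normalization of the third order law\<close>

lemma tsm_v2_eq: "0 < a \<Longrightarrow> tsm_v2 a y2 y3 = sgn (sw_curve (y2 / a) (y3 / a))"
proof -
  assume a: "0 < a"
  have "y2 + y3\<^sup>2 * sgn y3 / (2 * a) = a * sw_curve (y2 / a) (y3 / a)"
    using a by (simp add: sw_curve_def power2_eq_square abs_sgn field_simps)
  then show ?thesis using a by (simp add: tsm_v2_def sgn_mult)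
qed

lemma pow32_powr: "0 \<le> c \<Longrightarrow> pow32 c = c powr (3 / 2)"
proof (cases "c = 0")
  case False
  assume "0 \<le> c"
  then have c: "0 < c" using False by simp
  have "c powr (3 / 2) = c powr (1 + 1 / 2)" by simp
  also have "\<dots> = c * sqrt c" unfolding powr_add using c by (simp add: powr_half_sqrt)
  finally show ?thesis using c by (simp add: pow32_def)
qed (simp add: pow32_def)

text \<open>The power 3 / 2 of the scale against the prefactor leaves a single factor
  \<open>a\<close>, so \<open>tsm_s\<close> is homogeneous of degree one when coordinates and
  authority are scaled together.\<close>

lemma powr_scale: "0 < a \<Longrightarrow> 0 \<le> c \<Longrightarrow> 1 / sqrt a * (a * c) powr (3 / 2) = a * pow32 c"
proof -
  assume a: "0 < a" and c: "0 \<le> c"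
  have "(a * c) powr (3 / 2) = pow32 a * pow32 c" using a c by (simp add: powr_mult pow32_powr)
  then show ?thesis using a by (simp add: pow32_def field_simps real_sqrt_mult_self)
qed

lemma tsm_s_eq:
  assumes a: "0 < a" and ne: "sw_curve (y2 / a) (y3 / a) \<noteq> 0"
  shows "tsm_s a y1 y2 y3 = a * sw (y1 / a, y2 / a, y3 / a)"
proof (cases "0 < sw_curve (y2 / a) (y3 / a)")
  case True
  have "0 \<le> y2 / a + (y3 / a)\<^sup>2 / 2" using sw_curve_nonneg_imp(1) True by simp
  note p = powr_scale[OF a this]
  have "y2 + y3\<^sup>2 / (2 * a) = a * (y2 / a + (y3 / a)\<^sup>2 / 2)" using a by (simp add: field_simps power2_eq_square)
  then have "tsm_s a y1 y2 y3 = y1 + y3 ^ 3 / (3 * a\<^sup>2) + (a * pow32 (y2 / a + (y3 / a)\<^sup>2 / 2) + y2 * y3 / a)"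
    using True by (simp only: tsm_s_def tsm_v2_eq[OF a] sgn_pos mult_1 p)
  also have "\<dots> = a * sw (y1 / a, y2 / a, y3 / a)"
    using True a by (simp add: sw_def sw_plus_def distrib_left)
      (simp add: field_simps power2_eq_square power3_eq_cube)
  finally show ?thesis .
next
  case False
  then have neg: "sw_curve (y2 / a) (y3 / a) < 0" using ne by simp
  then have "0 < sw_curve (- (y2 / a)) (- (y3 / a))" using sw_curve_uminus[of "y2 / a" "y3 / a"] by simp
  then have "0 \<le> - (y2 / a) + (- (y3 / a))\<^sup>2 / 2" by (rule sw_curve_nonneg_imp(1)[OF less_imp_le])
  note p = powr_scale[OF a this]
  have "- 1 * y2 + y3\<^sup>2 / (2 * a) = a * (- (y2 / a) + (- (y3 / a))\<^sup>2 / 2)"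
    using a by (simp add: field_simps power2_eq_square)
  then have "tsm_s a y1 y2 y3 = y1 + y3 ^ 3 / (3 * a\<^sup>2) +
      - 1 * (a * pow32 (- (y2 / a) + (- (y3 / a))\<^sup>2 / 2) + y2 * y3 / a)"
    using neg by (simp only: tsm_s_def tsm_v2_eq[OF a] sgn_neg p)
  also have "\<dots> = a * sw (y1 / a, y2 / a, y3 / a)"
    using neg a by (simp add: sw_def sw_minus_def sw_plus_def distrib_left)
      (simp add: field_simps power2_eq_square power3_eq_cube)
  finally show ?thesis .
qed

text \<open>\<open>tsm_M1\<close> lies in the curve, and off the curve \<open>tsm_M2\<close> is the
  surface; elsewhere only the last case of the law remains.\<close>

lemma tsm_control_eq:
  assumes a: "0 < a" and ne: "sw_curve (y2 / a) (y3 / a) \<noteq> 0" and sw: "sw (y1 / a, y2 / a, y3 / a) \<noteq> 0"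
  shows "tsm_control \<alpha> a y1 y2 y3 = - \<alpha> * sgn (sw (y1 / a, y2 / a, y3 / a))"
proof -
  have "y2 + y3 * \<bar>y3\<bar> / (2 * a) = a * sw_curve (y2 / a) (y3 / a)"
    using a by (simp add: sw_curve_def field_simps)
  then have "(y1, y2, y3) \<notin> tsm_M1 a" using a ne by (simp add: tsm_M1_def)
  moreover have "(y1, y2, y3) \<notin> tsm_M2 a" using a sw by (simp add: tsm_M2_def tsm_s_eq[OF a ne])
  ultimately show ?thesis
    using a by (simp add: tsm_control_def tsm_s_eq[OF a ne] sgn_mult)
qed

lemma abs_tsm_control_le: "0 < \<alpha> \<Longrightarrow> \<bar>tsm_control \<alpha> a y1 y2 y3\<bar> \<le> \<alpha>"
proof -
  assume "0 < \<alpha>"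
  then have "\<bar>- \<alpha> * sgn r\<bar> \<le> \<alpha>" for r :: real by (simp add: abs_mult sgn_if)
  then show ?thesis unfolding tsm_control_def tsm_v2_def by (simp split: if_split)
qed

type_synonym ('n, 'm) tsm_state =
  "('n, 'm) grid_state \<times> (real^'n) \<times> ((real^'n) \<times> (real^'n) \<times> (real^'n))"

text \<open>In the full state space the curve is the graph of one coordinate of the second estimate
  over the third. Being a null set, it can be removed from the convexification.\<close>

lemma negligible_sw_curve:
  assumes a: "0 < a"
  shows "negligible {z :: ('n::finite, 'm::finite) tsm_state.
    sw_curve (fst (snd (snd (snd z))) $ i / a) (snd (snd (snd (snd z))) $ i / a) = 0}"
proof -
  let ?b = "(0, 0, 0, axis i 1, 0) :: ('n, 'm) tsm_state"
  let ?k = "\<lambda>z :: ('n, 'm) tsm_state. snd (snd (snd (snd z))) $ i"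
  define \<psi> where "\<psi> = (\<lambda>z. - (?k z * \<bar>?k z\<bar>) / (2 * a))"
  have k: "bounded_linear ?k"
    by (intro bounded_linear_compose[OF bounded_linear_vec_nth] bounded_linear_snd_comp bounded_linear_ident)
  have "negligible {z. z \<bullet> ?b = \<psi> z}"
  proof (rule negligible_graph)
    show "norm ?b = 1" by (simp add: norm_Pair)
    show "\<psi> (z + c *\<^sub>R ?b) = \<psi> z" for z c by (cases z) (simp add: \<psi>_def)
    have "(\<lambda>z. ?k z * \<bar>?k z\<bar>) differentiable (at z)" for z
    proof -
      have "(?k has_derivative ?k) (at z)" by (rule bounded_linear.has_derivative[OF k]) simp
      from has_derivative_compose[OF this has_real_derivative_times_abs[of "?k z", unfolded has_field_derivative_def]]
      show ?thesis by (auto simp: differentiable_def)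
    qed
    then show "\<psi> differentiable_on UNIV"
      unfolding \<psi>_def differentiable_on_def using a by (intro ballI differentiable_divide differentiable_minus) auto
  qed
  moreover have "sw_curve (fst (snd (snd (snd z))) $ i / a) (?k z / a) = 0 \<longleftrightarrow> z \<bullet> ?b = \<psi> z" for z
    using a by (cases z) (auto simp: sw_curve_def \<psi>_def inner_axis field_simps)
  ultimately show ?thesis by simp
qed

lemma isCont_matrix:
  fixes f :: "'a::t2_space \<Rightarrow> real^'n"
  shows "isCont f z \<Longrightarrow> isCont (\<lambda>z. (A :: real^'n^'m) *v f z) z"
  by (rule bounded_linear.isCont[OF matrix_vector_mul_bounded_linear])

lemma isCont_grid_field:
  fixes z :: "('n::finite, 'm::finite) tsm_state"
  shows "isCont (\<lambda>z. grid_field g (fst (snd z)) (fst z)) z"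
proof -
  have "(\<lambda>z::('n, 'm) tsm_state. grid_field g (fst (snd z)) (fst z)) = (\<lambda>z.
     (matrix_inv (L\<^sub>t g) *v (- (R\<^sub>t g *v fst (fst z)) - fst (snd (fst z)) + fst (snd z)),
     matrix_inv (C\<^sub>t g) *v (fst (fst z) + incidence g *v fst (snd (snd (fst z))) - I\<^sub>L g),
     matrix_inv (L\<^sub>l g) *v (- (transpose (incidence g) *v fst (snd (fst z))) - R\<^sub>l g *v fst (snd (snd (fst z)))),
     - ((comm_laplacian g ** W_mat g) *v fst (fst z))))"
    by (auto simp: fun_eq_iff)
  then show ?thesis by (simp only:) (intro continuous_intros isCont_matrix)
qed

text \<open>The grid part of the field is continuous, so its convexification is a single point;
  equality is tested from both sides in every direction \<open>b\<close>.\<close>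

lemma filippov_tsm_grid_field:
  fixes z :: "('n::finite, 'm::finite) tsm_state"
  assumes q: "q \<in> filippov (tsm_field g \<alpha> a \<Lambda>) z"
  shows "fst q = grid_field g (fst (snd z)) (fst z)"
proof (rule vector_eq_rdot[THEN iffD1], rule allI)
  have fst: "fst (tsm_field g \<alpha> a \<Lambda> w) = grid_field g (fst (snd w)) (fst w)" for w
    by (cases w) auto
  fix b :: "('n, 'm) grid_state"
  have h: "bounded_linear (\<lambda>q::('n, 'm) tsm_state. fst q \<bullet> b)"
    by (rule bounded_linear_compose[OF bounded_linear_inner_left bounded_linear_fst])
  have w: "isCont (\<lambda>z::('n, 'm) tsm_state. grid_field g (fst (snd z)) (fst z) \<bullet> b) z"
    by (intro continuous_intros isCont_grid_field)
  have "fst q \<bullet> b \<le> grid_field g (fst (snd z)) (fst z) \<bullet> b"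
    by (rule filippov_le[OF q h w zero_less_one negligible_empty]) (simp add: fst)
  moreover have "grid_field g (fst (snd z)) (fst z) \<bullet> b \<le> fst q \<bullet> b"
    by (rule filippov_ge[OF q h w zero_less_one negligible_empty]) (simp add: fst)
  ultimately show "fst q \<bullet> b = grid_field g (fst (snd z)) (fst z) \<bullet> b" by simp
qed

definition scaled_estimate :: "'n \<Rightarrow> real \<Rightarrow> ('n::finite, 'm::finite) tsm_state \<Rightarrow> real \<times> real \<times> real" where
  "scaled_estimate i a z = (fst (snd (snd z)) $ i / a, fst (snd (snd (snd z))) $ i / a,
    snd (snd (snd (snd z))) $ i / a)"

text \<open>A strict sign of the continuous function \<open>sw\<close> persists in a ball, on which
  the control is constant off the null curve.\<close>

lemma filippov_tsm_input:
  fixes z :: "('n::finite, 'm::finite) tsm_state"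
  assumes q: "q \<in> filippov (tsm_field g \<alpha> a \<Lambda>) z" and a: "0 < a i" and \<alpha>: "0 < \<alpha> i"
  shows "\<bar>fst (snd q) $ i\<bar> \<le> \<alpha> i"
    and "0 < sw (scaled_estimate i (a i) z) \<Longrightarrow> fst (snd q) $ i \<le> - \<alpha> i"
    and "sw (scaled_estimate i (a i) z) < 0 \<Longrightarrow> \<alpha> i \<le> fst (snd q) $ i"
proof -
  let ?h = "\<lambda>q::('n, 'm) tsm_state. fst (snd q) $ i"
  let ?sw = "\<lambda>z::('n, 'm) tsm_state. sw (scaled_estimate i (a i) z)"
  let ?N = "{z :: ('n, 'm) tsm_state.
    sw_curve (fst (snd (snd (snd z))) $ i / a i) (snd (snd (snd (snd z))) $ i / a i) = 0}"
  have h: "bounded_linear ?h"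
    by (intro bounded_linear_compose[OF bounded_linear_vec_nth] bounded_linear_state)
  have field: "?h (tsm_field g \<alpha> a \<Lambda> w) = tsm_control (\<alpha> i) (a i) (fst (snd (snd w)) $ i)
      (fst (snd (snd (snd w))) $ i) (snd (snd (snd (snd w))) $ i)" for w
    by (cases w) auto
  have N: "negligible ?N" by (rule negligible_sw_curve[where a = "a i", OF a])
  have off: "?h (tsm_field g \<alpha> a \<Lambda> w) = - \<alpha> i * sgn (?sw w)" if "w \<notin> ?N" "?sw w \<noteq> 0" for w
    unfolding field using that by (simp add: scaled_estimate_def tsm_control_eq[OF a])
  have cont: "continuous_on UNIV ?sw"
    unfolding scaled_estimate_def using a
    by (intro continuous_on_compose2[OF continuous_on_sw] continuous_intros) auto
  have abs: "\<bar>?h (tsm_field g \<alpha> a \<Lambda> w)\<bar> \<le> \<alpha> i" for w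
    unfolding field by (rule abs_tsm_control_le[OF \<alpha>])
  have "?h q \<le> \<alpha> i"
    by (rule filippov_le[OF q h _ zero_less_one negligible_empty]) (use abs in \<open>auto simp: abs_le_iff\<close>)
  moreover have "- \<alpha> i \<le> ?h q"
    by (rule filippov_ge[OF q h _ zero_less_one negligible_empty])
      (use abs in \<open>auto simp: abs_le_iff minus_le_iff\<close>)
  ultimately show "\<bar>?h q\<bar> \<le> \<alpha> i" by simp
  show "?h q \<le> - \<alpha> i" if "0 < ?sw z"
  proof -
    have "open {w. 0 < ?sw w}" by (rule open_Collect_less[OF continuous_on_const cont])
    moreover have "z \<in> {w. 0 < ?sw w}" using that by simp
    ultimately obtain \<delta> where \<delta>: "0 < \<delta>" "ball z \<delta> \<subseteq> {w. 0 < ?sw w}" by (rule openE)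
    show ?thesis
    proof (rule filippov_le[OF q h _ \<delta>(1) N])
      fix w assume w: "w \<in> ball z \<delta>" "w \<notin> ?N"
      then have "0 < ?sw w" using \<delta>(2) by blast
      then show "?h (tsm_field g \<alpha> a \<Lambda> w) \<le> - \<alpha> i" using off[OF w(2)] by simp
    qed simp
  qed
  show "\<alpha> i \<le> ?h q" if "?sw z < 0"
  proof -
    have "open {w. ?sw w < 0}" by (rule open_Collect_less[OF cont continuous_on_const])
    moreover have "z \<in> {w. ?sw w < 0}" using that by simp
    ultimately obtain \<delta> where \<delta>: "0 < \<delta>" "ball z \<delta> \<subseteq> {w. ?sw w < 0}" by (rule openE)
    show ?thesis
    proof (rule filippov_ge[OF q h _ \<delta>(1) N])
      fix w assume w: "w \<in> ball z \<delta>" "w \<notin> ?N"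
      then have "?sw w < 0" using \<delta>(2) by blast
      then show "\<alpha> i \<le> ?h (tsm_field g \<alpha> a \<Lambda> w)" using off[OF w(2)] by simp
    qed simp
  qed
qed

lemma has_vector_derivative_vec_nth:
  "(f has_vector_derivative f') F \<Longrightarrow> ((\<lambda>t. f t $ i) has_vector_derivative f' $ i) F"
  by (rule bounded_linear.has_vector_derivative[OF bounded_linear_vec_nth])

lemma tsm_sliding_zero:
  fixes g :: "('n::finite, 'm::finite) microgrid"
  assumes sol: "grid_solution g x x' u"
    and G: "0 < Gmin" "Gmin \<le> G_d g $ i $ i"
    and a: "a i = \<alpha> i * Gmin - \<beta>" "0 < a i" and \<alpha>: "0 < \<alpha> i" and \<beta>: "0 < \<beta>"
    and u: "has_ac_derivative u u'"
    and fil: "AE t in lebesgue. t \<ge> 0 \<longrightarrow>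
      (\<exists>q. q \<in> filippov (tsm_field g \<alpha> a \<Lambda>) (x t, u t, (e1 t, e2 t, e3 t)) \<and> fst (snd q) = u' t)"
    and T: "0 \<le> T"
    and e1: "\<And>t. T < t \<Longrightarrow> e1 t = sliding g (x t)"
    and e2: "\<And>t. T < t \<Longrightarrow> ((\<lambda>s. sliding g (x s)) has_vector_derivative e2 t) (at t)"
    and e3: "\<And>t. T < t \<Longrightarrow> (e2 has_vector_derivative e3 t) (at t)"
    and b: "has_ac_derivative (\<lambda>t. b_term g (u t) (x t)) b'"
    and b\<beta>: "AE t in lebesgue. t \<ge> 0 \<longrightarrow> \<bar>b' t $ i\<bar> \<le> \<beta>"
  shows "\<exists>T\<ge>0. \<forall>t\<ge>T. sliding g (x t) $ i = 0"
proof -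
  interpret grid_solution g x x' u by (rule sol)
  let ?G = "G_d g $ i $ i" and ?a = "a i" and ?\<alpha> = "\<alpha> i"
  \<comment> \<open>Exact estimates are derivatives of \<sigma>, and uniqueness of derivatives
    identifies \<open>e2\<close> and then \<open>e3\<close> with functions whose increments are
    controlled.\<close>
  have e2_rate: "e2 t = sliding_rate g (x t)" if "T < t" for t
    using vector_derivative_unique_at[OF e2[OF that] sliding_derivative] T that by simp
  let ?c = "\<lambda>t. b_term g (u t) (x t) + G_d g *v u t"
  have c: "has_ac_derivative ?c (\<lambda>t. b' t + G_d g *v u' t)"
    by (intro has_ac_derivative_add b has_ac_derivative_linear[OF u matrix_vector_mul_bounded_linear])
  have rate_der: "((\<lambda>t. sliding_rate g (x t)) has_vector_derivative ?c t) (at t)" if "0 < t" for t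
  proof (rule has_ac_derivative_vector_derivative[OF rate_ac has_ac_derivative_continuous[OF c] _ that])
    show "AE t in lebesgue. 0 \<le> t \<longrightarrow> rate_lin g (x' t) = ?c t"
      using ae by eventually_elim (simp add: rate_lin_grid_field)
  qed
  have e3_c: "e3 t = ?c t" if t: "T < t" for t
  proof -
    have "(e2 has_vector_derivative ?c t) (at t)"
    proof (rule has_vector_derivative_transform_within_open[OF rate_der, of _ "{T<..}"])
      show "0 < t" using T t by simp
    qed (use t e2_rate in auto)
    then show ?thesis using vector_derivative_unique_at[OF e3[OF t]] by simp
  qed
  \<comment> \<open>Dividing by \<open>?a\<close> turns the guaranteed jerk
    \<open>\<alpha> i * Gmin - \<beta>\<close> into 1.\<close>
  let ?y1 = "\<lambda>t. sliding g (x t) $ i / ?a" and ?y2 = "\<lambda>t. e2 t $ i / ?a" and ?y3 = "\<lambda>t. e3 t $ i / ?a"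
  let ?w = "\<lambda>t. b' t $ i + ?G * u' t $ i"
  have ci: "has_ac_derivative (\<lambda>t. ?c t $ i) ?w"
    using has_ac_derivative_linear[OF c bounded_linear_vec_nth[of i]] by (simp add: G_d_mult[OF g])
  have G\<alpha>: "Gmin * ?\<alpha> \<le> ?G * ?\<alpha>" using G \<alpha> by (intro mult_right_mono) auto
  have G0: "0 \<le> ?G" using G by simp
  have bounds: "AE t in lebesgue. T < t \<longrightarrow> \<bar>?w t\<bar> \<le> ?G * ?\<alpha> + \<beta> \<and>
      (0 < sw (?y1 t, ?y2 t, ?y3 t) \<longrightarrow> ?w t \<le> - ?a) \<and>
      (sw (?y1 t, ?y2 t, ?y3 t) < 0 \<longrightarrow> ?a \<le> ?w t)"
    using fil b\<beta>
  proof eventually_elim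
    case (elim t)
    show ?case
    proof
      assume t: "T < t"
      then have t0: "0 \<le> t" using T by simp
      then obtain q where q: "q \<in> filippov (tsm_field g \<alpha> a \<Lambda>) (x t, u t, (e1 t, e2 t, e3 t))"
        "fst (snd q) = u' t" using elim by blast
      have b': "\<bar>b' t $ i\<bar> \<le> \<beta>" using elim t0 by simp
      have y: "scaled_estimate i ?a (x t, u t, (e1 t, e2 t, e3 t)) = (?y1 t, ?y2 t, ?y3 t)"
        by (simp add: scaled_estimate_def e1[OF t])
      note v = filippov_tsm_input[OF q(1), of i, OF a(2) \<alpha>, unfolded q(2) y]
      have "\<bar>?G * u' t $ i\<bar> \<le> ?G * ?\<alpha>" unfolding abs_mult using v(1) G0 by (simp add: mult_left_mono)
      then have "\<bar>?w t\<bar> \<le> ?G * ?\<alpha> + \<beta>" using b' by linarith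
      moreover have "?w t \<le> - ?a" if "0 < sw (?y1 t, ?y2 t, ?y3 t)"
      proof -
        have "?G * u' t $ i \<le> ?G * - ?\<alpha>" using v(2)[OF that] G0 by (rule mult_left_mono)
        then show ?thesis using b' G\<alpha> a(1) by (simp add: mult.commute[of ?\<alpha>])
      qed
      moreover have "?a \<le> ?w t" if "sw (?y1 t, ?y2 t, ?y3 t) < 0"
      proof -
        have "?G * ?\<alpha> \<le> ?G * u' t $ i" using v(3)[OF that] G0 by (rule mult_left_mono)
        then show ?thesis using b' G\<alpha> a(1) by (simp add: mult.commute[of ?\<alpha>])
      qed
      ultimately show "\<bar>?w t\<bar> \<le> ?G * ?\<alpha> + \<beta> \<and>
          (0 < sw (?y1 t, ?y2 t, ?y3 t) \<longrightarrow> ?w t \<le> - ?a) \<and>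
          (sw (?y1 t, ?y2 t, ?y3 t) < 0 \<longrightarrow> ?a \<le> ?w t)" by blast
    qed
  qed
  \<comment> \<open>The differentiator is exact for \<open>t > T\<close>, whereas the locale
    includes its starting time; hence \<open>T + 1\<close>.\<close>
  interpret triple_integrator "T + 1" "(?G * ?\<alpha> + \<beta>) / ?a" ?y1 ?y2 ?y3
  proof
    fix t :: real assume "T + 1 \<le> t"
    then have t: "T < t" by simp
    show "(?y1 has_real_derivative ?y2 t) (at t)" "(?y2 has_real_derivative ?y3 t) (at t)"
      using has_vector_derivative_vec_nth[OF e2[OF t], of i] has_vector_derivative_vec_nth[OF e3[OF t], of i]
      by (auto intro!: DERIV_cdivide simp: has_real_derivative_iff_has_vector_derivative[symmetric])
  next
    fix p q :: real assume pq: "T + 1 \<le> p" "p \<le> q"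
    then have p0: "0 \<le> p" using T by simp
    have y3: "?y3 q - ?y3 p = (?c q $ i - ?c p $ i) / ?a"
      using e3_c pq by (simp add: diff_divide_distrib)
    have up: "?y3 q - ?y3 p \<le> k / ?a * (q - p)" if "AE t in lebesgue. p < t \<longrightarrow> t < q \<longrightarrow> ?w t \<le> k" for k
    proof -
      have "?c q $ i - ?c p $ i \<le> k * (q - p)" by (rule has_ac_derivative_le[OF ci p0 pq(2) that])
      then show ?thesis unfolding y3 using a(2) by (simp add: divide_right_mono)
    qed
    have low: "k / ?a * (q - p) \<le> ?y3 q - ?y3 p" if "AE t in lebesgue. p < t \<longrightarrow> t < q \<longrightarrow> k \<le> ?w t" for k
    proof -
      have "k * (q - p) \<le> ?c q $ i - ?c p $ i" by (rule has_ac_derivative_ge[OF ci p0 pq(2) that])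
      then show ?thesis unfolding y3 using a(2) by (simp add: divide_right_mono)
    qed
    have "?y3 q - ?y3 p \<le> (?G * ?\<alpha> + \<beta>) / ?a * (q - p)"
      by (rule up, use bounds in eventually_elim) (use pq in auto)
    moreover have "(- (?G * ?\<alpha> + \<beta>)) / ?a * (q - p) \<le> ?y3 q - ?y3 p"
      by (rule low, use bounds in eventually_elim) (use pq in auto)
    moreover have "(- (?G * ?\<alpha> + \<beta>)) / ?a * (q - p) = - ((?G * ?\<alpha> + \<beta>) / ?a * (q - p))"
      by (simp only: minus_divide_left mult_minus_left)
    ultimately show "\<bar>?y3 q - ?y3 p\<bar> \<le> (?G * ?\<alpha> + \<beta>) / ?a * (q - p)" by linarith
    show "?y3 q - ?y3 p \<le> - (q - p)" if "\<And>t. p < t \<Longrightarrow> t < q \<Longrightarrow> 0 < sw (?y1 t, ?y2 t, ?y3 t)"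
    proof -
      have "?y3 q - ?y3 p \<le> (- ?a) / ?a * (q - p)"
        by (rule up, use bounds in eventually_elim) (use pq that in auto)
      then show ?thesis using a(2) by simp
    qed
    show "q - p \<le> ?y3 q - ?y3 p" if "\<And>t. p < t \<Longrightarrow> t < q \<Longrightarrow> sw (?y1 t, ?y2 t, ?y3 t) < 0"
    proof -
      have "?a / ?a * (q - p) \<le> ?y3 q - ?y3 p"
        by (rule low, use bounds in eventually_elim) (use pq that in auto)
      then show ?thesis using a(2) by simp
    qed
  qed
  obtain T' where "T + 1 \<le> T'" "\<forall>t\<ge>T'. ?y1 t = 0" using finite_time_convergence by blast
  then show ?thesis using a(2) T by (intro exI[of _ T']) auto
qed

section \<open>Voltage balance for the two schemes\<close>

lemma tsm_voltage_balance:
  fixes g :: "('n::finite, 'm::finite) microgrid"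
  assumes "microgrid g"
    and "\<And>i. 0 < Gmin i \<and> 0 < Gmax i \<and> Gmin i \<le> G_d g $ i $ i \<and> G_d g $ i $ i \<le> Gmax i"
    and "(\<chi> i. 1) \<bullet> snd (snd (snd (x 0))) = 0"
    and "tsm_closed_loop g Gmin \<beta>max \<alpha> \<Lambda> x u"
  shows "\<exists>T\<ge>0. \<forall>t\<ge>T. (\<chi> i. 1) \<bullet> (matrix_inv (W_mat g) *v fst (snd (x t))) =
    (\<chi> i. 1) \<bullet> (matrix_inv (W_mat g) *v V_ref g)"
proof -
  let ?a = "\<lambda>i. \<alpha> i * Gmin i - \<beta>max i"
  have par: "0 < \<beta>max i" "0 < \<alpha> i" "0 < ?a i" for i
    using assms(4) by (auto simp: tsm_closed_loop_def)
  obtain z' e1 e2 e3 where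
    sol: "filippov_solution (\<lambda>t. tsm_field g \<alpha> ?a \<Lambda>) (\<lambda>t. (x t, u t, (e1 t, e2 t, e3 t))) z'" and
    ex: "\<exists>T\<ge>0. \<forall>t>T. e1 t = sliding g (x t) \<and>
        ((\<lambda>s. sliding g (x s)) has_vector_derivative e2 t) (at t) \<and> (e2 has_vector_derivative e3 t) (at t)"
    using assms(4) unfolding tsm_closed_loop_def by blast
  obtain T where T: "0 \<le> T" "\<And>t. T < t \<Longrightarrow> e1 t = sliding g (x t)"
    "\<And>t. T < t \<Longrightarrow> ((\<lambda>s. sliding g (x s)) has_vector_derivative e2 t) (at t)"
    "\<And>t. T < t \<Longrightarrow> (e2 has_vector_derivative e3 t) (at t)" using ex by blast
  obtain b' where b: "has_ac_derivative (\<lambda>t. b_term g (u t) (x t)) b'"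
    "\<And>i. AE t in lebesgue. t \<ge> 0 \<longrightarrow> \<bar>b' t $ i\<bar> \<le> \<beta>max i"
    using assms(4) unfolding tsm_closed_loop_def by blast
  have ac: "has_ac_derivative (\<lambda>t. (x t, u t, (e1 t, e2 t, e3 t))) z'"
    and fil: "AE t in lebesgue. t \<ge> 0 \<longrightarrow> z' t \<in> filippov (tsm_field g \<alpha> ?a \<Lambda>) (x t, u t, (e1 t, e2 t, e3 t))"
    using sol by (auto simp: filippov_solution_def)
  have xac: "has_ac_derivative x (\<lambda>t. fst (z' t))"
    using has_ac_derivative_linear[OF ac bounded_linear_fst] by simp
  have uac: "has_ac_derivative u (\<lambda>t. fst (snd (z' t)))"
    using has_ac_derivative_linear[OF ac bounded_linear_fst_comp[OF bounded_linear_snd]] by simp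
  interpret grid_solution g x "\<lambda>t. fst (z' t)" u
  proof
    show "AE t in lebesgue. t \<ge> 0 \<longrightarrow> fst (z' t) = grid_field g (u t) (x t)"
      using fil by eventually_elim (use filippov_tsm_grid_field in fastforce)
  qed (fact assms(1) xac)+
  have sol': "grid_solution g x (\<lambda>t. fst (z' t)) u" by unfold_locales
  show ?thesis
  proof (rule voltage_balance[OF _ assms(3)])
    fix i
    have "AE t in lebesgue. t \<ge> 0 \<longrightarrow> (\<exists>q. q \<in> filippov (tsm_field g \<alpha> ?a \<Lambda>)
        (x t, u t, (e1 t, e2 t, e3 t)) \<and> fst (snd q) = fst (snd (z' t)))"
      using fil by eventually_elim blast
    from tsm_sliding_zero[OF sol' _ _ _ par(3,2,1) uac this T b(1) b(2)]
    show "\<exists>T\<ge>0. \<forall>t\<ge>T. sliding g (x t) $ i = 0" using assms(2)[of i] by blast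
  qed
qed

lemma ssosm_voltage_balance:
  fixes g :: "('n::finite, 'm::finite) microgrid"
  assumes g: "microgrid g"
    and G: "\<And>i. 0 < Gmin i \<and> 0 < Gmax i \<and> Gmin i \<le> G_d g $ i $ i \<and> G_d g $ i $ i \<le> Gmax i"
    and \<theta>: "(\<chi> i. 1) \<bullet> snd (snd (snd (x 0))) = 0"
    and loop: "ssosm_closed_loop g Gmin Gmax bmax \<mu>s Umax x u"
  shows "\<exists>T\<ge>0. \<forall>t\<ge>T. (\<chi> i. 1) \<bullet> (matrix_inv (W_mat g) *v fst (snd (x t))) =
    (\<chi> i. 1) \<bullet> (matrix_inv (W_mat g) *v V_ref g)"
proof -
  have par: "0 < bmax i" "0 < \<mu>s i" "\<mu>s i \<le> 1" "\<mu>s i < 3 * Gmin i / Gmax i"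
    "bmax i / (\<mu>s i * Gmin i) < Umax i" "4 * bmax i / (3 * Gmin i - \<mu>s i * Gmax i) < Umax i" for i
    using loop by (auto simp: ssosm_closed_loop_def)
  obtain x' m where m: "\<And>i. stores_extremum (\<lambda>t. sliding g (x t) $ i) (\<lambda>t. m t $ i)" and
    sol: "filippov_solution
      (\<lambda>t z. grid_field g (\<chi> i. ssosm_input (\<mu>s i) (Umax i) (m t $ i) (sliding g z $ i)) z) x x'" and
    u: "AE t in lebesgue. t \<ge> 0 \<longrightarrow> x' t = grid_field g (u t) (x t)"
    using loop unfolding ssosm_closed_loop_def by blast
  have b: "AE t in lebesgue. t \<ge> 0 \<longrightarrow> \<bar>b_term g (u t) (x t) $ i\<bar> \<le> bmax i" for i
    using loop unfolding ssosm_closed_loop_def by blast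
  have ac: "has_ac_derivative x x'" and fil: "AE t in lebesgue. t \<ge> 0 \<longrightarrow> x' t \<in> filippov
      (\<lambda>z. grid_field g (\<chi> i. ssosm_input (\<mu>s i) (Umax i) (m t $ i) (sliding g z $ i)) z) (x t)"
    using sol by (auto simp: filippov_solution_def)
  interpret grid_solution g x x' u using g ac u by unfold_locales
  have sol': "grid_solution g x x' u" by unfold_locales
  show ?thesis
  proof (rule voltage_balance[OF _ \<theta>])
    fix i
    show "\<exists>T\<ge>0. \<forall>t\<ge>T. sliding g (x t) $ i = 0"
      using G[of i]
      by (intro ssosm_sliding_zero[OF sol' _ _ _ par(2,3,1,5,6,4) m fil b]) auto
  qed
qed

theorem theorem2:
  fixes g :: "('n::finite, 'm::finite) microgrid"
    and It V \<theta> u :: "real \<Rightarrow> real^'n"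
    and I :: "real \<Rightarrow> real^'m"
    and Gmin Gmax bmax \<mu>s Umax \<beta>max \<alpha> \<Lambda> :: "'n \<Rightarrow> real"
  assumes "microgrid g"
    and "\<And>i. 0 < Gmin i \<and> 0 < Gmax i \<and> Gmin i \<le> G_d g $ i $ i \<and> G_d g $ i $ i \<le> Gmax i"
    and "(\<chi> i. 1) \<bullet> \<theta> 0 = 0"
    and "ssosm_closed_loop g Gmin Gmax bmax \<mu>s Umax (\<lambda>t. (It t, V t, I t, \<theta> t)) u \<or>
         tsm_closed_loop g Gmin \<beta>max \<alpha> \<Lambda> (\<lambda>t. (It t, V t, I t, \<theta> t)) u"
  shows "\<exists>T\<^sub>r\<ge>0. \<forall>t\<ge>T\<^sub>r. (\<chi> i. 1) \<bullet> (matrix_inv (W_mat g) *v V t) =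
                      (\<chi> i. 1) \<bullet> (matrix_inv (W_mat g) *v V_ref g)"
proof -
  let ?x = "\<lambda>t. (It t, V t, I t, \<theta> t)"
  have \<theta>0: "(\<chi> i. 1) \<bullet> snd (snd (snd (?x 0))) = 0" using assms(3) by simp
  show ?thesis
    using assms(4) ssosm_voltage_balance[where x = ?x, OF assms(1,2) \<theta>0]
      tsm_voltage_balance[where x = ?x, OF assms(1,2) \<theta>0]
    by auto
qed

end
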